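(* Let $n\ge 1$ be an integer, let $\mathcal{H}=L^2(\mathbb{R}^n)$, and let $p>\frac{4n}{2n-1}$ be a real number. Then there exists a non-zero operator $A\in S^p(\mathcal{H})$ whose quantum translates are linearly dependent; that is, there exist $k\ge 1$, distinct elements $(x_1,y_1),\dots,(x_k,y_k)$ of $\mathbb{R}^{2n}$ (with $x_j,y_j\in\mathbb{R}^n$), and scalars $c_1,\dots,c_k\in\mathbb{C}$, not all zero, such that $\sum_{j=1}^k c_j\,(x_j,y_j)\cdot A=0$.
   Context: $\mathcal{H}=L^2(\mathbb{R}^n)$ is the complex Hilbert space of square-integrable functions, and $S^p(\mathcal{H})$ denotes the $p$-Schatten class of operators on $\mathcal{H}$. For $x,y\in\mathbb{R}^n$ and $z\in\mathbb{C}$ with $|z|=1$, $\rho(x,y,z)$ is the unitary operator on $\mathcal{H}$ given by $$(\rho(x,y,z)\varphi)(t)=z\,e^{\pi i(x\cdot y+2y\cdot t)}\varphi(t+x),\qquad \varphi\in\mathcal{H},\ t\in\mathbb{R}^n$$ (the Schrödinger representation of the reduced Heisenberg group, whose multiplication is $(x,y,z)(x',y',z')=(x+x',y+y',zz'e^{\pi i(x\cdot y'-y\cdot x')})$). The quantum translate of an operator $X\in S^p(\mathcal{H})$ by $(x,y)\in\mathbb{R}^{2n}$ is $$(x,y)\cdot X=\rho(x,y,1)\,X\,\rho(x,y,1)^{-1}.$$ *)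

theory Defs
  imports "HOL-Analysis.Analysis"
begin

definition square_integrable :: "('a::euclidean_space \<Rightarrow> complex) \<Rightarrow> bool" where
  "square_integrable f \<longleftrightarrow>
     f \<in> borel_measurable lborel \<and> integrable lborel (\<lambda>t. (cmod (f t))\<^sup>2)"

definition l2_rel :: "('a::euclidean_space \<Rightarrow> complex) \<Rightarrow> ('a \<Rightarrow> complex) \<Rightarrow> bool" where
  "l2_rel f g \<longleftrightarrow> square_integrable f \<and> square_integrable g \<and> (AE t in lborel. f t = g t)"

lemma square_integrable_zero: "square_integrable (\<lambda>_. 0)"
  by (simp add: square_integrable_def)

lemma square_integrable_cmult:
  assumes "square_integrable f"
  shows "square_integrable (\<lambda>t. c * f t)"
  using assms by (auto simp: square_integrable_def norm_mult power_mult_distrib)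

lemma square_integrable_add:
  assumes "square_integrable f" "square_integrable g"
  shows "square_integrable (\<lambda>t. f t + g t)"
proof -
  have [measurable]: "f \<in> borel_measurable lborel" "g \<in> borel_measurable lborel"
    using assms by (auto simp: square_integrable_def)
  have bound: "(cmod (a + b))\<^sup>2 \<le> 2 * (cmod a)\<^sup>2 + 2 * (cmod b)\<^sup>2" for a b
  proof -
    have "(cmod (a + b))\<^sup>2 \<le> (cmod a + cmod b)\<^sup>2"
      by (intro power_mono norm_triangle_ineq) auto
    also have "\<dots> \<le> 2 * (cmod a)\<^sup>2 + 2 * (cmod b)\<^sup>2"
      using sum_squares_bound[of "cmod a" "cmod b"] by (simp add: power2_sum)
    finally show ?thesis .
  qed
  have "integrable lborel (\<lambda>t. (cmod (f t + g t))\<^sup>2)"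
  proof (rule Bochner_Integration.integrable_bound)
    show "integrable lborel (\<lambda>t. 2 * (cmod (f t))\<^sup>2 + 2 * (cmod (g t))\<^sup>2)"
      using assms by (auto simp: square_integrable_def)
  qed (use bound in \<open>auto simp: abs_of_nonneg intro: order_trans\<close>)
  then show ?thesis by (simp add: square_integrable_def)
qed

lemma measurable_mult_cnj:
  fixes f g :: "'a::euclidean_space \<Rightarrow> complex"
  assumes "f \<in> borel_measurable borel" "g \<in> borel_measurable borel"
  shows "(\<lambda>t. f t * cnj (g t)) \<in> borel_measurable borel"
proof -
  have "cnj \<in> borel_measurable borel"
    by (intro borel_measurable_continuous_onI continuous_intros)
  then have "(\<lambda>t. cnj (g t)) \<in> borel_measurable borel"
    using assms(2) by (rule measurable_compose[rotated])
  with assms(1) show ?thesis by (rule borel_measurable_times)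
qed

lemma square_integrable_mult_cnj:
  assumes "square_integrable f" "square_integrable g"
  shows "integrable lborel (\<lambda>t. f t * cnj (g t))"
proof (rule Bochner_Integration.integrable_bound)
  have [measurable]: "f \<in> borel_measurable lborel" "g \<in> borel_measurable lborel"
    using assms by (auto simp: square_integrable_def)
  show "integrable lborel (\<lambda>t. (cmod (f t))\<^sup>2 + (cmod (g t))\<^sup>2)"
    using assms by (auto simp: square_integrable_def)
  show "(\<lambda>t. f t * cnj (g t)) \<in> borel_measurable lborel"
    using assms by (simp add: square_integrable_def measurable_mult_cnj)
  have "cmod (a * cnj b) \<le> (cmod a)\<^sup>2 + (cmod b)\<^sup>2" for a b
  proof -
    have "0 \<le> cmod a * cmod b" by simp
    then have "cmod a * cmod b \<le> (cmod a)\<^sup>2 + (cmod b)\<^sup>2"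
      using sum_squares_bound[of "cmod a" "cmod b"] by linarith
    then show ?thesis by (simp add: norm_mult)
  qed
  then show "AE t in lborel. norm (f t * cnj (g t)) \<le> norm ((cmod (f t))\<^sup>2 + (cmod (g t))\<^sup>2)"
    by (auto intro: order_trans)
qed

quotient_type (overloaded) 'a L2 = "'a::euclidean_space \<Rightarrow> complex" / partial: l2_rel
proof (rule part_equivpI)
  show "\<exists>f :: 'a \<Rightarrow> complex. l2_rel f f"
    using square_integrable_zero by (auto simp: l2_rel_def)
  show "symp (l2_rel :: ('a \<Rightarrow> complex) \<Rightarrow> _)"
    by (auto simp: l2_rel_def intro!: sympI)
  show "transp (l2_rel :: ('a \<Rightarrow> complex) \<Rightarrow> _)"
  proof (rule transpI)
    fix f g h :: "'a \<Rightarrow> complex"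
    assume "l2_rel f g" "l2_rel g h"
    then show "l2_rel f h" unfolding l2_rel_def by (auto elim: AE_mp)
  qed
qed

lift_definition scaleC :: "complex \<Rightarrow> 'a::euclidean_space L2 \<Rightarrow> 'a L2" (infixr "*\<^sub>C" 75)
  is "\<lambda>c f t. c * f t"
  by (auto simp: l2_rel_def square_integrable_cmult)

lift_definition cinner :: "'a::euclidean_space L2 \<Rightarrow> 'a L2 \<Rightarrow> complex"
  is "\<lambda>f g. \<integral>t. f t * cnj (g t) \<partial>lborel"
proof -
  fix f f' g g' :: "'a \<Rightarrow> complex"
  assume "l2_rel f f'" "l2_rel g g'"
  then show "(\<integral>t. f t * cnj (g t) \<partial>lborel) = (\<integral>t. f' t * cnj (g' t) \<partial>lborel)"
    by (intro integral_cong_AE)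
       (auto simp: l2_rel_def square_integrable_def measurable_mult_cnj elim: AE_mp)
qed

instantiation L2 :: (euclidean_space) real_inner
begin

lift_definition zero_L2 :: "'a L2" is "\<lambda>_. 0"
  by (simp add: l2_rel_def square_integrable_zero)

lift_definition plus_L2 :: "'a L2 \<Rightarrow> 'a L2 \<Rightarrow> 'a L2" is "\<lambda>f g t. f t + g t"
  by (auto simp: l2_rel_def square_integrable_add)

definition uminus_L2 :: "'a L2 \<Rightarrow> 'a L2" where
  "- f = (-1) *\<^sub>C f"

definition minus_L2 :: "'a L2 \<Rightarrow> 'a L2 \<Rightarrow> 'a L2" where
  "f - g = f + - g" for f g :: "'a L2"

definition scaleR_L2 :: "real \<Rightarrow> 'a L2 \<Rightarrow> 'a L2" where
  "r *\<^sub>R f = complex_of_real r *\<^sub>C f"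

definition inner_L2 :: "'a L2 \<Rightarrow> 'a L2 \<Rightarrow> real" where
  "f \<bullet> g = Re (cinner f g)"

definition norm_L2 :: "'a L2 \<Rightarrow> real" where
  "norm f = sqrt (f \<bullet> f)" for f :: "'a L2"

definition sgn_L2 :: "'a L2 \<Rightarrow> 'a L2" where
  "sgn f = inverse (norm f) *\<^sub>R f" for f :: "'a L2"

definition dist_L2 :: "'a L2 \<Rightarrow> 'a L2 \<Rightarrow> real" where
  "dist f g = norm (f - g)" for f g :: "'a L2"

definition uniformity_L2 :: "('a L2 \<times> 'a L2) filter" where
  "uniformity_L2 = (INF e\<in>{0<..}. principal {(f, g). dist f g < e})"

definition open_L2 :: "'a L2 set \<Rightarrow> bool" where
  "open_L2 U \<longleftrightarrow> (\<forall>f\<in>U. \<forall>\<^sub>F (f', g) in uniformity. f' = f \<longrightarrow> g \<in> U)"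

instance
proof
  fix f g h :: "'a L2" and r s :: real
  show "f + g + h = f + (g + h)"
    by transfer (auto simp: l2_rel_def add.assoc intro!: square_integrable_add)
  show "f + g = g + f"
    by transfer (auto simp: l2_rel_def add.commute intro!: square_integrable_add)
  show "0 + f = f"
    by transfer (auto simp: l2_rel_def)
  show "- f + f = 0"
    unfolding uminus_L2_def
    by transfer (auto simp: l2_rel_def square_integrable_zero)
  show "f - g = f + - g"
    by (rule minus_L2_def)
  show "r *\<^sub>R (f + g) = r *\<^sub>R f + r *\<^sub>R g"
    unfolding scaleR_L2_def
    by transfer (auto simp: l2_rel_def distrib_left
        intro!: square_integrable_cmult square_integrable_add)
  show "(r + s) *\<^sub>R f = r *\<^sub>R f + s *\<^sub>R f"
    unfolding scaleR_L2_def of_real_add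
    by transfer (auto simp: l2_rel_def distrib_right
        intro!: square_integrable_cmult square_integrable_add)
  show "r *\<^sub>R s *\<^sub>R f = (r * s) *\<^sub>R f"
    unfolding scaleR_L2_def of_real_mult
    by transfer (auto simp: l2_rel_def mult.assoc intro!: square_integrable_cmult)
  show "1 *\<^sub>R f = f"
    unfolding scaleR_L2_def of_real_1
    by transfer (auto simp: l2_rel_def)
  show "sgn f = inverse (norm f) *\<^sub>R f" by (rule sgn_L2_def)
  show "dist f g = norm (f - g)" by (rule dist_L2_def)
  show "uniformity = (INF e\<in>{0<..}. principal {(f, g::'a L2). dist f g < e})"
    by (rule uniformity_L2_def)
  show "open U \<longleftrightarrow> (\<forall>f\<in>U. \<forall>\<^sub>F (f', g) in uniformity. f' = f \<longrightarrow> g \<in> U)"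
    for U :: "'a L2 set"
    by (rule open_L2_def)
  have flip: "Re (\<integral>t. a t * cnj (b t) \<partial>lborel) = Re (\<integral>t. b t * cnj (a t) \<partial>lborel)"
    for a b :: "'a \<Rightarrow> complex"
  proof -
    have "(\<integral>t. b t * cnj (a t) \<partial>lborel) = (\<integral>t. cnj (a t * cnj (b t)) \<partial>lborel)"
      by (simp add: mult.commute)
    also have "\<dots> = cnj (\<integral>t. a t * cnj (b t) \<partial>lborel)"
      by (rule Bochner_Integration.integral_cnj)
    finally show ?thesis by simp
  qed
  show "f \<bullet> g = g \<bullet> f"
    unfolding inner_L2_def by transfer (rule flip)
  show "(f + g) \<bullet> h = f \<bullet> h + g \<bullet> h"
    unfolding inner_L2_def
    by transfer (auto simp: l2_rel_def distrib_right square_integrable_mult_cnj)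
  show "(r *\<^sub>R f) \<bullet> g = r * (f \<bullet> g)"
    unfolding inner_L2_def scaleR_L2_def
    by transfer (auto simp: l2_rel_def mult.assoc)
  have sq: "Re (\<integral>t. a t * cnj (a t) \<partial>lborel) = (\<integral>t. (cmod (a t))\<^sup>2 \<partial>lborel)"
    for a :: "'a \<Rightarrow> complex"
    by (simp add: complex_norm_square[symmetric] del: of_real_power)
  show "0 \<le> f \<bullet> f"
    unfolding inner_L2_def by transfer (simp add: sq)
  show "f \<bullet> f = 0 \<longleftrightarrow> f = 0"
    unfolding inner_L2_def
  proof transfer
    fix a :: "'a \<Rightarrow> complex"
    assume "l2_rel a a"
    then have a: "square_integrable a" by (simp add: l2_rel_def)
    have "Re (\<integral>t. a t * cnj (a t) \<partial>lborel) = 0 \<longleftrightarrow> (AE t in lborel. (cmod (a t))\<^sup>2 = 0)"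
      unfolding sq using a
      by (intro integral_nonneg_eq_0_iff_AE) (auto simp: square_integrable_def)
    then show "Re (\<integral>t. a t * cnj (a t) \<partial>lborel) = 0 \<longleftrightarrow> l2_rel a (\<lambda>_. 0)"
      using a by (simp add: l2_rel_def square_integrable_zero)
  qed
  show "norm f = sqrt (f \<bullet> f)" by (rule norm_L2_def)
qed

end

global_interpretation L2: vector_space "scaleC :: complex \<Rightarrow> 'a::euclidean_space L2 \<Rightarrow> 'a L2"
proof
  fix a b :: complex and f g :: "'a L2"
  show "a *\<^sub>C (f + g) = a *\<^sub>C f + a *\<^sub>C g"
    by transfer (auto simp: l2_rel_def distrib_left
        intro!: square_integrable_cmult square_integrable_add)
  show "(a + b) *\<^sub>C f = a *\<^sub>C f + b *\<^sub>C f"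
    by transfer (auto simp: l2_rel_def distrib_right
        intro!: square_integrable_cmult square_integrable_add)
  show "a *\<^sub>C b *\<^sub>C f = (a * b) *\<^sub>C f"
    by transfer (auto simp: l2_rel_def mult.assoc intro!: square_integrable_cmult)
  show "1 *\<^sub>C f = f"
    by transfer (auto simp: l2_rel_def)
qed

definition compact_operator :: "('a::euclidean_space L2 \<Rightarrow> 'a L2) \<Rightarrow> bool" where
  "compact_operator A \<longleftrightarrow>
     Vector_Spaces.linear scaleC scaleC A \<and> compact (closure (A ` cball 0 1))"

text \<open>For a bounded operator the adjoint exists by the Riesz representation theorem and is unique,
  so \<open>SOME\<close> then picks the adjoint.\<close>

definition cadjoint :: "('a::euclidean_space L2 \<Rightarrow> 'a L2) \<Rightarrow> 'a L2 \<Rightarrow> 'a L2" where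
  "cadjoint A = (SOME B. \<forall>f g. cinner (A f) g = cinner f (B g))"

definition singular_space :: "('a::euclidean_space L2 \<Rightarrow> 'a L2) \<Rightarrow> real \<Rightarrow> 'a L2 set" where
  "singular_space A s = {f. cadjoint A (A f) = complex_of_real (s\<^sup>2) *\<^sub>C f}"

definition singular_values :: "('a::euclidean_space L2 \<Rightarrow> 'a L2) \<Rightarrow> real set" where
  "singular_values A = {s. s > 0 \<and> (\<exists>f\<in>singular_space A s. f \<noteq> 0)}"

text \<open>The multiplicity of \<open>s\<close> is the complex dimension of the eigenspace of
  \<open>A* A\<close> at the eigenvalue \<open>s\<^sup>2\<close>; for compact \<open>A\<close> and \<open>s > 0\<close> it is finite, so the convention that
  the dimension of an infinite-dimensional space is \<open>0\<close> plays no role.\<close>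

definition schatten_class :: "real \<Rightarrow> ('a::euclidean_space L2 \<Rightarrow> 'a L2) set" where
  "schatten_class p = {A. compact_operator A \<and>
     (\<lambda>s. real (L2.dim (singular_space A s)) * s powr p) summable_on singular_values A}"

lemma square_integrable_shift:
  fixes x :: "'a::euclidean_space"
  assumes "square_integrable f"
  shows "square_integrable (\<lambda>t. f (t + x))"
proof -
  have [measurable]: "f \<in> borel_measurable borel"
    using assms by (simp add: square_integrable_def)
  have "integrable (distr lborel borel ((+) x)) (\<lambda>t. (cmod (f t))\<^sup>2)"
    using assms by (simp add: square_integrable_def lborel_distr_plus)
  then have "integrable lborel (\<lambda>t. (cmod (f (x + t)))\<^sup>2)"
    by (subst (asm) integrable_distr_eq) auto
  then show ?thesis
    by (simp add: square_integrable_def add.commute)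
qed

lemma AE_lborel_shift:
  fixes x :: "'a::euclidean_space"
  assumes "AE t in lborel. P t"
  shows "AE t in lborel. P (t + x)"
proof -
  have "AE t in distr lborel borel ((+) x). P t"
    using assms unfolding lborel_distr_plus .
  then have "AE t in lborel. P (x + t)"
    by (rule AE_distrD[rotated]) simp
  then show ?thesis by (simp add: add.commute)
qed

definition schroedinger_phase :: "'a::euclidean_space \<Rightarrow> 'a \<Rightarrow> 'a \<Rightarrow> complex" where
  "schroedinger_phase x y t = exp (complex_of_real pi * \<i> * complex_of_real (x \<bullet> y + 2 * (y \<bullet> t)))"

lemma norm_schroedinger_phase: "cmod (schroedinger_phase x y t) = 1"
  by (simp add: schroedinger_phase_def)

lemma l2_rel_schroedinger:
  assumes fg: "l2_rel f g"
  shows "l2_rel (\<lambda>t. z * schroedinger_phase x y t * f (t + x))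
                (\<lambda>t. z * schroedinger_phase x y t * g (t + x))"
proof -
  have sq: "square_integrable (\<lambda>t. z * schroedinger_phase x y t * h (t + x))"
    if "square_integrable h" for h
  proof -
    have s: "square_integrable (\<lambda>t. z * h (t + x))"
      by (intro square_integrable_cmult square_integrable_shift that)
    then have [measurable]: "(\<lambda>t. z * h (t + x)) \<in> borel_measurable borel"
      by (simp add: square_integrable_def)
    have [measurable]: "schroedinger_phase x y \<in> borel_measurable borel"
      unfolding schroedinger_phase_def[abs_def] by measurable
    have "(\<lambda>t. schroedinger_phase x y t * (z * h (t + x))) \<in> borel_measurable borel"
      by measurable
    with s show ?thesis
      by (simp add: square_integrable_def norm_mult norm_schroedinger_phase ac_simps)
  qed
  have "AE t in lborel. f (t + x) = g (t + x)"
    using fg by (intro AE_lborel_shift) (simp add: l2_rel_def)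
  then have "AE t in lborel. z * schroedinger_phase x y t * f (t + x) =
      z * schroedinger_phase x y t * g (t + x)"
    by eventually_elim simp
  then show ?thesis
    using fg sq by (simp add: l2_rel_def)
qed

lift_definition schroedinger ::
  "'a::euclidean_space \<Rightarrow> 'a \<Rightarrow> complex \<Rightarrow> 'a L2 \<Rightarrow> 'a L2"
  is "\<lambda>x y z \<phi> t. z * schroedinger_phase x y t * \<phi> (t + x)"
  by (rule l2_rel_schroedinger)

lemma schroedinger_phase_mult:
  "schroedinger_phase x y t * schroedinger_phase x' y' (t + x) =
     exp (complex_of_real pi * \<i> * complex_of_real (x \<bullet> y' - y \<bullet> x')) *
     schroedinger_phase (x + x') (y + y') t"
  unfolding schroedinger_phase_def exp_add[symmetric] distrib_left[symmetric] of_real_add[symmetric]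
  by (simp add: inner_add_left inner_add_right inner_commute algebra_simps)

lemma schroedinger_mult:
  "schroedinger x y z (schroedinger x' y' z' \<phi>) =
     schroedinger (x + x') (y + y')
       (z * z' * exp (complex_of_real pi * \<i> * complex_of_real (x \<bullet> y' - y \<bullet> x'))) \<phi>"
proof transfer
  fix x y x' y' :: 'a and z z' :: complex and f :: "'a \<Rightarrow> complex"
  assume f: "l2_rel f f"
  define e where "e = exp (complex_of_real pi * \<i> * complex_of_real (x \<bullet> y' - y \<bullet> x'))"
  have eq: "(\<lambda>t. z * schroedinger_phase x y t *
        (z' * schroedinger_phase x' y' (t + x) * f (t + x + x'))) =
      (\<lambda>t. z * z' * e * schroedinger_phase (x + x') (y + y') t * f (t + (x + x')))"
  proof
    fix t
    have "z * schroedinger_phase x y t *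
        (z' * schroedinger_phase x' y' (t + x) * f (t + x + x')) =
        z * z' * (schroedinger_phase x y t * schroedinger_phase x' y' (t + x)) * f (t + x + x')"
      by (simp only: ac_simps)
    also have "\<dots> = z * z' * e * schroedinger_phase (x + x') (y + y') t * f (t + (x + x'))"
      unfolding schroedinger_phase_mult e_def by (simp only: ac_simps)
    finally show "z * schroedinger_phase x y t *
        (z' * schroedinger_phase x' y' (t + x) * f (t + x + x')) =
        z * z' * e * schroedinger_phase (x + x') (y + y') t * f (t + (x + x'))" .
  qed
  show "l2_rel (\<lambda>t. z * schroedinger_phase x y t *
        (z' * schroedinger_phase x' y' (t + x) * f (t + x + x')))
      (\<lambda>t. z * z' * exp (complex_of_real pi * \<i> * complex_of_real (x \<bullet> y' - y \<bullet> x')) *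
        schroedinger_phase (x + x') (y + y') t * f (t + (x + x')))"
    unfolding eq e_def[symmetric] by (intro l2_rel_schroedinger f)
qed

lemma schroedinger_one: "schroedinger 0 0 1 \<phi> = \<phi>"
  by transfer (simp add: schroedinger_phase_def)

text \<open>Hence \<open>inv\<close> below is the genuine inverse.\<close>

lemma bij_schroedinger:
  assumes "cmod z = 1"
  shows "bij (schroedinger x y z)"
proof -
  have z: "z * cnj z = 1" "cnj z * z = 1"
    using assms by (simp_all add: complex_norm_square[symmetric] mult.commute)
  show ?thesis
    by (rule o_bij[where g = "schroedinger (- x) (- y) (cnj z)"])
       (auto simp: fun_eq_iff schroedinger_mult inner_commute z schroedinger_one)
qed

definition quantum_translate ::
  "'a::euclidean_space \<times> 'a \<Rightarrow> ('a L2 \<Rightarrow> 'a L2) \<Rightarrow> 'a L2 \<Rightarrow> 'a L2" where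
  "quantum_translate w X =
     (case w of (x, y) \<Rightarrow> schroedinger x y 1 \<circ> X \<circ> inv (schroedinger x y 1))"

end

(*
  Writing X^(w) for the Fourier-Wigner transform, the translate of X by w multiplies X^ by a
  character, so A has dependent translates as soon as A^ is a measure on the zero set of a
  trigonometric polynomial. We take a piece of the hypersurface
     y_0 = theta(x_0) + sum_(i <> 0) (theta(x_i) + theta(y_i)),
  where exp(i theta(x)) = (2 + exp(i x)) / (2 + exp(-i x)): multiplying out the denominators gives
  the polynomial, and theta'' <> 0 makes the surface curved. In the Kohn-Nirenberg ordering A is the
  integral operator with kernel
     prod_(i <> 0) F(t_0, t_i) * prod_i 1_[1,2](s_i - t_i) exp(i t_0 theta(s_i - t_i)),
  F(l, q) being the integral of exp(i (l theta(y) + q y)) over y in [1,2].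

  On |t_0| <= R the squared Hilbert-Schmidt norm is O(R^(1+eps)). On |t_0| > R each of the 2n - 1
  oscillatory factors contributes R^(-(1-eps)) to the squared operator norm; for the factors without
  F this is the Schur test applied to T T*. Choosing R so that the second part is at most s^2 / 2,
  there are O(s^(-q)) singular values above s, and q tends to 2 + 2 / (2n - 1) = 4n / (2n - 1).
*)
theory Submission
  imports Defs "HOL-Complex_Analysis.Great_Picard"
begin

section \<open>The Hilbert space\<close>

text \<open>The exponent has a classical model: a smooth density on a hypersurface of R^(2n) with
  non-vanishing curvature has a Fourier transform of size |xi|^(-(2n-1)/2), and this decay is
  p-integrable at infinity exactly for p > 4n/(2n-1). Here operators replace functions and Schatten
  norms replace L^p norms. The obstacle is to find a curved piece of a trigonometric zero set whose
  operator can be estimated explicitly. A graph over a sum of functions of one variable serves: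
  exp(i t_0 y_0) splits into one factor per variable, so the kernel, the kernel of T T* and the
  linear relation are all products of one-dimensional objects. The quotient defining theta is
  unimodular since its numerator and denominator are conjugate, so theta is real. On [1,2] the sine
  is bounded below, which keeps theta'' away from 0. Every decay estimate rests on integration by
  parts against a lower bound for the first derivative of a phase. This costs logarithms, which eps
  absorbs because p exceeds the threshold strictly. The coordinate t_0 is at once a frequency and a
  position, so two rows interact only when their frequencies differ by at most 1.\<close>

lemma square_integrable_rep: "square_integrable (rep_L2 \<phi>)"
  using Quotient_rel_rep[OF Quotient_L2, of \<phi> \<phi>] by (simp add: l2_rel_def)

lemma abs_rep_L2: "abs_L2 (rep_L2 \<phi>) = \<phi>"
  by (rule Quotient_abs_rep[OF Quotient_L2])

lemma l2_rel_refl: "square_integrable f \<Longrightarrow> l2_rel f f"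
  by (simp add: l2_rel_def)

lemma rep_abs_L2_AE: "square_integrable f \<Longrightarrow> AE t in lborel. rep_L2 (abs_L2 f) t = f t"
  using Quotient_rep_abs[OF Quotient_L2, of f] by (simp add: l2_rel_def)

lemma abs_L2_cong_AE:
  assumes "square_integrable f" "square_integrable g" "AE t in lborel. f t = g t"
  shows "abs_L2 f = abs_L2 g"
  using assms by (intro Quotient_rel_abs[OF Quotient_L2]) (simp add: l2_rel_def)

lemma L2_cases:
  obtains f where "square_integrable f" "\<phi> = abs_L2 f"
  using square_integrable_rep[of \<phi>] abs_rep_L2[of \<phi>] by metis

lemma cinner_abs_L2:
  "square_integrable f \<Longrightarrow> square_integrable g \<Longrightarrow>
    cinner (abs_L2 f) (abs_L2 g) = (\<integral>t. f t * cnj (g t) \<partial>lborel)"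
  by (simp add: cinner.abs_eq l2_rel_refl)

lemma cinner_add_left: "cinner (f + g) h = cinner f h + cinner g h"
  by transfer (auto simp: l2_rel_def distrib_right square_integrable_mult_cnj)

lemma cinner_scaleC_left: "cinner (c *\<^sub>C f) h = c * cinner f h"
  by transfer (auto simp: l2_rel_def mult.assoc)

lemma cinner_commute: "cinner f g = cnj (cinner g f)"
proof transfer
  fix f g :: "'a \<Rightarrow> complex"
  have "(\<integral>t. f t * cnj (g t) \<partial>lborel) = (\<integral>t. cnj (g t * cnj (f t)) \<partial>lborel)"
    by (simp add: mult.commute)
  also have "\<dots> = cnj (\<integral>t. g t * cnj (f t) \<partial>lborel)"
    by (rule Bochner_Integration.integral_cnj)
  finally show "(\<integral>t. f t * cnj (g t) \<partial>lborel) = cnj (\<integral>t. g t * cnj (f t) \<partial>lborel)" .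
qed

lemma cinner_add_right: "cinner h (f + g) = cinner h f + cinner h g"
  by (subst (1 2 3) cinner_commute) (simp add: cinner_add_left)

lemma cinner_scaleC_right: "cinner h (c *\<^sub>C f) = cnj c * cinner h f"
  by (subst (1 2) cinner_commute) (simp add: cinner_scaleC_left)

lemma cinner_sum_left: "cinner (\<Sum>i\<in>I. f i) h = (\<Sum>i\<in>I. cinner (f i) h)"
proof (induction I rule: infinite_finite_induct)
  case empty
  show ?case using cinner_scaleC_left[of 0 0 h] by simp
qed (use cinner_scaleC_left[of 0 0 h] in \<open>auto simp: cinner_add_left\<close>)

lemma cinner_diff_left: "cinner (f - g) h = cinner f h - cinner g h"
  using cinner_add_left[of "f - g" g h] by simp

lemma cinner_self: "cinner f f = complex_of_real ((norm f)\<^sup>2)"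
proof -
  have "Im (cinner f f) = 0"
    using cinner_commute[of f f] by (metis Reals_cnj_iff complex_is_Real_iff)
  moreover have "Re (cinner f f) = (norm f)\<^sup>2"
    by (simp add: norm_eq_sqrt_inner inner_L2_def[symmetric])
  ultimately show ?thesis by (simp add: complex_eq_iff)
qed

lemma norm_scaleC: "norm (c *\<^sub>C f) = cmod c * norm f"
proof -
  have "complex_of_real ((norm (c *\<^sub>C f))\<^sup>2) = (c * cnj c) * complex_of_real ((norm f)\<^sup>2)"
    unfolding cinner_self[symmetric] cinner_scaleC_left cinner_scaleC_right by simp
  also have "\<dots> = complex_of_real ((cmod c * norm f)\<^sup>2)"
    by (simp add: complex_norm_square[symmetric] power_mult_distrib)
  finally have "(norm (c *\<^sub>C f))\<^sup>2 = (cmod c * norm f)\<^sup>2" by (simp only: of_real_eq_iff)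
  then show ?thesis by simp
qed

lemma cinner_Cauchy_Schwarz: "cmod (cinner f g) \<le> norm f * norm g"
proof (cases "cinner f g = 0")
  case False
  \<comment> \<open>A unimodular factor rotating \<open>cinner f g\<close> onto the nonnegative
    reals reduces the complex inequality to the real one for \<open>Re (cinner f g)\<close>.\<close>
  define c where "c = cnj (cinner f g) / complex_of_real (cmod (cinner f g))"
  have c: "cmod c = 1" using False by (simp add: c_def norm_divide)
  have "c * cinner f g = complex_of_real (cmod (cinner f g))"
    using False by (simp add: c_def complex_norm_square[symmetric] power2_eq_square
        mult.commute[of "cnj _"])
  then have "cmod (cinner f g) = (c *\<^sub>C f) \<bullet> g"
    by (simp add: inner_L2_def cinner_scaleC_left)
  also have "\<dots> \<le> norm (c *\<^sub>C f) * norm g" by (rule norm_cauchy_schwarz)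
  finally show ?thesis by (simp add: norm_scaleC c)
qed simp

lemma norm_abs_L2:
  assumes "square_integrable f"
  shows "ennreal ((norm (abs_L2 f))\<^sup>2) = (\<integral>\<^sup>+t. ennreal ((cmod (f t))\<^sup>2) \<partial>lborel)"
proof -
  have "(norm (abs_L2 f))\<^sup>2 = Re (cinner (abs_L2 f) (abs_L2 f))"
    by (simp add: cinner_self)
  also have "\<dots> = (\<integral>t. (cmod (f t))\<^sup>2 \<partial>lborel)"
    using assms by (simp add: cinner_abs_L2 complex_norm_square[symmetric] del: of_real_power)
  finally show ?thesis
    using assms by (subst nn_integral_eq_integral) (auto simp: square_integrable_def)
qed

lemma norm_L2_eq_nn_integral:
  "ennreal ((norm \<phi>)\<^sup>2) = (\<integral>\<^sup>+t. ennreal ((cmod (rep_L2 \<phi> t))\<^sup>2) \<partial>lborel)"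
  using norm_abs_L2[OF square_integrable_rep[of \<phi>]] by (simp add: abs_rep_L2)

lemma square_integrable_measurable [measurable_dest]:
  "square_integrable f \<Longrightarrow> f \<in> borel_measurable borel"
  by (simp add: square_integrable_def)

lemma measurable_rep_L2 [measurable]: "rep_L2 \<phi> \<in> borel_measurable borel"
  using square_integrable_rep[of \<phi>] by (simp add: square_integrable_def)

lemma square_integrableI:
  assumes "f \<in> borel_measurable borel" "(\<integral>\<^sup>+t. ennreal ((cmod (f t))\<^sup>2) \<partial>lborel) < \<infinity>"
  shows "square_integrable f"
  using assms by (auto simp: square_integrable_def intro!: integrableI_bounded)

lemma square_integrable_nn:
  "square_integrable f \<Longrightarrow> (\<integral>\<^sup>+t. ennreal ((cmod (f t))\<^sup>2) \<partial>lborel) < \<infinity>"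
  using norm_abs_L2[of f] by (metis ennreal_less_top infinity_ennreal_def)

lemma abs_L2_add:
  "square_integrable f \<Longrightarrow> square_integrable g \<Longrightarrow> abs_L2 f + abs_L2 g = abs_L2 (\<lambda>t. f t + g t)"
  by (simp add: plus_L2.abs_eq l2_rel_refl)

lemma abs_L2_scaleC: "square_integrable f \<Longrightarrow> c *\<^sub>C abs_L2 f = abs_L2 (\<lambda>t. c * f t)"
  by (simp add: scaleC.abs_eq l2_rel_refl)

lemma square_integrable_diff:
  assumes "square_integrable f" "square_integrable g"
  shows "square_integrable (\<lambda>t. f t - g t)"
  using square_integrable_add[OF assms(1) square_integrable_cmult[OF assms(2), where c = "-1"]]
  by simp

lemma abs_L2_diff:
  "square_integrable f \<Longrightarrow> square_integrable g \<Longrightarrow> abs_L2 f - abs_L2 g = abs_L2 (\<lambda>t. f t - g t)"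
  unfolding minus_L2_def uminus_L2_def
  by (simp only: abs_L2_scaleC abs_L2_add square_integrable_cmult) simp

section \<open>Finite orthonormal systems\<close>

definition orthonormal :: "'a::euclidean_space L2 set \<Rightarrow> bool" where
  "orthonormal E \<longleftrightarrow> (\<forall>e\<in>E. \<forall>e'\<in>E. cinner e e' = (if e = e' then 1 else 0))"

text \<open>With \<open>v\<close> the projection of \<open>h\<close> onto the span of
  \<open>E\<close>, both v \<bullet> h and v \<bullet> v equal the sum, so the claim is 0 \<le> |h -
  v|^2.\<close>

lemma Bessel_inequality:
  assumes "finite E" "orthonormal E"
  shows "(\<Sum>e\<in>E. (cmod (cinner e h))\<^sup>2) \<le> (norm h)\<^sup>2"
proof -
  define v where "v = (\<Sum>e\<in>E. cinner h e *\<^sub>C e)"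
  have vh: "cinner v h = (\<Sum>e\<in>E. complex_of_real ((cmod (cinner e h))\<^sup>2))"
    unfolding v_def cinner_sum_left cinner_scaleC_left
    by (intro sum.cong refl) (metis cinner_commute complex_norm_square mult.commute)
  have ve: "cinner v e = cinner h e" if "e \<in> E" for e
    using assms that unfolding v_def cinner_sum_left cinner_scaleC_left orthonormal_def
    by (subst sum.cong[OF refl, where h = "\<lambda>x. if x = e then cinner h e else 0"]) auto
  have vv: "cinner v v = (\<Sum>e\<in>E. complex_of_real ((cmod (cinner e h))\<^sup>2))"
  proof -
    have "cinner v v = (\<Sum>e\<in>E. cinner h e * cinner e v)"
      by (subst (1) v_def) (simp add: cinner_sum_left cinner_scaleC_left)
    also have "\<dots> = (\<Sum>e\<in>E. complex_of_real ((cmod (cinner e h))\<^sup>2))"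
      by (intro sum.cong refl) (metis cinner_commute complex_norm_square mult.commute ve)
    finally show ?thesis .
  qed
  have "0 \<le> (h - v) \<bullet> (h - v)" by simp
  also have "(h - v) \<bullet> (h - v) = h \<bullet> h - 2 * (v \<bullet> h) + v \<bullet> v"
    by (simp add: inner_diff_left inner_diff_right inner_commute)
  also have "v \<bullet> h = (\<Sum>e\<in>E. (cmod (cinner e h))\<^sup>2)"
    by (simp add: inner_L2_def vh flip: of_real_sum)
  also have "v \<bullet> v = (\<Sum>e\<in>E. (cmod (cinner e h))\<^sup>2)"
    by (simp add: inner_L2_def vv flip: of_real_sum)
  finally show ?thesis by (simp add: power2_norm_eq_inner)
qed

lemma Gram_Schmidt:
  fixes B :: "'a::euclidean_space L2 set"
  assumes "finite B" "L2.independent B"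
  shows "\<exists>E. finite E \<and> card E = card B \<and> E \<subseteq> L2.span B \<and> orthonormal E"
  using assms
proof (induction B rule: finite_induct)
  case empty
  show ?case by (intro exI[of _ "{}"]) (auto simp: orthonormal_def)
next
  case (insert b B)
  then have indep: "L2.independent B" "b \<notin> L2.span B"
    by (auto simp: L2.independent_insert)
  with insert.IH obtain E where E: "finite E" "card E = card B" "E \<subseteq> L2.span B" "orthonormal E"
    by auto
  define u where "u = (\<Sum>e\<in>E. cinner b e *\<^sub>C e)"
  define v where "v = b - u"
  have u: "u \<in> L2.span B"
    unfolding u_def using E by (intro L2.span_sum L2.span_scale) auto
  have "v \<noteq> 0" using indep u by (auto simp: v_def)
  have ue: "cinner u e = cinner b e" if "e \<in> E" for e
    using E that unfolding u_def cinner_sum_left cinner_scaleC_left orthonormal_def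
    by (subst sum.cong[OF refl, where h = "\<lambda>x. if x = e then cinner b e else 0"]) auto
  have vE: "cinner v e = 0" if "e \<in> E" for e
    using that by (simp add: v_def cinner_diff_left ue)
  define w where "w = complex_of_real (1 / norm v) *\<^sub>C v"
  have wE: "cinner w e = 0" "cinner e w = 0" if "e \<in> E" for e
    using vE[OF that] cinner_commute[of e v]
    by (auto simp: w_def cinner_scaleC_left cinner_scaleC_right)
  have ww: "cinner w w = 1"
    using \<open>v \<noteq> 0\<close>
    by (simp add: w_def cinner_self norm_scaleC norm_divide)
  have "w \<notin> E" using wE ww by force
  have "v \<in> L2.span (insert b B)"
    unfolding v_def using u L2.span_mono[of B "insert b B"]
    by (intro L2.span_diff) (auto intro: L2.span_base)
  then have "w \<in> L2.span (insert b B)" unfolding w_def by (rule L2.span_scale)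
  moreover have "E \<subseteq> L2.span (insert b B)" using E L2.span_mono[of B "insert b B"] by auto
  ultimately show ?case
    using E insert.hyps \<open>w \<notin> E\<close> ww wE
    by (intro exI[of _ "insert w E"]) (auto simp: orthonormal_def)
qed

lemma orthonormal_basis_card_dim:
  assumes "L2.subspace V"
  shows "\<exists>E. finite E \<and> card E = L2.dim V \<and> E \<subseteq> V \<and> orthonormal E"
proof -
  obtain B where B: "B \<subseteq> V" "L2.independent B" "card B = L2.dim V"
    using L2.basis_exists[of V] by metis
  show ?thesis
  proof (cases "finite B")
    case True
    then obtain E where "finite E" "card E = card B" "E \<subseteq> L2.span B" "orthonormal E"
      using Gram_Schmidt B by metis
    moreover have "L2.span B \<subseteq> V" using B assms by (intro L2.span_minimal)
    ultimately show ?thesis using B by auto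
  next
    case False
    \<comment> \<open>Here \<open>card B\<close>, and with it \<open>L2.dim V\<close>, is 0 by
      convention, so the empty system has the right size.\<close>
    then show ?thesis using B by (intro exI[of _ "{}"]) (auto simp: orthonormal_def)
  qed
qed

section \<open>Integral operators satisfying the Schur test\<close>

text \<open>One constant bounds rows and columns, which makes the condition invariant under
  \<open>adj_kernel\<close>; the operator norm is then at most \<open>S\<close>.\<close>

definition schur_kernel :: "real \<Rightarrow> ('a::euclidean_space \<Rightarrow> 'a \<Rightarrow> complex) \<Rightarrow> bool" where
  "schur_kernel S k \<longleftrightarrow> 0 \<le> S \<and> case_prod k \<in> borel_measurable (borel \<Otimes>\<^sub>M borel) \<and>
     (\<forall>t. (\<integral>\<^sup>+s. ennreal (cmod (k t s)) \<partial>lborel) \<le> ennreal S) \<and>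
     (\<forall>s. (\<integral>\<^sup>+t. ennreal (cmod (k t s)) \<partial>lborel) \<le> ennreal S)"

lemma schur_kernel_measurable:
  "schur_kernel S k \<Longrightarrow> case_prod k \<in> borel_measurable (borel \<Otimes>\<^sub>M borel)"
  by (simp add: schur_kernel_def)

text \<open>Write |k| as the product of two square roots, apply Cauchy-Schwarz in \<open>s\<close>
  using the row bound, then Tonelli and the column bound. Working with values in
  \<open>ennreal\<close> yields the norm bound and the absolute convergence for later uses of Fubini
  at the same time.\<close>

lemma schur_test_nn:
  fixes k :: "'a::euclidean_space \<Rightarrow> 'a \<Rightarrow> complex" and f :: "'a \<Rightarrow> ennreal"
  assumes k: "schur_kernel S k" and f [measurable]: "f \<in> borel_measurable borel"
  shows "(\<integral>\<^sup>+t. (\<integral>\<^sup>+s. ennreal (cmod (k t s)) * f s \<partial>lborel)\<^sup>2 \<partial>lborel)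
    \<le> ennreal (S\<^sup>2) * (\<integral>\<^sup>+s. (f s)\<^sup>2 \<partial>lborel)"
proof -
  note [measurable] = schur_kernel_measurable[OF k]
  have S: "0 \<le> S" using k by (simp add: schur_kernel_def)
  let ?h = "\<lambda>t s. ennreal (sqrt (cmod (k t s)))"
  have hh: "?h t s * ?h t s = ennreal (cmod (k t s))" for t s
    by (simp flip: ennreal_mult'')
  have "(\<integral>\<^sup>+s. ennreal (cmod (k t s)) * f s \<partial>lborel)\<^sup>2
      \<le> ennreal S * (\<integral>\<^sup>+s. ennreal (cmod (k t s)) * (f s)\<^sup>2 \<partial>lborel)" for t
  proof -
    have "(\<integral>\<^sup>+s. ?h t s * (?h t s * f s) \<partial>lborel)\<^sup>2
        \<le> (\<integral>\<^sup>+s. (?h t s)\<^sup>2 \<partial>lborel) * (\<integral>\<^sup>+s. (?h t s * f s)\<^sup>2 \<partial>lborel)"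
      by (rule Cauchy_Schwarz_nn_integral) measurable
    also have "(\<integral>\<^sup>+s. (?h t s)\<^sup>2 \<partial>lborel) \<le> ennreal S"
      using k by (simp add: power2_eq_square hh schur_kernel_def)
    finally show ?thesis
      by (simp add: power2_eq_square mult.assoc[symmetric] hh mult.left_commute[of _ "?h _ _"]
          mult_right_mono) (simp add: ac_simps hh mult_right_mono)
  qed
  then have "(\<integral>\<^sup>+t. (\<integral>\<^sup>+s. ennreal (cmod (k t s)) * f s \<partial>lborel)\<^sup>2 \<partial>lborel)
      \<le> (\<integral>\<^sup>+t. ennreal S * (\<integral>\<^sup>+s. ennreal (cmod (k t s)) * (f s)\<^sup>2 \<partial>lborel) \<partial>lborel)"
    by (intro nn_integral_mono)
  also have "\<dots> = ennreal S * (\<integral>\<^sup>+t. (\<integral>\<^sup>+s. ennreal (cmod (k t s)) * (f s)\<^sup>2 \<partial>lborel) \<partial>lborel)"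
    by (rule nn_integral_cmult) measurable
  also have "(\<integral>\<^sup>+t. (\<integral>\<^sup>+s. ennreal (cmod (k t s)) * (f s)\<^sup>2 \<partial>lborel) \<partial>lborel)
      = (\<integral>\<^sup>+s. (\<integral>\<^sup>+t. ennreal (cmod (k t s)) * (f s)\<^sup>2 \<partial>lborel) \<partial>lborel)"
    by (rule lborel_pair.Fubini'[symmetric]) measurable
  also have "\<dots> = (\<integral>\<^sup>+s. (\<integral>\<^sup>+t. ennreal (cmod (k t s)) \<partial>lborel) * (f s)\<^sup>2 \<partial>lborel)"
    by (intro nn_integral_cong nn_integral_multc) measurable
  also have "\<dots> \<le> (\<integral>\<^sup>+s. ennreal S * (f s)\<^sup>2 \<partial>lborel)"
    using k by (intro nn_integral_mono mult_right_mono) (auto simp: schur_kernel_def)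
  also have "\<dots> = ennreal S * (\<integral>\<^sup>+s. (f s)\<^sup>2 \<partial>lborel)"
    by (rule nn_integral_cmult) measurable
  finally show ?thesis
    using S by (simp add: power2_eq_square ennreal_mult mult.assoc mult_left_mono)
qed

definition int_op :: "('a::euclidean_space \<Rightarrow> 'a \<Rightarrow> complex) \<Rightarrow> ('a \<Rightarrow> complex) \<Rightarrow> 'a \<Rightarrow> complex" where
  "int_op k f t = (\<integral>s. k t s * f s \<partial>lborel)"

definition kernel_op :: "('a::euclidean_space \<Rightarrow> 'a \<Rightarrow> complex) \<Rightarrow> 'a L2 \<Rightarrow> 'a L2" where
  "kernel_op k \<phi> = abs_L2 (int_op k (rep_L2 \<phi>))"

lemma measurable_int_op [measurable]:
  assumes [measurable]: "case_prod k \<in> borel_measurable (borel \<Otimes>\<^sub>M borel)" "f \<in> borel_measurable borel"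
  shows "int_op k f \<in> borel_measurable borel"
proof -
  have "int_op k f \<in> borel_measurable lborel"
    unfolding int_op_def[abs_def]
    by (rule lborel.borel_measurable_lebesgue_integral) measurable
  then show ?thesis by simp
qed

lemma norm_int_op_le:
  "ennreal (cmod (int_op k f t)) \<le> (\<integral>\<^sup>+s. ennreal (cmod (k t s)) * ennreal (cmod (f s)) \<partial>lborel)"
proof (cases "integrable lborel (\<lambda>s. k t s * f s)")
  case True
  then show ?thesis
    using integral_norm_bound_ennreal[OF True] by (simp add: int_op_def norm_mult ennreal_mult)
next
  case False
  \<comment> \<open>The integral of a non-integrable function is 0 by convention, which any
    right-hand side dominates.\<close>
  then show ?thesis by (simp add: int_op_def not_integrable_integral_eq)
qed

lemma nn_integral_square_less_top_AE:
  fixes f :: "'a \<Rightarrow> ennreal"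
  assumes [measurable]: "f \<in> borel_measurable M" and "(\<integral>\<^sup>+x. (f x)\<^sup>2 \<partial>M) < \<infinity>"
  shows "AE x in M. f x < \<infinity>"
proof -
  have "AE x in M. (f x)\<^sup>2 \<noteq> \<infinity>"
    using assms by (intro nn_integral_PInf_AE) auto
  then show ?thesis
    by eventually_elim (auto simp: power2_eq_square top.not_eq_extremum ennreal_mult_eq_top_iff)
qed

lemma schur_nn_less_top:
  assumes k: "schur_kernel S k" and f: "f \<in> borel_measurable borel" "(\<integral>\<^sup>+s. (f s)\<^sup>2 \<partial>lborel) < \<infinity>"
  shows "(\<integral>\<^sup>+t. (\<integral>\<^sup>+s. ennreal (cmod (k t s)) * f s \<partial>lborel)\<^sup>2 \<partial>lborel) < \<infinity>"
  using schur_test_nn[OF k f(1)] f(2)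
  by (auto simp: ennreal_mult_less_top intro: le_less_trans)

lemma integrable_kernel_row_AE:
  assumes k: "schur_kernel S k" and f: "square_integrable f"
  shows "AE t in lborel. integrable lborel (\<lambda>s. k t s * f s)"
proof -
  note [measurable] = schur_kernel_measurable[OF k] square_integrable_measurable[OF f]
  have "(\<integral>\<^sup>+t. (\<integral>\<^sup>+s. ennreal (cmod (k t s)) * ennreal (cmod (f s)) \<partial>lborel)\<^sup>2 \<partial>lborel) < \<infinity>"
    using square_integrable_nn[OF f] by (intro schur_nn_less_top[OF k]) (auto simp: ennreal_power)
  then have "AE t in lborel. (\<integral>\<^sup>+s. ennreal (cmod (k t s)) * ennreal (cmod (f s)) \<partial>lborel) < \<infinity>"
    by (intro nn_integral_square_less_top_AE) measurable
  then show ?thesis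
    by eventually_elim (auto intro!: integrableI_bounded simp: norm_mult ennreal_mult)
qed

lemma int_op_norm_bound:
  assumes k: "schur_kernel S k" and [measurable]: "f \<in> borel_measurable borel"
  shows "(\<integral>\<^sup>+t. ennreal ((cmod (int_op k f t))\<^sup>2) \<partial>lborel)
    \<le> ennreal (S\<^sup>2) * (\<integral>\<^sup>+s. ennreal ((cmod (f s))\<^sup>2) \<partial>lborel)"
proof -
  have "(\<integral>\<^sup>+t. ennreal ((cmod (int_op k f t))\<^sup>2) \<partial>lborel)
     \<le> (\<integral>\<^sup>+t. (\<integral>\<^sup>+s. ennreal (cmod (k t s)) * ennreal (cmod (f s)) \<partial>lborel)\<^sup>2 \<partial>lborel)"
    using norm_int_op_le[of k f]
    by (intro nn_integral_mono) (simp add: ennreal_power[symmetric] power_mono)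
  also have "\<dots> \<le> ennreal (S\<^sup>2) * (\<integral>\<^sup>+s. (ennreal (cmod (f s)))\<^sup>2 \<partial>lborel)"
    by (rule schur_test_nn[OF k]) measurable
  finally show ?thesis by (simp add: ennreal_power)
qed

lemma square_integrable_int_op:
  assumes k: "schur_kernel S k" and f: "square_integrable f"
  shows "square_integrable (int_op k f)"
proof (rule square_integrableI)
  note [measurable] = schur_kernel_measurable[OF k] square_integrable_measurable[OF f]
  show "int_op k f \<in> borel_measurable borel" by measurable
  show "(\<integral>\<^sup>+t. ennreal ((cmod (int_op k f t))\<^sup>2) \<partial>lborel) < \<infinity>"
    using int_op_norm_bound[OF k, of f] square_integrable_nn[OF f]
    by (auto simp: ennreal_mult_less_top intro: le_less_trans)
qed

lemma int_op_cong_AE: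
  assumes [measurable]: "case_prod k \<in> borel_measurable (borel \<Otimes>\<^sub>M borel)"
    "f \<in> borel_measurable borel" "g \<in> borel_measurable borel"
    and "AE s in lborel. f s = g s"
  shows "int_op k f = int_op k g"
  unfolding int_op_def using assms(4)
  by (intro ext integral_cong_AE) auto

lemma int_op_rep_abs:
  assumes k: "case_prod k \<in> borel_measurable (borel \<Otimes>\<^sub>M borel)" and f: "square_integrable f"
  shows "int_op k (rep_L2 (abs_L2 f)) = int_op k f"
  using k square_integrable_measurable[OF f] rep_abs_L2_AE[OF f]
  by (intro int_op_cong_AE) auto

lemma kernel_op_abs:
  assumes k: "schur_kernel S k" and f: "square_integrable f"
  shows "kernel_op k (abs_L2 f) = abs_L2 (int_op k f)"
  using int_op_rep_abs[OF schur_kernel_measurable[OF k] f] by (simp add: kernel_op_def)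

lemma norm_kernel_op_le:
  assumes k: "schur_kernel S k"
  shows "norm (kernel_op k \<phi>) \<le> S * norm \<phi>"
proof -
  have S: "0 \<le> S" using k by (simp add: schur_kernel_def)
  have "ennreal ((norm (kernel_op k \<phi>))\<^sup>2) \<le> ennreal (S\<^sup>2) * ennreal ((norm \<phi>)\<^sup>2)"
    unfolding kernel_op_def norm_L2_eq_nn_integral[of \<phi>]
    by (subst norm_abs_L2[OF square_integrable_int_op[OF k square_integrable_rep]])
       (rule int_op_norm_bound[OF k], measurable)
  also have "\<dots> = ennreal ((S * norm \<phi>)\<^sup>2)"
    by (simp add: ennreal_mult power_mult_distrib)
  finally have "(norm (kernel_op k \<phi>))\<^sup>2 \<le> (S * norm \<phi>)\<^sup>2"
    by simp
  then show ?thesis using S by (simp add: power2_le_iff_abs_le)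
qed

lemma kernel_op_add:
  assumes k: "schur_kernel S k"
  shows "kernel_op k (\<phi> + \<psi>) = kernel_op k \<phi> + kernel_op k \<psi>"
proof -
  obtain f where f: "square_integrable f" "\<phi> = abs_L2 f" by (rule L2_cases)
  obtain g where g: "square_integrable g" "\<psi> = abs_L2 g" by (rule L2_cases)
  have "AE t in lborel. int_op k (\<lambda>t. f t + g t) t = int_op k f t + int_op k g t"
    using integrable_kernel_row_AE[OF k f(1)] integrable_kernel_row_AE[OF k g(1)]
    by eventually_elim (simp add: int_op_def distrib_left)
  then have "abs_L2 (int_op k (\<lambda>t. f t + g t)) = abs_L2 (\<lambda>t. int_op k f t + int_op k g t)"
    using f g by (intro abs_L2_cong_AE)
      (auto intro!: square_integrable_int_op[OF k] square_integrable_add)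
  then show ?thesis
    using f g by (simp add: abs_L2_add kernel_op_abs[OF k] square_integrable_int_op[OF k]
        square_integrable_add)
qed

lemma int_op_scale: "int_op k (\<lambda>t. c * f t) = (\<lambda>t. c * int_op k f t)"
  unfolding int_op_def by (auto simp: mult.left_commute fun_eq_iff)

lemma kernel_op_scaleC:
  assumes k: "schur_kernel S k"
  shows "kernel_op k (c *\<^sub>C \<phi>) = c *\<^sub>C kernel_op k \<phi>"
proof -
  obtain f where f: "square_integrable f" "\<phi> = abs_L2 f" by (rule L2_cases)
  show ?thesis unfolding f(2)
    using f(1) by (simp add: abs_L2_scaleC kernel_op_abs[OF k] square_integrable_int_op[OF k]
        square_integrable_cmult int_op_scale)
qed

lemma linear_kernel_op:
  assumes k: "schur_kernel S k"
  shows "Vector_Spaces.linear scaleC scaleC (kernel_op k)"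
  by unfold_locales (simp_all add: kernel_op_add[OF k] kernel_op_scaleC[OF k]
      L2.scale_right_distrib L2.scale_left_distrib)

definition adj_kernel :: "('a \<Rightarrow> 'a \<Rightarrow> complex) \<Rightarrow> 'a \<Rightarrow> 'a \<Rightarrow> complex" where
  "adj_kernel k t s = cnj (k s t)"

lemma borel_measurable_cnj [measurable (raw)]:
  "f \<in> borel_measurable M \<Longrightarrow> (\<lambda>x. cnj (f x)) \<in> borel_measurable M"
  by (rule measurable_compose[of _ _ borel])
     (auto intro!: borel_measurable_continuous_onI continuous_intros)

lemma schur_adj_kernel:
  assumes k: "schur_kernel S k"
  shows "schur_kernel S (adj_kernel k)"
proof -
  note [measurable] = schur_kernel_measurable[OF k]
  have "case_prod (adj_kernel k) \<in> borel_measurable (borel \<Otimes>\<^sub>M borel)"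
    unfolding adj_kernel_def case_prod_beta' by measurable
  then show ?thesis using k by (simp add: schur_kernel_def adj_kernel_def)
qed

text \<open>This is what Fubini needs in order to move the operator to the other side of the inner
  product. The Schur test puts |k| applied to |f| into L2, and Cauchy-Schwarz pairs it with |g|; an
  \<open>ennreal\<close> is finite once its square is.\<close>

lemma integrable_kernel_pairing:
  assumes k: "schur_kernel S k" and f: "square_integrable f" and g: "square_integrable g"
  shows "integrable (lborel \<Otimes>\<^sub>M lborel) (\<lambda>(t, s). k t s * f s * cnj (g t))"
proof (rule integrableI_bounded)
  note [measurable] = schur_kernel_measurable[OF k]
    square_integrable_measurable[OF f] square_integrable_measurable[OF g]
  let ?H = "\<lambda>t. \<integral>\<^sup>+s. ennreal (cmod (k t s)) * ennreal (cmod (f s)) \<partial>lborel"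
  show "(\<lambda>(t, s). k t s * f s * cnj (g t)) \<in> borel_measurable (lborel \<Otimes>\<^sub>M lborel)"
    unfolding case_prod_beta' by measurable
  have H: "(\<integral>\<^sup>+t. (?H t)\<^sup>2 \<partial>lborel) < \<infinity>"
    using square_integrable_nn[OF f] by (intro schur_nn_less_top[OF k]) (auto simp: ennreal_power)
  have "(\<integral>\<^sup>+z. ennreal (norm (case z of (t, s) \<Rightarrow> k t s * f s * cnj (g t))) \<partial>(lborel \<Otimes>\<^sub>M lborel))
      = (\<integral>\<^sup>+t. \<integral>\<^sup>+s. ennreal (cmod (k t s * f s * cnj (g t))) \<partial>lborel \<partial>lborel)"
    by (subst lborel.nn_integral_fst[symmetric]) (auto simp: case_prod_beta')
  also have "\<dots> = (\<integral>\<^sup>+t. ?H t * ennreal (cmod (g t)) \<partial>lborel)"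
    by (intro nn_integral_cong, subst nn_integral_multc[symmetric])
       (auto simp: norm_mult ennreal_mult)
  finally have eq: "(\<integral>\<^sup>+z. ennreal (norm (case z of (t, s) \<Rightarrow> k t s * f s * cnj (g t)))
      \<partial>(lborel \<Otimes>\<^sub>M lborel)) = (\<integral>\<^sup>+t. ?H t * ennreal (cmod (g t)) \<partial>lborel)" .
  have "(\<integral>\<^sup>+t. ?H t * ennreal (cmod (g t)) \<partial>lborel)\<^sup>2
      \<le> (\<integral>\<^sup>+t. (?H t)\<^sup>2 \<partial>lborel) * (\<integral>\<^sup>+t. (ennreal (cmod (g t)))\<^sup>2 \<partial>lborel)"
    by (rule Cauchy_Schwarz_nn_integral) measurable
  also have "\<dots> < \<infinity>"
    using H square_integrable_nn[OF g] by (auto simp: ennreal_mult_less_top ennreal_power)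
  finally show "(\<integral>\<^sup>+z. ennreal (norm (case z of (t, s) \<Rightarrow> k t s * f s * cnj (g t)))
      \<partial>(lborel \<Otimes>\<^sub>M lborel)) < \<infinity>"
    unfolding eq by (auto simp: power2_eq_square ennreal_mult_less_top top.not_eq_extremum)
qed

lemma cinner_kernel_op:
  assumes k: "schur_kernel S k"
  shows "cinner (kernel_op k \<phi>) \<psi> = cinner \<phi> (kernel_op (adj_kernel k) \<psi>)"
proof -
  obtain f where f: "square_integrable f" "\<phi> = abs_L2 f" by (rule L2_cases)
  obtain g where g: "square_integrable g" "\<psi> = abs_L2 g" by (rule L2_cases)
  have "cinner (kernel_op k \<phi>) \<psi> = (\<integral>t. (\<integral>s. k t s * f s * cnj (g t) \<partial>lborel) \<partial>lborel)"
    using f g by (simp add: kernel_op_abs[OF k] cinner_abs_L2 square_integrable_int_op[OF k] int_op_def)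
  also have "\<dots> = (\<integral>s. (\<integral>t. k t s * f s * cnj (g t) \<partial>lborel) \<partial>lborel)"
    by (rule lborel_pair.Fubini_integral[symmetric])
       (rule integrable_kernel_pairing[OF k f(1) g(1)])
  also have "\<dots> = (\<integral>s. f s * cnj (int_op (adj_kernel k) g s) \<partial>lborel)"
  proof (rule Bochner_Integration.integral_cong[OF refl])
    fix s
    have "(\<integral>t. k t s * f s * cnj (g t) \<partial>lborel) = f s * (\<integral>t. cnj (cnj (k t s) * g t) \<partial>lborel)"
      by (subst integral_mult_right_zero[symmetric]) (simp add: ac_simps)
    also have "\<dots> = f s * cnj (int_op (adj_kernel k) g s)"
      by (subst Bochner_Integration.integral_cnj) (simp add: int_op_def adj_kernel_def)
    finally show "(\<integral>t. k t s * f s * cnj (g t) \<partial>lborel) = f s * cnj (int_op (adj_kernel k) g s)" .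
  qed
  also have "\<dots> = cinner \<phi> (kernel_op (adj_kernel k) \<psi>)"
    using f g schur_adj_kernel[OF k]
    by (simp add: kernel_op_abs[OF schur_adj_kernel[OF k]] cinner_abs_L2
        square_integrable_int_op[OF schur_adj_kernel[OF k]])
  finally show ?thesis .
qed

text \<open>\<open>cadjoint\<close> is picked by \<open>SOME\<close>; the operator with kernel
  \<open>adj_kernel k\<close> is a witness, so the choice has the defining property.\<close>

lemma cadjoint_kernel_op:
  assumes k: "schur_kernel S k"
  shows "cinner (kernel_op k \<phi>) \<psi> = cinner \<phi> (cadjoint (kernel_op k) \<psi>)"
proof -
  have "\<exists>B. \<forall>f g. cinner (kernel_op k f) g = cinner f (B g)"
    using cinner_kernel_op[OF k] by blast
  from someI_ex[OF this] show ?thesis unfolding cadjoint_def by blast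
qed

section \<open>Composition of kernels and the norm of T T*\<close>

definition comp_kernel ::
  "('a::euclidean_space \<Rightarrow> 'a \<Rightarrow> complex) \<Rightarrow> ('a \<Rightarrow> 'a \<Rightarrow> complex) \<Rightarrow> 'a \<Rightarrow> 'a \<Rightarrow> complex" where
  "comp_kernel k l t r = (\<integral>s. k t s * l s r \<partial>lborel)"

lemma measurable_comp_kernel:
  assumes [measurable]: "case_prod k \<in> borel_measurable (borel \<Otimes>\<^sub>M borel)"
    "case_prod l \<in> borel_measurable (borel \<Otimes>\<^sub>M borel)"
  shows "case_prod (comp_kernel k l) \<in> borel_measurable (borel \<Otimes>\<^sub>M borel)"
  unfolding comp_kernel_def case_prod_beta'
  by (rule lborel.borel_measurable_lebesgue_integral) measurable

text \<open>The order of integration may be exchanged at those \<open>t\<close> where the double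
  integral converges absolutely. Two applications of the Schur test show that its square is
  integrable in \<open>t\<close>, hence that it is finite almost everywhere.\<close>

lemma int_op_comp_AE:
  assumes k: "schur_kernel S k" and l: "schur_kernel S' l" and f: "square_integrable f"
  shows "AE t in lborel. int_op k (int_op l f) t = int_op (comp_kernel k l) f t"
proof -
  note [measurable] = schur_kernel_measurable[OF k] schur_kernel_measurable[OF l]
    square_integrable_measurable[OF f]
  let ?G = "\<lambda>s. \<integral>\<^sup>+r. ennreal (cmod (l s r)) * ennreal (cmod (f r)) \<partial>lborel"
  have G: "(\<integral>\<^sup>+s. (?G s)\<^sup>2 \<partial>lborel) < \<infinity>"
    using square_integrable_nn[OF f] by (intro schur_nn_less_top[OF l]) (auto simp: ennreal_power)
  have "AE t in lborel. (\<integral>\<^sup>+s. ennreal (cmod (k t s)) * ?G s \<partial>lborel) < \<infinity>"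
    using schur_nn_less_top[OF k _ G] by (intro nn_integral_square_less_top_AE) measurable
  then show ?thesis
  proof eventually_elim
    case (elim t)
    have int: "integrable (lborel \<Otimes>\<^sub>M lborel) (\<lambda>(s, r). k t s * l s r * f r)"
    proof (rule integrableI_bounded)
      show "(\<lambda>(s, r). k t s * l s r * f r) \<in> borel_measurable (lborel \<Otimes>\<^sub>M lborel)"
        unfolding case_prod_beta' by measurable
      have "(\<integral>\<^sup>+z. ennreal (norm (case z of (s, r) \<Rightarrow> k t s * l s r * f r)) \<partial>(lborel \<Otimes>\<^sub>M lborel))
          = (\<integral>\<^sup>+s. \<integral>\<^sup>+r. ennreal (cmod (k t s * l s r * f r)) \<partial>lborel \<partial>lborel)"
        by (subst lborel.nn_integral_fst[symmetric]) (auto simp: case_prod_beta')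
      also have "\<dots> = (\<integral>\<^sup>+s. ennreal (cmod (k t s)) * ?G s \<partial>lborel)"
        by (intro nn_integral_cong, subst nn_integral_cmult[symmetric])
           (auto simp: norm_mult ennreal_mult mult.assoc)
      finally show "(\<integral>\<^sup>+z. ennreal (norm (case z of (s, r) \<Rightarrow> k t s * l s r * f r))
          \<partial>(lborel \<Otimes>\<^sub>M lborel)) < \<infinity>"
        using elim by simp
    qed
    have "int_op k (int_op l f) t = (\<integral>s. (\<integral>r. k t s * l s r * f r \<partial>lborel) \<partial>lborel)"
      unfolding int_op_def
      by (intro Bochner_Integration.integral_cong refl)
         (subst integral_mult_right_zero[symmetric], simp add: mult.assoc)
    also have "\<dots> = (\<integral>r. (\<integral>s. k t s * l s r * f r \<partial>lborel) \<partial>lborel)"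
      by (rule lborel_pair.Fubini_integral[symmetric]) (rule int)
    also have "\<dots> = int_op (comp_kernel k l) f t"
      by (simp add: int_op_def comp_kernel_def)
    finally show ?case .
  qed
qed

text \<open>The \<open>T T*\<close> method: oscillation, invisible to the Schur test for \<open>k\<close> itself, shows up as decay
  of the kernel of \<open>T T*\<close>.\<close>

lemma norm_kernel_op_TTstar:
  assumes k: "schur_kernel S k" and c: "schur_kernel S' (comp_kernel k (adj_kernel k))"
  shows "(norm (kernel_op k \<phi>))\<^sup>2 \<le> S' * (norm \<phi>)\<^sup>2"
proof -
  have S': "0 \<le> S'" using c by (simp add: schur_kernel_def)
  note ka = schur_adj_kernel[OF k]
  have comp: "kernel_op k (kernel_op (adj_kernel k) g) = kernel_op (comp_kernel k (adj_kernel k)) g" for g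
  proof -
    obtain f where f: "square_integrable f" "g = abs_L2 f" by (rule L2_cases)
    note sq = square_integrable_int_op[OF ka f(1)]
    show ?thesis
      unfolding f(2) kernel_op_abs[OF ka f(1)] kernel_op_abs[OF c f(1)] kernel_op_abs[OF k sq]
      by (rule abs_L2_cong_AE[OF square_integrable_int_op[OF k sq]
            square_integrable_int_op[OF c f(1)] int_op_comp_AE[OF k ka f(1)]])
  qed
  \<comment> \<open>The adjoint comes first, since |T* g|^2 is the inner product of T T* g with g
    and the Schur test bounds T T*.\<close>
  have adj: "(norm (kernel_op (adj_kernel k) g))\<^sup>2 \<le> S' * (norm g)\<^sup>2" for g
  proof -
    let ?h = "kernel_op (adj_kernel k) g"
    have "complex_of_real ((norm ?h)\<^sup>2) = cinner (kernel_op k ?h) g"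
      unfolding cinner_self[symmetric] by (rule cinner_kernel_op[OF k, symmetric])
    then have "(norm ?h)\<^sup>2 = cmod (cinner (kernel_op k ?h) g)"
      by (metis norm_of_real abs_of_nonneg zero_le_power2)
    also have "\<dots> \<le> norm (kernel_op k ?h) * norm g" by (rule cinner_Cauchy_Schwarz)
    also have "\<dots> \<le> (S' * norm g) * norm g"
      unfolding comp by (intro mult_right_mono norm_kernel_op_le[OF c]) auto
    finally show ?thesis by (simp add: power2_eq_square)
  qed
  let ?n = "norm (kernel_op k \<phi>)"
  have "complex_of_real (?n\<^sup>2) = cinner \<phi> (kernel_op (adj_kernel k) (kernel_op k \<phi>))"
    unfolding cinner_self[symmetric] by (rule cinner_kernel_op[OF k])
  then have "?n\<^sup>2 = cmod (cinner \<phi> (kernel_op (adj_kernel k) (kernel_op k \<phi>)))"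
    by (metis norm_of_real abs_of_nonneg zero_le_power2)
  also have "\<dots> \<le> norm \<phi> * norm (kernel_op (adj_kernel k) (kernel_op k \<phi>))"
    by (rule cinner_Cauchy_Schwarz)
  finally have "(?n\<^sup>2)\<^sup>2 \<le> (norm \<phi> * norm (kernel_op (adj_kernel k) (kernel_op k \<phi>)))\<^sup>2"
    by (rule power_mono) simp
  also have "\<dots> \<le> (norm \<phi>)\<^sup>2 * (S' * ?n\<^sup>2)"
    unfolding power_mult_distrib by (intro mult_left_mono adj) simp
  \<comment> \<open>Cauchy-Schwarz against T* T \<phi> together with the bound for T* leaves a
    common factor \<open>?n\<^sup>2\<close>, which cancels unless it is 0.\<close>
  finally have *: "?n\<^sup>2 * ?n\<^sup>2 \<le> (S' * (norm \<phi>)\<^sup>2) * ?n\<^sup>2"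
    by (simp add: power2_eq_square ac_simps)
  show ?thesis
  proof (cases "?n = 0")
    case True
    then show ?thesis using S' by simp
  next
    case False
    then have "0 < ?n\<^sup>2" by simp
    with * show ?thesis by (rule mult_right_le_imp_le)
  qed
qed

section \<open>Compactness and Schatten classes\<close>

text \<open>Conjugated because \<open>cinner\<close> is antilinear in its second argument: the row
  is the Riesz representative of evaluating the image function at \<open>t\<close>.\<close>

definition kernel_row :: "('a::euclidean_space \<Rightarrow> 'a \<Rightarrow> complex) \<Rightarrow> 'a \<Rightarrow> 'a L2" where
  "kernel_row k t = abs_L2 (\<lambda>s. cnj (k t s))"

lemma square_integrable_cnj: "square_integrable f \<Longrightarrow> square_integrable (\<lambda>s. cnj (f s))"
  by (auto simp: square_integrable_def intro: borel_measurable_cnj)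

lemma int_op_eq_cinner:
  assumes "square_integrable (k t)" "square_integrable f"
  shows "int_op k f t = cinner (abs_L2 f) (kernel_row k t)"
  using assms square_integrable_cnj[OF assms(1)]
  by (simp add: int_op_def kernel_row_def cinner_abs_L2 mult.commute)

lemma int_op_rep_eq_cinner:
  assumes "square_integrable (k t)"
  shows "int_op k (rep_L2 \<phi>) t = cinner \<phi> (kernel_row k t)"
  using int_op_eq_cinner[where k = k and t = t, OF assms square_integrable_rep] by (simp add: abs_rep_L2)

lemma norm_kernel_row:
  assumes "square_integrable (k t)"
  shows "ennreal ((norm (kernel_row k t))\<^sup>2) = (\<integral>\<^sup>+s. ennreal ((cmod (k t s))\<^sup>2) \<partial>lborel)"
  unfolding kernel_row_def using norm_abs_L2[OF square_integrable_cnj[OF assms]] by simp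

lemma cmod_int_op_le:
  assumes "square_integrable (k t)"
  shows "cmod (int_op k (rep_L2 \<phi>) t) \<le> norm \<phi> * norm (kernel_row k t)"
  unfolding int_op_rep_eq_cinner[of k t, OF assms] by (rule cinner_Cauchy_Schwarz)

lemma norm_kernel_op_nn:
  assumes "schur_kernel S k"
  shows "ennreal ((norm (kernel_op k \<phi>))\<^sup>2)
    = (\<integral>\<^sup>+t. ennreal ((cmod (int_op k (rep_L2 \<phi>) t))\<^sup>2) \<partial>lborel)"
  unfolding kernel_op_def
  by (rule norm_abs_L2[OF square_integrable_int_op[OF assms square_integrable_rep]])

text \<open>A sequence in the closure is shadowed, with error 1/(n+1), by a sequence in
  \<open>A\<close>, and both have the same limits along any subsequence.\<close>

lemma compact_closure_sequentially:
  fixes A :: "'a::real_normed_vector set"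
  assumes "\<And>f. (\<And>n::nat. f n \<in> A) \<Longrightarrow> \<exists>l r. strict_mono r \<and> (f \<circ> r) \<longlonglongrightarrow> l"
  shows "compact (closure A)"
  unfolding compact_eq_seq_compact_metric seq_compact_def
proof (intro allI impI)
  fix f :: "nat \<Rightarrow> 'a"
  assume f: "\<forall>n. f n \<in> closure A"
  have "\<exists>y\<in>A. dist y (f n) < 1 / real (Suc n)" for n
    using f closure_approachable[of "f n" A] by (auto simp del: of_nat_Suc)
  then obtain g where g: "\<And>n. g n \<in> A" "\<And>n. dist (g n) (f n) < 1 / real (Suc n)"
    by metis
  obtain l r where r: "strict_mono r" "(g \<circ> r) \<longlonglongrightarrow> l"
    using assms[of g] g(1) by blast
  have "(\<lambda>n. dist (g n) (f n)) \<longlonglongrightarrow> 0"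
    by (rule tendsto_sandwich[OF _ _ tendsto_const LIMSEQ_inverse_real_of_nat])
       (auto intro!: always_eventually less_imp_le simp: g(2) inverse_eq_divide simp del: of_nat_Suc)
  then have "(\<lambda>n. dist ((g \<circ> r) n) ((f \<circ> r) n)) \<longlonglongrightarrow> 0"
    using LIMSEQ_subseq_LIMSEQ[OF _ r(1)] by (fastforce simp: o_def)
  then have "(\<lambda>n. (g \<circ> r) n - (f \<circ> r) n) \<longlonglongrightarrow> 0"
    unfolding dist_norm by (rule tendsto_norm_zero_cancel)
  with r(2) have "(f \<circ> r) \<longlonglongrightarrow> l" by (rule Lim_transform2)
  moreover have "l \<in> closure A"
    using g(1) r(2) by (auto simp: closure_sequential intro!: exI[of _ "g \<circ> r"])
  ultimately show "\<exists>l\<in>closure A. \<exists>r. strict_mono r \<and> (f \<circ> r) \<longlonglongrightarrow> l"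
    using r(1) by blast
qed

lemma power2_cmod_diff_le: "(cmod (a - b))\<^sup>2 \<le> 2 * (cmod a)\<^sup>2 + 2 * (cmod b)\<^sup>2"
proof -
  have "(cmod (a - b))\<^sup>2 \<le> (cmod a + cmod b)\<^sup>2"
    by (intro power_mono norm_triangle_ineq4) auto
  also have "\<dots> \<le> 2 * (cmod a)\<^sup>2 + 2 * (cmod b)\<^sup>2"
    using sum_squares_bound[of "cmod a" "cmod b"] by (simp add: power2_sum)
  finally show ?thesis .
qed

text \<open>A form of weak sequential compactness of the unit ball, tested only on the vectors
  \<open>R t\<close>. A diagonal argument gives convergence for \<open>t\<close> in a countable
  dense subset of the parameter space; continuity of \<open>R\<close> and the common bound on the
  norms of the \<open>f n\<close> carry it to every \<open>t\<close> by an e/3 argument.\<close>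

lemma pointwise_convergent_subseq_cinner:
  fixes f :: "nat \<Rightarrow> 'a::euclidean_space L2" and R :: "'b::euclidean_space \<Rightarrow> 'a L2"
  assumes f: "\<And>n. norm (f n) \<le> 1" and R: "\<And>t. norm (R t) \<le> B" "continuous_on UNIV R"
  obtains r where "strict_mono r" "\<And>t. convergent (\<lambda>n. cinner (f (r n)) (R t))"
proof -
  obtain D :: "'b set" where D: "countable D" "\<And>X. open X \<Longrightarrow> X \<noteq> {} \<Longrightarrow> \<exists>d\<in>D. d \<in> X"
    by (rule countable_dense_setE) blast
  have bd: "cmod (cinner (f n) u) \<le> norm u" for n u
    using cinner_Cauchy_Schwarz[of "f n" u] mult_right_mono[OF f[of n], of "norm u"] by simp
  have "cmod (cinner (f n) (R t)) \<le> B" for n t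
    using bd[of n "R t"] R(1)[of t] by simp
  then obtain r where r: "strict_mono r" "\<And>t. t \<in> D \<Longrightarrow> \<exists>l. (\<lambda>n. cinner (f (r n)) (R t)) \<longlonglongrightarrow> l"
    using function_convergent_subsequence[OF D(1), of "\<lambda>n t. cinner (f n) (R t)" B] by metis
  have "convergent (\<lambda>n. cinner (f (r n)) (R t))" for t
  proof (rule Cauchy_convergent, rule metric_CauchyI)
    fix e :: real assume e: "0 < e"
    have "isCont R t" using R(2) by (simp add: continuous_on_eq_continuous_at)
    then obtain \<delta> where \<delta>: "0 < \<delta>" "\<And>u. dist u t < \<delta> \<Longrightarrow> dist (R u) (R t) < e / 3"
      using e unfolding continuous_at_eps_delta by (metis divide_pos_pos zero_less_numeral)
    obtain d where d: "d \<in> D" "d \<in> ball t \<delta>"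
      using D(2)[of "ball t \<delta>"] \<delta>(1) by auto
    have close: "cmod (cinner (f n) (R t) - cinner (f n) (R d)) < e / 3" for n
    proof -
      have "cinner (f n) (R t) - cinner (f n) (R d) = cinner (f n) (R t - R d)"
        by (subst (1 2 3) cinner_commute) (simp add: cinner_diff_left)
      then show ?thesis
        using bd[of n "R t - R d"] \<delta>(2)[of d] d by (simp add: dist_norm norm_minus_commute)
    qed
    have "Cauchy (\<lambda>n. cinner (f (r n)) (R d))"
      using r(2)[OF d(1)] by (auto intro: LIMSEQ_imp_Cauchy)
    then obtain M where M: "\<And>m n. m \<ge> M \<Longrightarrow> n \<ge> M \<Longrightarrow>
        dist (cinner (f (r m)) (R d)) (cinner (f (r n)) (R d)) < e / 3"
      using e unfolding Cauchy_def by (metis divide_pos_pos zero_less_numeral)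
    have "dist (cinner (f (r m)) (R t)) (cinner (f (r n)) (R t)) < e" if "m \<ge> M" "n \<ge> M" for m n
    proof -
      have "dist (cinner (f (r m)) (R t)) (cinner (f (r n)) (R t))
        \<le> dist (cinner (f (r m)) (R t)) (cinner (f (r m)) (R d))
          + dist (cinner (f (r m)) (R d)) (cinner (f (r n)) (R d))
          + dist (cinner (f (r n)) (R d)) (cinner (f (r n)) (R t))"
        by (meson dist_triangle add_right_mono order_trans)
      also have "\<dots> < e / 3 + e / 3 + e / 3"
        using close[of "r m"] close[of "r n"] M[OF that]
        by (intro add_strict_mono) (auto simp: dist_norm norm_minus_commute)
      finally show ?thesis by simp
    qed
    then show "\<exists>M. \<forall>m\<ge>M. \<forall>n\<ge>M.
        dist (cinner (f (r m)) (R t)) (cinner (f (r n)) (R t)) < e" by blast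
  qed
  with r(1) that show thesis by blast
qed

lemma nn_integral_split_set:
  fixes f :: "'a::euclidean_space \<Rightarrow> ennreal"
  assumes "T \<in> sets borel" "f \<in> borel_measurable borel"
  shows "(\<integral>\<^sup>+t. f t \<partial>lborel) = (\<integral>\<^sup>+t\<in>T. f t \<partial>lborel) + (\<integral>\<^sup>+t\<in>-T. f t \<partial>lborel)"
proof -
  have "(\<integral>\<^sup>+t. f t \<partial>lborel) = (\<integral>\<^sup>+t. f t * indicator T t + f t * indicator (-T) t \<partial>lborel)"
    by (intro nn_integral_cong) (auto split: split_indicator)
  also have "\<dots> = (\<integral>\<^sup>+t\<in>T. f t \<partial>lborel) + (\<integral>\<^sup>+t\<in>-T. f t \<partial>lborel)"
    using assms by (intro nn_integral_add) auto
  finally show ?thesis .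
qed

lemma ennreal_add_less_le:
  assumes "a < ennreal x" "b \<le> ennreal y"
  shows "a + b < ennreal x + ennreal y"
proof -
  have "b < top" using assms(2) by (rule le_less_trans) simp
  have "a + b < ennreal x + b"
    using assms(1) \<open>b < top\<close> by (simp add: add.commute[of _ b] ennreal_add_left_cancel_less less_top)
  also have "\<dots> \<le> ennreal x + ennreal y" using assms(2) by (rule add_left_mono)
  finally show ?thesis .
qed

text \<open>Along a weakly convergent subsequence the image functions converge at every point,
  because a point value is a pairing with a row. On \<open>T\<close> the row norms dominate, so the
  convergence is in L2; off \<open>T\<close> all images of the unit ball are uniformly
  small.\<close>

lemma compact_operator_kernel_op:
  fixes k :: "'a::euclidean_space \<Rightarrow> 'a \<Rightarrow> complex"
  assumes k: "schur_kernel S k"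
    and rows: "\<And>t. square_integrable (k t)" "\<And>t. norm (kernel_row k t) \<le> B"
      "continuous_on UNIV (kernel_row k)"
    and T: "\<And>e. e > 0 \<Longrightarrow> \<exists>T. T \<in> sets borel \<and>
      (\<integral>\<^sup>+t\<in>T. ennreal ((norm (kernel_row k t))\<^sup>2) \<partial>lborel) < \<infinity> \<and>
      (\<forall>\<phi>. norm \<phi> \<le> 1 \<longrightarrow>
        (\<integral>\<^sup>+t\<in>-T. ennreal ((cmod (int_op k (rep_L2 \<phi>) t))\<^sup>2) \<partial>lborel) \<le> ennreal e)"
  shows "compact_operator (kernel_op k)"
  unfolding compact_operator_def
proof (intro conjI linear_kernel_op[OF k] compact_closure_sequentially)
  fix F :: "nat \<Rightarrow> 'a L2"
  assume F: "\<And>n. F n \<in> kernel_op k ` cball 0 1"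
  note [measurable] = schur_kernel_measurable[OF k]
  have "\<exists>f. norm f \<le> 1 \<and> F n = kernel_op k f" for n using F[of n] by auto
  then obtain f where f: "\<And>n. norm (f n) \<le> 1" "\<And>n. F n = kernel_op k (f n)" by metis
  obtain r where r: "strict_mono r" "\<And>t. convergent (\<lambda>n. cinner (f (r n)) (kernel_row k t))"
    using pointwise_convergent_subseq_cinner[of f "kernel_row k" B] f(1) rows(2,3) by metis
  define h where "h n = int_op k (rep_L2 (f (r n)))" for n
  define g where "g t = lim (\<lambda>n. h n t)" for t
  have h_g: "(\<lambda>n. h n t) \<longlonglongrightarrow> g t" for t
    using r(2)[of t] unfolding g_def h_def int_op_rep_eq_cinner[of k, OF rows(1)]
    by (simp add: convergent_LIMSEQ_iff)
  have [measurable]: "h n \<in> borel_measurable borel" for n unfolding h_def by measurable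
  have [measurable]: "g \<in> borel_measurable borel"
    by (rule borel_measurable_LIMSEQ_metric[OF _ h_g]) measurable
  have [measurable]: "kernel_row k \<in> borel_measurable borel"
    using rows(3) by (rule borel_measurable_continuous_onI)
  have h_le: "cmod (h n t) \<le> norm (kernel_row k t)" for n t
    using cmod_int_op_le[of k t "f (r n)", OF rows(1)]
      mult_right_mono[OF f(1)[of "r n"], of "norm (kernel_row k t)"] by (simp add: h_def)
  have g_le: "cmod (g t) \<le> norm (kernel_row k t)" for t
    by (rule LIMSEQ_le_const2[OF tendsto_norm[OF h_g]]) (use h_le in auto)
  let ?D = "\<lambda>n. \<integral>\<^sup>+t. ennreal ((cmod (h n t - g t))\<^sup>2) \<partial>lborel"
  have conv: "\<forall>\<^sub>F n in sequentially. ?D n < ennreal e"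
    if e: "e > 0" for e
  proof -
    \<comment> \<open>The tail of a difference is at most twice the sum of the two tails, so e / 8
      for each of them yields e / 2.\<close>
    obtain T where [measurable]: "T \<in> sets borel"
      and TR: "(\<integral>\<^sup>+t\<in>T. ennreal ((norm (kernel_row k t))\<^sup>2) \<partial>lborel) < \<infinity>"
      and tail: "\<And>\<phi>. norm \<phi> \<le> 1 \<Longrightarrow>
        (\<integral>\<^sup>+t\<in>-T. ennreal ((cmod (int_op k (rep_L2 \<phi>) t))\<^sup>2) \<partial>lborel) \<le> ennreal (e / 8)"
      using T[of "e / 8"] e by auto
    have "(\<lambda>n. \<integral>\<^sup>+t. ennreal ((cmod (h n t - g t))\<^sup>2) * indicator T t \<partial>lborel)
        \<longlonglongrightarrow> (\<integral>\<^sup>+t. 0 \<partial>(lborel :: 'a measure))"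
    proof (rule nn_integral_dominated_convergence[where w =
          "\<lambda>t. ennreal (4 * (norm (kernel_row k t))\<^sup>2) * indicator T t"])
      show "AE t in lborel. ennreal ((cmod (h n t - g t))\<^sup>2) * indicator T t
          \<le> ennreal (4 * (norm (kernel_row k t))\<^sup>2) * indicator T t" for n
      proof (rule AE_I2, rule mult_right_mono, rule ennreal_leI)
        fix t
        have "(cmod (h n t - g t))\<^sup>2 \<le> 2 * (cmod (h n t))\<^sup>2 + 2 * (cmod (g t))\<^sup>2"
          by (rule power2_cmod_diff_le)
        also have "\<dots> \<le> 2 * (norm (kernel_row k t))\<^sup>2 + 2 * (norm (kernel_row k t))\<^sup>2"
          by (intro add_mono mult_left_mono power_mono h_le g_le) auto
        finally show "(cmod (h n t - g t))\<^sup>2 \<le> 4 * (norm (kernel_row k t))\<^sup>2" by simp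
      qed simp
      show "(\<integral>\<^sup>+t. ennreal (4 * (norm (kernel_row k t))\<^sup>2) * indicator T t \<partial>lborel) < \<infinity>"
        using TR by (simp add: ennreal_mult mult.assoc nn_integral_cmult ennreal_mult_less_top)
      have "(\<lambda>n. ennreal ((cmod (h n t - g t))\<^sup>2)) \<longlonglongrightarrow> 0" for t
      proof -
        have "(\<lambda>n. (cmod (h n t - g t))\<^sup>2) \<longlonglongrightarrow> (cmod (g t - g t))\<^sup>2"
          by (intro tendsto_intros h_g)
        then show ?thesis using tendsto_ennrealI by fastforce
      qed
      then show "AE t in lborel. (\<lambda>n. ennreal ((cmod (h n t - g t))\<^sup>2) * indicator T t) \<longlonglongrightarrow> 0"
        by (intro AE_I2) (auto split: split_indicator)
    qed measurable
    then have ev: "\<forall>\<^sub>F n in sequentially.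
        (\<integral>\<^sup>+t. ennreal ((cmod (h n t - g t))\<^sup>2) * indicator T t \<partial>lborel) < ennreal (e / 2)"
      using e by (intro order_tendstoD(2)[of _ 0]) auto
    let ?t = "\<lambda>u. \<integral>\<^sup>+t\<in>-T. ennreal ((cmod (u t))\<^sup>2) \<partial>lborel"
    have htail: "?t (h n) \<le> ennreal (e / 8)" for n
      unfolding h_def by (intro tail f)
    \<comment> \<open>The tail bound is known for images of unit vectors only; Fatou's lemma passes
      it to the pointwise limit.\<close>
    have gtail: "?t g \<le> ennreal (e / 8)"
    proof -
      have "?t g
          = (\<integral>\<^sup>+t. liminf (\<lambda>n. ennreal ((cmod (h n t))\<^sup>2) * indicator (-T) t) \<partial>lborel)"
      proof (rule nn_integral_cong)
        fix t
        have "(\<lambda>n. ennreal ((cmod (h n t))\<^sup>2) * indicator (-T) t)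
            \<longlonglongrightarrow> ennreal ((cmod (g t))\<^sup>2) * indicator (-T) t"
          by (auto split: split_indicator intro!: tendsto_ennrealI tendsto_intros h_g)
        then show "ennreal ((cmod (g t))\<^sup>2) * indicator (-T) t
            = liminf (\<lambda>n. ennreal ((cmod (h n t))\<^sup>2) * indicator (-T) t)"
          by (intro lim_imp_Liminf[symmetric]) auto
      qed
      also have "\<dots> \<le> liminf (\<lambda>n. ?t (h n))"
        by (rule nn_integral_liminf) measurable
      also have "\<dots> \<le> liminf (\<lambda>n. ennreal (e / 8))"
        by (intro Liminf_mono always_eventually allI htail)
      finally show ?thesis by (simp add: Liminf_const)
    qed
    have hg_tail: "(\<integral>\<^sup>+t\<in>-T. ennreal ((cmod (h n t - g t))\<^sup>2) \<partial>lborel) \<le> ennreal (e / 2)" for n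
    proof -
      have "(\<integral>\<^sup>+t\<in>-T. ennreal ((cmod (h n t - g t))\<^sup>2) \<partial>lborel)
          \<le> (\<integral>\<^sup>+t. 2 * (ennreal ((cmod (h n t))\<^sup>2) * indicator (-T) t)
              + 2 * (ennreal ((cmod (g t))\<^sup>2) * indicator (-T) t) \<partial>lborel)"
      proof (rule nn_integral_mono)
        fix t
        have "ennreal ((cmod (h n t - g t))\<^sup>2) \<le> ennreal (2 * (cmod (h n t))\<^sup>2 + 2 * (cmod (g t))\<^sup>2)"
          by (intro ennreal_leI power2_cmod_diff_le)
        then show "ennreal ((cmod (h n t - g t))\<^sup>2) * indicator (-T) t
            \<le> 2 * (ennreal ((cmod (h n t))\<^sup>2) * indicator (-T) t)
              + 2 * (ennreal ((cmod (g t))\<^sup>2) * indicator (-T) t)"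
          by (auto simp: ennreal_mult split: split_indicator)
      qed
      also have "\<dots> = 2 * ?t (h n)
          + 2 * ?t g"
        by (simp add: nn_integral_add nn_integral_cmult)
      also have "\<dots> \<le> 2 * ennreal (e / 8) + 2 * ennreal (e / 8)"
        by (intro add_mono mult_left_mono htail gtail) auto
      also have "\<dots> = ennreal (2 * (e / 8) + 2 * (e / 8))"
        using e by (simp only: ennreal_plus ennreal_mult ennreal_numeral)
      finally show ?thesis by simp
    qed
    show ?thesis
    proof (rule eventually_mono[OF ev])
      fix n
      assume "(\<integral>\<^sup>+t. ennreal ((cmod (h n t - g t))\<^sup>2) * indicator T t \<partial>lborel) < ennreal (e / 2)"
      then have "?D n < ennreal (e / 2) + ennreal (e / 2)"
        by (subst nn_integral_split_set[of T]) (auto intro!: ennreal_add_less_le hg_tail)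
      then show "?D n < ennreal e"
        using e by (simp flip: ennreal_plus)
    qed
  qed
  have hsq: "square_integrable (h n)" for n
    unfolding h_def by (rule square_integrable_int_op[OF k square_integrable_rep])
  \<comment> \<open>The limit differs from one of the L2 functions \<open>h n\<close> by a function
    of finite L2 norm.\<close>
  have gsq: "square_integrable g"
  proof -
    obtain n where n: "?D n < ennreal 1"
      using eventually_happens[OF conv[of 1]] by auto
    then have "square_integrable (\<lambda>t. h n t - g t)"
      by (intro square_integrableI) (auto intro: less_trans)
    from square_integrable_diff[OF hsq[of n] this] show ?thesis by simp
  qed
  have "(\<lambda>n. norm (F (r n) - abs_L2 g)) \<longlonglongrightarrow> 0"
  proof (rule LIMSEQ_I)
    fix e :: real assume e: "e > 0"
    then have "0 < e\<^sup>2" by simp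
    from conv[OF this] have "\<forall>\<^sub>F n in sequentially. norm (F (r n) - abs_L2 g) < e"
    proof (rule eventually_mono)
      fix n assume *: "?D n < ennreal (e\<^sup>2)"
      have "F (r n) - abs_L2 g = abs_L2 (\<lambda>t. h n t - g t)"
        using hsq[of n] gsq by (simp add: f(2) kernel_op_def h_def abs_L2_diff)
      then have "ennreal ((norm (F (r n) - abs_L2 g))\<^sup>2) < ennreal (e\<^sup>2)"
        using * norm_abs_L2[OF square_integrable_diff[OF hsq[of n] gsq]] by simp
      then show "norm (F (r n) - abs_L2 g) < e"
        using e by (simp add: ennreal_less_iff power2_less_imp_less)
    qed
    then show "\<exists>no. \<forall>n\<ge>no. norm (norm (F (r n) - abs_L2 g) - 0) < e"
      by (auto simp: eventually_sequentially)
  qed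
  then have "(F \<circ> r) \<longlonglongrightarrow> abs_L2 g"
    by (auto simp: o_def tendsto_norm_zero_iff LIM_zero_iff intro: LIM_zero_cancel)
  with r(1) show "\<exists>l r. strict_mono r \<and> (F \<circ> r) \<longlonglongrightarrow> l" by blast
qed


section \<open>Singular values and how many of them exceed a level\<close>

lemma cinner_right_cancel:
  assumes "\<And>f. cinner f x = cinner f y"
  shows "x = y"
proof -
  have "cinner (x - y) x = cinner (x - y) y" by (rule assms)
  then have "cinner (x - y) (x - y) = 0"
    using cinner_add_right[of "x - y" "x - y" y] by simp
  then show ?thesis by (simp add: cinner_self)
qed

text \<open>Adjoints are unique, so the choice made by \<open>SOME\<close> is the operator with the
  adjoint kernel; linearity of that operator then turns singular spaces into subspaces.\<close>

lemma cadjoint_kernel_op_eq: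
  assumes k: "schur_kernel S k"
  shows "cadjoint (kernel_op k) = kernel_op (adj_kernel k)"
proof
  fix \<psi>
  show "cadjoint (kernel_op k) \<psi> = kernel_op (adj_kernel k) \<psi>"
    by (rule cinner_right_cancel)
       (simp flip: cadjoint_kernel_op[OF k] cinner_kernel_op[OF k])
qed

lemma subspace_singular_space:
  assumes k: "schur_kernel S k"
  shows "L2.subspace (singular_space (kernel_op k) s)"
proof -
  note ka = schur_adj_kernel[OF k]
  have [simp]: "kernel_op k 0 = 0" "kernel_op (adj_kernel k) 0 = 0"
    using kernel_op_scaleC[OF k, of 0 0] kernel_op_scaleC[OF ka, of 0 0] by simp_all
  show ?thesis
    unfolding singular_space_def cadjoint_kernel_op_eq[OF k]
    by (intro L2.subspaceI)
       (simp_all add: kernel_op_add[OF k] kernel_op_add[OF ka] kernel_op_scaleC[OF k]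
         kernel_op_scaleC[OF ka] L2.scale_right_distrib mult.commute)
qed

lemma cinner_singular_space:
  assumes k: "schur_kernel S k" and f: "f \<in> singular_space (kernel_op k) s"
  shows "cinner (kernel_op k f) (kernel_op k g) = complex_of_real (s\<^sup>2) * cinner f g"
proof -
  have "cinner (kernel_op k g) (kernel_op k f) = complex_of_real (s\<^sup>2) * cinner g f"
    using f unfolding cadjoint_kernel_op[OF k] singular_space_def by (simp add: cinner_scaleC_right)
  then show ?thesis
    by (subst (1 2) cinner_commute) simp
qed

lemma norm_kernel_op_singular_space:
  assumes k: "schur_kernel S k" and f: "f \<in> singular_space (kernel_op k) s"
  shows "(norm (kernel_op k f))\<^sup>2 = s\<^sup>2 * (norm f)\<^sup>2"
proof -
  have "complex_of_real ((norm (kernel_op k f))\<^sup>2) = complex_of_real (s\<^sup>2 * (norm f)\<^sup>2)"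
    using cinner_singular_space[OF k f, of f] by (simp add: cinner_self)
  then show ?thesis by (simp only: of_real_eq_iff)
qed

lemma singular_spaces_orthogonal:
  assumes k: "schur_kernel S k"
    and f: "f \<in> singular_space (kernel_op k) s" and g: "g \<in> singular_space (kernel_op k) r"
    and "s > 0" "r > 0" "s \<noteq> r"
  shows "cinner f g = 0"
proof -
  have "complex_of_real (s\<^sup>2) * cinner f g = cnj (complex_of_real (r\<^sup>2) * cinner g f)"
    unfolding cinner_singular_space[OF k f, symmetric] cinner_singular_space[OF k g, symmetric]
    by (rule cinner_commute)
  also have "\<dots> = complex_of_real (r\<^sup>2) * cinner f g"
    using cinner_commute[of f g] by simp
  finally have "(complex_of_real (s\<^sup>2) - complex_of_real (r\<^sup>2)) * cinner f g = 0"
    by (simp add: left_diff_distrib)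
  moreover have "s\<^sup>2 \<noteq> r\<^sup>2" using assms(4-6) by (simp add: power2_eq_iff)
  then have "complex_of_real (s\<^sup>2) - complex_of_real (r\<^sup>2) \<noteq> 0"
    by (simp only: of_real_diff[symmetric] of_real_eq_0_iff)
  ultimately show ?thesis by simp
qed

lemma singular_value_le:
  assumes k: "schur_kernel S k" and s: "s \<in> singular_values (kernel_op k)"
  shows "s \<le> S"
proof -
  obtain f where f: "f \<in> singular_space (kernel_op k) s" "f \<noteq> 0" and "s > 0"
    using s by (auto simp: singular_values_def)
  have "(s * norm f)\<^sup>2 = (norm (kernel_op k f))\<^sup>2"
    using norm_kernel_op_singular_space[OF k f(1)] by (simp add: power_mult_distrib)
  then have "s * norm f = norm (kernel_op k f)"
    using \<open>s > 0\<close> by (simp add: power2_eq_iff_nonneg)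
  also have "\<dots> \<le> S * norm f" by (rule norm_kernel_op_le[OF k])
  finally show ?thesis using f(2) by simp
qed

text \<open>Counting singular values with multiplicity becomes counting orthonormal vectors that the
  operator does not shrink below \<open>s\<close>. Bases of the separate singular spaces can be
  united because eigenvectors of A* A for different eigenvalues are orthogonal.\<close>

lemma orthonormal_singular_vectors:
  assumes k: "schur_kernel S k" and F: "finite F" "\<And>\<sigma>. \<sigma> \<in> F \<Longrightarrow> \<sigma> \<ge> s" and s: "s > 0"
  obtains E where "finite E" "orthonormal E"
    "card E = (\<Sum>\<sigma>\<in>F. L2.dim (singular_space (kernel_op k) \<sigma>))"
    "\<And>e. e \<in> E \<Longrightarrow> (norm (kernel_op k e))\<^sup>2 \<ge> s\<^sup>2"
proof -
  let ?V = "singular_space (kernel_op k)"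
  obtain G where G: "\<And>\<sigma>. finite (G \<sigma>)" "\<And>\<sigma>. card (G \<sigma>) = L2.dim (?V \<sigma>)"
      "\<And>\<sigma>. G \<sigma> \<subseteq> ?V \<sigma>" "\<And>\<sigma>. orthonormal (G \<sigma>)"
    using orthonormal_basis_card_dim[OF subspace_singular_space[OF k]] by metis
  have unit: "cinner e e = 1" if "e \<in> G \<sigma>" for e \<sigma>
    using G(4)[of \<sigma>] that by (simp add: orthonormal_def)
  have orth: "cinner e e' = 0" if "e \<in> G \<sigma>" "e' \<in> G \<tau>" "\<sigma> \<in> F" "\<tau> \<in> F" "\<sigma> \<noteq> \<tau>" for e e' \<sigma> \<tau>
    using that G(3) F(2)[of \<sigma>] F(2)[of \<tau>] s
    by (intro singular_spaces_orthogonal[OF k, of e \<sigma> e' \<tau>]) auto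
  have disj: "G \<sigma> \<inter> G \<tau> = {}" if "\<sigma> \<in> F" "\<tau> \<in> F" "\<sigma> \<noteq> \<tau>" for \<sigma> \<tau>
    using orth[of _ \<sigma> _ \<tau>] unit that by force
  show thesis
  proof (rule that)
    show "finite (\<Union>\<sigma>\<in>F. G \<sigma>)" using F(1) G(1) by auto
    show "orthonormal (\<Union>\<sigma>\<in>F. G \<sigma>)"
      unfolding orthonormal_def
    proof (intro ballI)
      fix e e' assume "e \<in> (\<Union>\<sigma>\<in>F. G \<sigma>)" "e' \<in> (\<Union>\<sigma>\<in>F. G \<sigma>)"
      then obtain \<sigma> \<tau> where *: "\<sigma> \<in> F" "e \<in> G \<sigma>" "\<tau> \<in> F" "e' \<in> G \<tau>" by blast
      show "cinner e e' = (if e = e' then 1 else 0)"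
      proof (cases "\<sigma> = \<tau>")
        case True
        then show ?thesis using G(4)[of \<sigma>] * by (simp add: orthonormal_def)
      next
        case False
        then show ?thesis using orth[of e \<sigma> e' \<tau>] disj[of \<sigma> \<tau>] * by auto
      qed
    qed
    show "card (\<Union>\<sigma>\<in>F. G \<sigma>) = (\<Sum>\<sigma>\<in>F. L2.dim (?V \<sigma>))"
      using F(1) G(1) disj by (subst card_UN_disjoint) (auto simp: G(2))
    show "(norm (kernel_op k e))\<^sup>2 \<ge> s\<^sup>2" if "e \<in> (\<Union>\<sigma>\<in>F. G \<sigma>)" for e
    proof -
      from that obtain \<sigma> where \<sigma>: "\<sigma> \<in> F" "e \<in> G \<sigma>" by blast
      have "complex_of_real ((norm e)\<^sup>2) = complex_of_real 1"
        using unit[OF \<sigma>(2)] by (simp add: cinner_self)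
      then have "(norm e)\<^sup>2 = 1" by (simp only: of_real_eq_iff)
      then have "(norm (kernel_op k e))\<^sup>2 = \<sigma>\<^sup>2"
        using norm_kernel_op_singular_space[OF k, of e \<sigma>] G(3) \<sigma> by auto
      then show ?thesis using F(2)[OF \<sigma>(1)] s by (simp add: power_mono)
    qed
  qed
qed

text \<open>Splitting \<open>\<Sum>\<^sub>e \<parallel>A e\<parallel>\<^sup>2\<close> over \<open>T\<close> and its complement, the first part is bounded by a
  Hilbert--Schmidt norm and the second by an operator norm that is at most half of the total.\<close>

lemma card_singular_vectors_le:
  fixes k :: "'a::euclidean_space \<Rightarrow> 'a \<Rightarrow> complex"
  assumes k: "schur_kernel S k" and rows: "\<And>t. square_integrable (k t)"
    and row [measurable]: "kernel_row k \<in> borel_measurable borel"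
    and T [measurable]: "T \<in> sets borel"
    and head: "(\<integral>\<^sup>+t\<in>T. ennreal ((norm (kernel_row k t))\<^sup>2) \<partial>lborel) \<le> ennreal H" and "H \<ge> 0"
    and tail: "\<And>\<phi>. (\<integral>\<^sup>+t\<in>-T. ennreal ((cmod (int_op k (rep_L2 \<phi>) t))\<^sup>2) \<partial>lborel)
      \<le> ennreal (\<epsilon> * (norm \<phi>)\<^sup>2)"
    and \<epsilon>: "0 \<le> \<epsilon>" "\<epsilon> \<le> s\<^sup>2 / 2"
    and E: "finite E" "orthonormal E" "\<And>e. e \<in> E \<Longrightarrow> (norm (kernel_op k e))\<^sup>2 \<ge> s\<^sup>2"
  shows "real (card E) * s\<^sup>2 \<le> 2 * H"
proof -
  note [measurable] = schur_kernel_measurable[OF k]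
  let ?A = "\<lambda>e t. ennreal ((cmod (int_op k (rep_L2 e) t))\<^sup>2)"
  have norm1: "(norm e)\<^sup>2 = 1" if "e \<in> E" for e
  proof -
    have "cinner e e = 1" using E(2) that by (simp add: orthonormal_def)
    then have "complex_of_real ((norm e)\<^sup>2) = complex_of_real 1" by (simp add: cinner_self)
    then show ?thesis by (simp only: of_real_eq_iff)
  qed
  have "ennreal (real (card E) * s\<^sup>2) = (\<Sum>e\<in>E. ennreal (s\<^sup>2))"
    by (simp add: ennreal_mult ennreal_of_nat_eq_real_of_nat)
  also have "\<dots> \<le> (\<Sum>e\<in>E. ennreal ((norm (kernel_op k e))\<^sup>2))"
    by (intro sum_mono ennreal_leI E)
  also have "\<dots> = (\<Sum>e\<in>E. (\<integral>\<^sup>+t\<in>T. ?A e t \<partial>lborel) + (\<integral>\<^sup>+t\<in>-T. ?A e t \<partial>lborel))"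
    unfolding norm_kernel_op_nn[OF k] by (intro sum.cong refl nn_integral_split_set) measurable
  also have "\<dots> = (\<Sum>e\<in>E. \<integral>\<^sup>+t\<in>T. ?A e t \<partial>lborel) + (\<Sum>e\<in>E. \<integral>\<^sup>+t\<in>-T. ?A e t \<partial>lborel)"
    by (rule sum.distrib)
  also have "(\<Sum>e\<in>E. \<integral>\<^sup>+t\<in>T. ?A e t \<partial>lborel) = (\<integral>\<^sup>+t. (\<Sum>e\<in>E. ?A e t * indicator T t) \<partial>lborel)"
    by (rule nn_integral_sum[symmetric]) measurable
  also have "\<dots> \<le> (\<integral>\<^sup>+t\<in>T. ennreal ((norm (kernel_row k t))\<^sup>2) \<partial>lborel)"
  proof (rule nn_integral_mono)
    fix t
    \<comment> \<open>For fixed \<open>t\<close> the images at \<open>t\<close> are the coefficients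
      of one row with respect to \<open>E\<close>, so by Bessel the bound does not grow with the
      size of \<open>E\<close>.\<close>
    have "(\<Sum>e\<in>E. ?A e t) = ennreal (\<Sum>e\<in>E. (cmod (cinner e (kernel_row k t)))\<^sup>2)"
      by (simp add: int_op_rep_eq_cinner[of k t, OF rows])
    also have "\<dots> \<le> ennreal ((norm (kernel_row k t))\<^sup>2)"
      by (intro ennreal_leI Bessel_inequality E)
    finally show "(\<Sum>e\<in>E. ?A e t * indicator T t) \<le> ennreal ((norm (kernel_row k t))\<^sup>2) * indicator T t"
      by (auto split: split_indicator)
  qed
  also have "\<dots> \<le> ennreal H" by (rule head)
  also have "(\<Sum>e\<in>E. \<integral>\<^sup>+t\<in>-T. ?A e t \<partial>lborel) \<le> (\<Sum>e\<in>E. ennreal (s\<^sup>2 / 2))"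
  proof (rule sum_mono)
    fix e assume "e \<in> E"
    then show "(\<integral>\<^sup>+t\<in>-T. ?A e t \<partial>lborel) \<le> ennreal (s\<^sup>2 / 2)"
      using order_trans[OF tail[of e] ennreal_leI] \<epsilon>(2) norm1[of e] by simp
  qed
  also have "(\<Sum>e\<in>E. ennreal (s\<^sup>2 / 2)) = ennreal (real (card E) * (s\<^sup>2 / 2))"
    by (simp add: ennreal_of_nat_eq_real_of_nat flip: ennreal_mult)
  finally have "ennreal (real (card E) * s\<^sup>2) \<le> ennreal (H + real (card E) * (s\<^sup>2 / 2))"
    using \<open>H \<ge> 0\<close> by (simp add: add_mono)
  then have "real (card E) * s\<^sup>2 \<le> H + real (card E) * (s\<^sup>2 / 2)"
    using \<open>H \<ge> 0\<close> by (subst (asm) ennreal_le_iff) auto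
  then show ?thesis by simp
qed

text \<open>Dyadic summation: the values between S 2^(-j-1) and S 2^(-j) number at most a constant
  times 2^(j q) and weigh about 2^(-j p) each, leaving a geometric series because q < p.\<close>

lemma powr_weighted_summable_on:
  fixes d :: "real \<Rightarrow> nat"
  assumes V: "V \<subseteq> {0<..S}" and q: "q < p" and C: "0 \<le> C"
    and count: "\<And>s F. 0 < s \<Longrightarrow> s \<le> S \<Longrightarrow> finite F \<Longrightarrow> F \<subseteq> V \<inter> {s..} \<Longrightarrow>
      real (\<Sum>\<sigma>\<in>F. d \<sigma>) \<le> C * s powr (-q)"
    and p: "0 < p"
  shows "(\<lambda>s. real (d s) * s powr p) summable_on V"
proof (cases "V = {}")
  case False
  then have S: "S > 0" using V by fastforce
  define x where "x = 2 powr (q - p)"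
  have x: "0 < x" "x < 1" using q by (auto simp: x_def powr_less_one)
  \<comment> \<open>Collects what does not depend on \<open>j\<close> in the product of the count at
    level S 2^(-j-1) with the weight (S 2^(-j))^p; what remains is \<open>x ^ j\<close>.\<close>
  define K where "K = C * S powr (p - q) * 2 powr q"
  have K: "0 \<le> K" using C by (simp add: K_def)
  \<comment> \<open>The index of the dyadic layer. It is nonnegative because every value is at most
    \<open>S\<close>.\<close>
  define \<kappa> where "\<kappa> \<sigma> = nat \<lfloor>log 2 (S / \<sigma>)\<rfloor>" for \<sigma>
  have \<kappa>: "S * 2 powr (- real (\<kappa> \<sigma>) - 1) \<le> \<sigma>" "\<sigma> \<le> S * 2 powr (- real (\<kappa> \<sigma>))" if "\<sigma> \<in> V" for \<sigma>
  proof -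
    have \<sigma>: "0 < \<sigma>" "\<sigma> \<le> S" using that V by auto
    let ?l = "log 2 (S / \<sigma>)"
    have l: "0 \<le> ?l" using \<sigma> S by (simp add: zero_le_log_cancel_iff)
    have eq: "\<sigma> = S * 2 powr (- ?l)" using \<sigma> S by (simp add: powr_minus field_simps)
    have "real (\<kappa> \<sigma>) \<le> ?l" "?l \<le> real (\<kappa> \<sigma>) + 1" using l by (auto simp: \<kappa>_def)
    then show "S * 2 powr (- real (\<kappa> \<sigma>) - 1) \<le> \<sigma>" "\<sigma> \<le> S * 2 powr (- real (\<kappa> \<sigma>))"
      using S by (subst eq; intro mult_left_mono powr_mono; simp)+
  qed
  have bound: "(\<Sum>\<sigma>\<in>F. real (d \<sigma>) * \<sigma> powr p) \<le> (\<Sum>j. K * x ^ j)" if F: "finite F" "F \<subseteq> V" for F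
  proof -
    have "(\<Sum>\<sigma>\<in>F. real (d \<sigma>) * \<sigma> powr p)
        = (\<Sum>j\<in>\<kappa> ` F. \<Sum>\<sigma>\<in>{\<sigma> \<in> F. \<kappa> \<sigma> = j}. real (d \<sigma>) * \<sigma> powr p)"
      by (rule sum.image_gen[OF F(1)])
    also have "\<dots> \<le> (\<Sum>j\<in>\<kappa> ` F. K * x ^ j)"
    proof (rule sum_mono)
      fix j
      let ?G = "{\<sigma> \<in> F. \<kappa> \<sigma> = j}" and ?s = "S * 2 powr (- real j - 1)"
      have "(\<Sum>\<sigma>\<in>?G. real (d \<sigma>) * \<sigma> powr p)
          \<le> (\<Sum>\<sigma>\<in>?G. real (d \<sigma>) * (S * 2 powr (- real j)) powr p)"
      proof (rule sum_mono, rule mult_left_mono, rule powr_mono2)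
        fix \<sigma> assume \<sigma>: "\<sigma> \<in> ?G"
        then show "\<sigma> \<le> S * 2 powr (- real j)" using \<kappa>(2)[of \<sigma>] F by auto
        show "0 \<le> \<sigma>" using \<sigma> F V by fastforce
      qed (use p in auto)
      also have "\<dots> = real (\<Sum>\<sigma>\<in>?G. d \<sigma>) * (S * 2 powr (- real j)) powr p"
        by (simp add: sum_distrib_right)
      also have "\<dots> \<le> (C * ?s powr (-q)) * (S * 2 powr (- real j)) powr p"
      proof (rule mult_right_mono, rule count)
        show "0 < ?s" using S by simp
        have "2 powr (- real j - 1) \<le> 2 powr (0::real)" by (intro powr_mono) auto
        then show "?s \<le> S" using S by simp
        show "finite ?G" using F by simp
        show "?G \<subseteq> V \<inter> {?s..}" using F \<kappa>(1) by auto
      qed simp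
      also have "\<dots> = K * x ^ j"
      proof -
        have "?s powr (-q) = S powr (-q) * 2 powr ((real j + 1) * q)"
          using S by (simp add: powr_mult powr_powr algebra_simps)
        moreover have "(S * 2 powr (- real j)) powr p = S powr p * 2 powr (- real j * p)"
          using S by (simp add: powr_mult powr_powr)
        moreover have "x ^ j = 2 powr (real j * (q - p))"
          by (simp add: x_def powr_powr mult.commute flip: powr_realpow)
        moreover have "S powr (p - q) = S powr (-q) * S powr p"
          by (simp add: powr_add[symmetric])
        moreover have "2 powr ((real j + 1) * q) * 2 powr (- real j * p)
            = 2 powr q * 2 powr (real j * (q - p))"
          by (simp add: powr_add[symmetric] algebra_simps)
        ultimately show ?thesis by (simp add: K_def ac_simps)
      qed
      finally show "(\<Sum>\<sigma>\<in>?G. real (d \<sigma>) * \<sigma> powr p) \<le> K * x ^ j" .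
    qed
    also have "\<dots> \<le> (\<Sum>j. K * x ^ j)"
      using x K F(1) by (intro sum_le_suminf summable_mult summable_geometric) auto
    finally show ?thesis .
  qed
  show ?thesis
    using bound by (intro nonneg_bdd_above_summable_on) (auto intro!: bdd_aboveI2)
qed simp

text \<open>Balance the two bounds: the tail is below s^2 / 2 once R is of order s^(-2/b), and then
  the head allows O(R^a / s^2), that is O(s^(-2 - 2a/b)), singular values above s. The hypothesis on
  \<open>p\<close> is exactly that it exceeds this exponent. The same choice of R gives the
  uniformly small tails needed for compactness.\<close>

theorem kernel_op_in_schatten_class:
  fixes k :: "'a::euclidean_space \<Rightarrow> 'a \<Rightarrow> complex"
  assumes k: "schur_kernel S k"
    and rows: "\<And>t. square_integrable (k t)" "\<And>t. norm (kernel_row k t) \<le> B"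
      "continuous_on UNIV (kernel_row k)"
    and T: "\<And>R. R \<ge> 1 \<Longrightarrow> T R \<in> sets borel"
    and head: "\<And>R. R \<ge> 1 \<Longrightarrow>
      (\<integral>\<^sup>+t\<in>T R. ennreal ((norm (kernel_row k t))\<^sup>2) \<partial>lborel) \<le> ennreal (C * R powr a)"
    and tail: "\<And>R \<phi>. R \<ge> 1 \<Longrightarrow>
      (\<integral>\<^sup>+t\<in>-T R. ennreal ((cmod (int_op k (rep_L2 \<phi>) t))\<^sup>2) \<partial>lborel)
        \<le> ennreal (C * R powr (-b) * (norm \<phi>)\<^sup>2)"
    and pos: "C > 0" "a > 0" "b > 0" and p: "p > 2 + 2 * a / b"
  shows "kernel_op k \<in> schatten_class p"
proof -
  have row [measurable]: "kernel_row k \<in> borel_measurable borel"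
    using rows(3) by (rule borel_measurable_continuous_onI)
  \<comment> \<open>Solves C R^(-b) = \<epsilon> for R, cut off below at 1, where the hypotheses on
    head and tail begin to hold.\<close>
  define radius where "radius \<epsilon> = max 1 ((C / \<epsilon>) powr (1 / b))" for \<epsilon>
  have radius: "radius \<epsilon> \<ge> 1" "C * radius \<epsilon> powr (-b) \<le> \<epsilon>" if "\<epsilon> > 0" for \<epsilon>
  proof -
    show "radius \<epsilon> \<ge> 1" by (simp add: radius_def)
    have "C / \<epsilon> = ((C / \<epsilon>) powr (1 / b)) powr b" using pos that by (simp add: powr_powr)
    also have "\<dots> \<le> radius \<epsilon> powr b" using pos by (intro powr_mono2) (auto simp: radius_def)
    finally show "C * radius \<epsilon> powr (-b) \<le> \<epsilon>"
      using that \<open>radius \<epsilon> \<ge> 1\<close> by (simp add: powr_minus field_simps)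
  qed
  have compact: "compact_operator (kernel_op k)"
  proof (rule compact_operator_kernel_op[OF k rows])
    fix e :: real assume e: "e > 0"
    note r = radius[OF e]
    show "\<exists>T. T \<in> sets borel \<and> (\<integral>\<^sup>+t\<in>T. ennreal ((norm (kernel_row k t))\<^sup>2) \<partial>lborel) < \<infinity> \<and>
      (\<forall>\<phi>. norm \<phi> \<le> 1 \<longrightarrow>
        (\<integral>\<^sup>+t\<in>-T. ennreal ((cmod (int_op k (rep_L2 \<phi>) t))\<^sup>2) \<partial>lborel) \<le> ennreal e)"
    proof (intro exI[of _ "T (radius e)"] conjI allI impI)
      show "T (radius e) \<in> sets borel" by (rule T[OF r(1)])
      show "(\<integral>\<^sup>+t\<in>T (radius e). ennreal ((norm (kernel_row k t))\<^sup>2) \<partial>lborel) < \<infinity>"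
        using head[OF r(1)] by (rule le_less_trans) simp
      fix \<phi> :: "'a L2" assume "norm \<phi> \<le> 1"
      then have "C * radius e powr (-b) * (norm \<phi>)\<^sup>2 \<le> e * 1"
        using r e pos by (intro mult_mono) (auto simp: power_le_one)
      then show "(\<integral>\<^sup>+t\<in>-T (radius e). ennreal ((cmod (int_op k (rep_L2 \<phi>) t))\<^sup>2) \<partial>lborel) \<le> ennreal e"
        using tail[OF r(1), of \<phi>] by (auto intro: order_trans ennreal_leI)
    qed
  qed
  define q where "q = 2 + 2 * a / b"
  define S' where "S' = max S 1"
  \<comment> \<open>The first summand turns s^(-2) into a multiple of s^(-q), which is possible
    since s \<le> S' and q > 2; the second is the power of \<open>2 * C\<close> produced by the
    choice of R.\<close>
  define C' where "C' = 2 * C * (S' powr (q - 2) + (2 * C) powr (a / b))"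
  have q: "q > 2" using pos by (simp add: q_def)
  have "(\<lambda>s. real (L2.dim (singular_space (kernel_op k) s)) * s powr p)
      summable_on singular_values (kernel_op k)"
  proof (rule powr_weighted_summable_on[where S = S' and q = q and C = C'])
    show "singular_values (kernel_op k) \<subseteq> {0<..S'}"
      using singular_value_le[OF k] by (fastforce simp: S'_def singular_values_def)
    show "q < p" using p by (simp add: q_def)
    then show "0 < p" using q by simp
    show "0 \<le> C'" using pos by (simp add: C'_def)
    fix s F
    assume s: "0 < s" "s \<le> S'" and F: "finite F" "F \<subseteq> singular_values (kernel_op k) \<inter> {s..}"
    obtain E where E: "finite E" "orthonormal E"
      "card E = (\<Sum>\<sigma>\<in>F. L2.dim (singular_space (kernel_op k) \<sigma>))"
      "\<And>e. e \<in> E \<Longrightarrow> (norm (kernel_op k e))\<^sup>2 \<ge> s\<^sup>2"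
      using orthonormal_singular_vectors[OF k F(1) _ s(1)] F(2) by blast
    have s2: "s\<^sup>2 / 2 > 0" using s by simp
    define R where "R = radius (s\<^sup>2 / 2)"
    have R: "R \<ge> 1" "C * R powr (-b) \<le> s\<^sup>2 / 2" using radius[OF s2] by (auto simp: R_def)
    have "real (card E) * s\<^sup>2 \<le> 2 * (C * R powr a)"
      using pos R
      by (intro card_singular_vectors_le[OF k rows(1) row T[OF R(1)] head[OF R(1)] _ tail[OF R(1)]
            _ R(2) E(1,2,4)]) auto
    \<comment> \<open>The 1 covers the case in which the radius is cut off at 1.\<close>
    also have "R powr a \<le> 1 + (2 * C) powr (a / b) * s powr (- (2 * a / b))"
    proof (cases "(C / (s\<^sup>2 / 2)) powr (1 / b) \<le> 1")
      case True
      then show ?thesis by (simp add: R_def radius_def)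
    next
      case False
      then have "R powr a = (C / (s\<^sup>2 / 2)) powr (a / b)"
        using pos s by (simp add: R_def radius_def powr_powr)
      also have "C / (s\<^sup>2 / 2) = (2 * C) * s powr (-2)"
        using s by (simp add: powr_minus field_simps)
      also have "\<dots> powr (a / b) = (2 * C) powr (a / b) * s powr (- (2 * a / b))"
        using pos s by (simp add: powr_mult powr_powr)
      finally show ?thesis by simp
    qed
    finally have "real (card E) * s\<^sup>2
        \<le> 2 * C * (1 + (2 * C) powr (a / b) * s powr (- (2 * a / b)))"
      using pos by simp
    then have "real (card E) \<le> 2 * C * (1 + (2 * C) powr (a / b) * s powr (- (2 * a / b))) * s powr (-2)"
      using s by (simp add: powr_minus field_simps)
    also have "\<dots> = 2 * C * (s powr (-2) + (2 * C) powr (a / b) * s powr (-q))"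
      by (simp add: q_def algebra_simps powr_add[symmetric])
    also have "\<dots> \<le> 2 * C * (S' powr (q - 2) * s powr (-q) + (2 * C) powr (a / b) * s powr (-q))"
    proof -
      have "s powr (-2) = s powr (q - 2) * s powr (-q)" by (simp add: powr_add[symmetric])
      also have "\<dots> \<le> S' powr (q - 2) * s powr (-q)"
        using s q by (intro mult_right_mono powr_mono2) auto
      finally show ?thesis using pos by (intro mult_left_mono add_right_mono) auto
    qed
    also have "\<dots> = C' * s powr (-q)" by (simp add: C'_def algebra_simps)
    finally show "real (\<Sum>\<sigma>\<in>F. L2.dim (singular_space (kernel_op k) \<sigma>)) \<le> C' * s powr (-q)"
      by (simp add: E(3))
  qed
  with compact show ?thesis by (simp add: schatten_class_def)
qed

section \<open>Oscillatory integrals\<close>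

lemma cis_has_vector_derivative:
  assumes "(f has_real_derivative f') (at x within S)"
  shows "((\<lambda>x. cis (f x)) has_vector_derivative (complex_of_real f' * \<i> * cis (f x))) (at x within S)"
proof -
  have "((\<lambda>x. complex_of_real (f x)) has_vector_derivative complex_of_real f') (at x within S)"
    using assms by (intro has_vector_derivative_of_real)
      (simp_all add: has_real_derivative_iff_has_vector_derivative)
  moreover have "((\<lambda>z. exp (\<i> * z)) has_field_derivative (exp (\<i> * complex_of_real (f x)) * \<i>))
      (at (complex_of_real (f x)) within (\<lambda>x. complex_of_real (f x)) ` S)"
    by (auto intro!: derivative_eq_intros)
  ultimately have "((\<lambda>z. exp (\<i> * z)) \<circ> (\<lambda>x. complex_of_real (f x)) has_vector_derivative
      complex_of_real f' * (exp (\<i> * complex_of_real (f x)) * \<i>)) (at x within S)"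
    by (rule field_vector_diff_chain_within)
  then show ?thesis by (simp add: o_def cis_conv_exp ac_simps)
qed

lemma measurable_cis [measurable (raw)]:
  "f \<in> borel_measurable M \<Longrightarrow> (\<lambda>x. cis (f x)) \<in> borel_measurable M"
  by (rule measurable_compose[of f _ borel])
     (auto intro!: borel_measurable_continuous_onI continuous_intros)

lemma norm_integral_le_integral:
  fixes f :: "'a \<Rightarrow> 'b::{banach, second_countable_topology}"
  assumes "integrable M f" "integrable M g" "\<And>x. norm (f x) \<le> g x"
  shows "norm (\<integral>x. f x \<partial>M) \<le> (\<integral>x. g x \<partial>M)"
  using assms by (intro order_trans[OF integral_norm_bound] integral_mono) auto

text \<open>Van der Corput's first-derivative test. The usual monotonicity of the derivative is
  replaced by a bound for the second derivative in terms of \<open>m\<close>, so that the remainder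
  after integration by parts is again of order 1/m.\<close>

lemma oscillatory_integral_bound:
  fixes \<psi> :: "real \<Rightarrow> real"
  assumes ab: "a \<le> b"
    and d1: "\<And>x. x \<in> {a..b} \<Longrightarrow> (\<psi> has_real_derivative \<psi>1 x) (at x within {a..b})"
    and d2: "\<And>x. x \<in> {a..b} \<Longrightarrow> (\<psi>1 has_real_derivative \<psi>2 x) (at x within {a..b})"
    and c2: "continuous_on {a..b} \<psi>2"
    and m: "m > 0" "\<And>x. x \<in> {a..b} \<Longrightarrow> m \<le> \<bar>\<psi>1 x\<bar>"
    and K: "\<And>x. x \<in> {a..b} \<Longrightarrow> \<bar>\<psi>2 x\<bar> \<le> K * m"
  shows "cmod (\<integral>x. indicator {a..b} x *\<^sub>R cis (\<psi> x) \<partial>lborel) \<le> (2 + K * (b - a)) / m"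
proof -
  \<comment> \<open>Integration by parts: \<open>G\<close> is the boundary term, and its derivative
    is the integrand minus the remainder \<open>r\<close>. The ends contribute 2/m and the remainder
    at most K (b - a) / m.\<close>
  define G where "G x = cis (\<psi> x) / (\<i> * complex_of_real (\<psi>1 x))" for x
  define r where "r x = cis (\<psi> x) * complex_of_real (\<psi>2 x) / (\<i> * complex_of_real ((\<psi>1 x)\<^sup>2))" for x
  have nz: "\<psi>1 x \<noteq> 0" if "x \<in> {a..b}" for x using m(1) m(2)[OF that] by auto
  have c\<psi>: "continuous_on {a..b} \<psi>" "continuous_on {a..b} \<psi>1"
    using DERIV_continuous_on[of _ \<psi> \<psi>1] DERIV_continuous_on[of _ \<psi>1 \<psi>2] d1 d2 by blast+
  have G': "(G has_vector_derivative (cis (\<psi> x) - r x)) (at x within {a..b})" if x: "x \<in> {a..b}" for x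
  proof -
    have inv: "((\<lambda>x. complex_of_real (1 / \<psi>1 x)) has_vector_derivative
        complex_of_real (- \<psi>2 x / (\<psi>1 x)\<^sup>2)) (at x within {a..b})"
      by (rule has_vector_derivative_of_real)
         (use d2[OF x] nz[OF x] in \<open>auto intro!: derivative_eq_intros
           simp: has_real_derivative_iff_has_vector_derivative[symmetric] power2_eq_square field_simps\<close>)
    have "((\<lambda>x. (cis (\<psi> x) * complex_of_real (1 / \<psi>1 x)) * (- \<i>)) has_vector_derivative
        (cis (\<psi> x) * complex_of_real (- \<psi>2 x / (\<psi>1 x)\<^sup>2)
          + complex_of_real (\<psi>1 x) * \<i> * cis (\<psi> x) * complex_of_real (1 / \<psi>1 x)) * (- \<i>))
        (at x within {a..b})"
      by (intro has_vector_derivative_mult_left has_vector_derivative_mult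
          cis_has_vector_derivative d1[OF x] inv)
    moreover have "(\<lambda>x. (cis (\<psi> x) * complex_of_real (1 / \<psi>1 x)) * (- \<i>)) = G"
      by (simp add: G_def fun_eq_iff divide_inverse mult.left_commute)
    moreover have "(cis (\<psi> x) * complex_of_real (- \<psi>2 x / (\<psi>1 x)\<^sup>2)
          + complex_of_real (\<psi>1 x) * \<i> * cis (\<psi> x) * complex_of_real (1 / \<psi>1 x)) * (- \<i>)
        = cis (\<psi> x) - r x"
      using nz[OF x] by (simp add: r_def field_simps power2_eq_square)
    ultimately show ?thesis by simp
  qed
  have cr: "continuous_on {a..b} r"
    unfolding r_def using nz by (intro continuous_intros c\<psi> c2) auto
  have ccis: "continuous_on {a..b} (\<lambda>x. cis (\<psi> x))" by (intro continuous_intros c\<psi>)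
  have 1: "has_bochner_integral lborel (\<lambda>x. indicator {a..b} x *\<^sub>R (cis (\<psi> x) - r x)) (G b - G a)"
    by (rule has_bochner_integral_FTC_Icc[OF ab G']) (auto intro!: continuous_intros ccis cr)
  have ir: "integrable lborel (\<lambda>x. indicator {a..b} x *\<^sub>R r x)"
    using borel_integrable_compact[OF _ cr] by (simp add: set_integrable_def)
  have ic: "integrable lborel (\<lambda>x. indicator {a..b} x *\<^sub>R cis (\<psi> x))"
    using borel_integrable_compact[OF _ ccis] by (simp add: set_integrable_def)
  have "(\<integral>x. indicator {a..b} x *\<^sub>R (cis (\<psi> x) - r x) \<partial>lborel)
      = (\<integral>x. indicator {a..b} x *\<^sub>R cis (\<psi> x) \<partial>lborel) - (\<integral>x. indicator {a..b} x *\<^sub>R r x \<partial>lborel)"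
    unfolding scaleR_diff_right by (rule Bochner_Integration.integral_diff[OF ic ir])
  then have eq: "(\<integral>x. indicator {a..b} x *\<^sub>R cis (\<psi> x) \<partial>lborel)
      = G b - G a + (\<integral>x. indicator {a..b} x *\<^sub>R r x \<partial>lborel)"
    using has_bochner_integral_integral_eq[OF 1] by simp
  have G_le: "cmod (G x) \<le> 1 / m" if "x \<in> {a..b}" for x
    using m(1) m(2)[OF that] by (simp add: G_def norm_divide norm_mult frac_le)
  have "cmod (\<integral>x. indicator {a..b} x *\<^sub>R r x \<partial>lborel) \<le> (\<integral>x. indicator {a..b} x * (K / m) \<partial>lborel)"
  proof (rule norm_integral_le_integral[OF ir])
    show "integrable lborel (\<lambda>x. indicator {a..b} x * (K / m))" by (simp add: ab)
    fix x
    have "cmod (r x) \<le> K / m" if x: "x \<in> {a..b}"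
    proof -
      have "cmod (r x) = \<bar>\<psi>2 x\<bar> / (\<psi>1 x)\<^sup>2"
        by (simp add: r_def norm_divide norm_mult norm_power)
      also have "\<dots> \<le> (K * m) / m\<^sup>2"
        using m(1) m(2)[OF x] K[OF x] nz[OF x] power_mono[OF m(2)[OF x], of 2]
        by (intro frac_le) (auto intro: order_trans[OF abs_ge_zero])
      finally show ?thesis using m(1) by (simp add: power2_eq_square)
    qed
    then show "cmod (indicator {a..b} x *\<^sub>R r x) \<le> indicator {a..b} x * (K / m)"
      by (auto split: split_indicator)
  qed
  also have "\<dots> = (b - a) * (K / m)" using ab by simp
  finally have "cmod (\<integral>x. indicator {a..b} x *\<^sub>R r x \<partial>lborel) \<le> (b - a) * (K / m)" .
  then have "cmod (\<integral>x. indicator {a..b} x *\<^sub>R cis (\<psi> x) \<partial>lborel) \<le> 1 / m + 1 / m + (b - a) * (K / m)"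
    unfolding eq using G_le[of a] G_le[of b] ab norm_triangle_ineq4[of "G b" "G a"]
    by (intro order_trans[OF norm_triangle_ineq] add_mono) auto
  also have "\<dots> = (2 + K * (b - a)) / m"
    by (simp add: add_divide_distrib diff_divide_distrib algebra_simps)
  finally show ?thesis .
qed

section \<open>The phase and its curvature\<close>

definition theta :: "real \<Rightarrow> real" where
  "theta x = 2 * arctan (sin x / (2 + cos x))"

lemma two_plus_cos_pos: "0 < 2 + cos (x::real)"
  using cos_ge_minus_one[of x] by linarith

lemma five_plus_cos: "1 \<le> 5 + 4 * cos (x::real)" "5 + 4 * cos (x::real) \<le> 9"
  using cos_ge_minus_one[of x] cos_le_one[of x] by linarith+

text \<open>\<open>theta x\<close> is twice the argument of \<open>2 + exp (i x)\<close>, so that \<open>exp (i theta x)\<close> is a quotient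
  of trigonometric polynomials.\<close>

lemma cis_theta: "cis (theta x) * (2 + cis (- x)) = 2 + cis x"
proof -
  define c where "c = 2 + cos x"
  define r where "r = sin x / c"
  have c: "c > 0" using two_plus_cos_pos by (simp add: c_def)
  define w where "w = sqrt (1 + r\<^sup>2)"
  have w: "w > 0" "w * w = 1 + r * r"
    unfolding w_def by (simp_all add: add_pos_nonneg real_sqrt_mult_self power2_eq_square add_nonneg_nonneg)
  have cis_r: "cis (arctan r) = Complex (1 / w) (r / w)"
    by (simp add: complex_eq_iff cos_arctan sin_arctan w_def)
  have "theta x = arctan r + arctan r" by (simp add: theta_def r_def c_def)
  then have "cis (theta x) = Complex (1 / w) (r / w) * Complex (1 / w) (r / w)"
    by (simp only: cis_mult[symmetric] cis_r)
  moreover have "2 + cis (- x) = Complex c (- (r * c))" "2 + cis x = Complex c (r * c)"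
    using c by (simp_all add: complex_eq_iff c_def[symmetric] r_def)
  moreover have "Complex (1 / w) (r / w) * Complex (1 / w) (r / w) * Complex c (- (r * c))
      = Complex ((1 + r * r) * c / (w * w)) (r * c * (1 + r * r) / (w * w))"
    using w(1) by (simp add: complex_eq_iff field_simps)
  moreover have "1 + r * r \<noteq> 0" using mult_pos_pos[OF w(1) w(1)] w(2) by simp
  ultimately show ?thesis
    using w by simp
qed

text \<open>The first derivative of \<open>theta\<close>. The denominator is |2 + exp(i x)|^2, and
  the fraction is the Poisson kernel of radius 1/2 at the angle x + pi.\<close>

definition theta1 :: "real \<Rightarrow> real" where "theta1 x = 1 - 3 / (5 + 4 * cos x)"
definition theta2 :: "real \<Rightarrow> real" where "theta2 x = - 12 * sin x / (5 + 4 * cos x)\<^sup>2"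

lemma DERIV_theta: "(theta has_real_derivative theta1 x) (at x)"
proof -
  have p: "2 + cos x \<noteq> 0" using two_plus_cos_pos[of x] by simp
  have "(theta has_real_derivative
      2 * (inverse (1 + (sin x / (2 + cos x))\<^sup>2)
        * ((cos x * (2 + cos x) - sin x * (- sin x)) / ((2 + cos x) * (2 + cos x))))) (at x)"
    unfolding theta_def[abs_def] using p by (auto intro!: derivative_eq_intros)
  moreover have "2 * (inverse (1 + (sin x / (2 + cos x))\<^sup>2)
        * ((cos x * (2 + cos x) - sin x * (- sin x)) / ((2 + cos x) * (2 + cos x)))) = theta1 x"
  proof -
    have "1 + (sin x / (2 + cos x))\<^sup>2 = ((2 + cos x)\<^sup>2 + (sin x)\<^sup>2) / (2 + cos x)\<^sup>2"
      using p by (simp add: power_divide field_simps)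
    also have "(2 + cos x)\<^sup>2 + (sin x)\<^sup>2 = 5 + 4 * cos x"
      using sin_cos_squared_add[of x] by (simp add: power2_eq_square algebra_simps)
    finally have 1: "1 + (sin x / (2 + cos x))\<^sup>2 = (5 + 4 * cos x) / (2 + cos x)\<^sup>2" .
    have 2: "cos x * (2 + cos x) - sin x * (- sin x) = 2 * cos x + 1"
      using sin_cos_squared_add[of x] by (simp add: power2_eq_square algebra_simps)
    have gen: "2 * (inverse (d / e\<^sup>2) * (y / (e * e))) = 2 * y / d" if "e \<noteq> 0" "d \<noteq> 0" for d e y :: real
      using that by (simp add: power2_eq_square field_simps)
    have "5 + 4 * cos x \<noteq> 0" using five_plus_cos[of x] by linarith
    then show ?thesis
      unfolding 1 2 theta1_def gen[OF p \<open>5 + 4 * cos x \<noteq> 0\<close>] by (simp add: field_simps)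
  qed
  ultimately show ?thesis by simp
qed

lemma DERIV_theta1: "(theta1 has_real_derivative theta2 x) (at x)"
  unfolding theta1_def[abs_def] theta2_def using five_plus_cos[of x]
  by (auto intro!: derivative_eq_intros simp: power2_eq_square)

lemma abs_theta1_le: "\<bar>theta1 x\<bar> \<le> 2"
proof -
  define a where "a = 3 / (5 + 4 * cos x)"
  have "a \<le> 3 / 1" "0 \<le> a"
    unfolding a_def using five_plus_cos[of x] by (intro divide_left_mono divide_nonneg_nonneg; simp)+
  then show ?thesis by (simp add: theta1_def a_def[symmetric])
qed

lemma abs_theta2_le: "\<bar>theta2 x\<bar> \<le> 12"
proof -
  have "\<bar>theta2 x\<bar> = 12 * \<bar>sin x\<bar> / (5 + 4 * cos x)\<^sup>2"
    by (simp add: theta2_def abs_mult)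
  also have "\<dots> \<le> 12 * 1 / 1"
    using five_plus_cos[of x] abs_sin_le_one[of x] by (intro frac_le mult_left_mono) (auto simp: one_le_power)
  finally show ?thesis by simp
qed

lemma DERIV_theta2: "(theta2 has_real_derivative
    (- 12 * cos x / (5 + 4 * cos x)\<^sup>2 - 96 * (sin x)\<^sup>2 / (5 + 4 * cos x) ^ 3)) (at x)"
proof -
  have nz: "5 + 4 * cos x \<noteq> 0" using five_plus_cos[of x] by linarith
  have n: "((\<lambda>x. - 12 * sin x) has_real_derivative - 12 * cos x) (at x)"
    by (auto intro!: derivative_eq_intros)
  have d: "((\<lambda>x. (5 + 4 * cos x)\<^sup>2) has_real_derivative (2 * (5 + 4 * cos x) * (- 4 * sin x))) (at x)"
    by (auto intro!: derivative_eq_intros)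
  have deriv: "(theta2 has_real_derivative ((- 12 * cos x) * (5 + 4 * cos x)\<^sup>2
      - (- 12 * sin x) * (2 * (5 + 4 * cos x) * (- 4 * sin x))) / ((5 + 4 * cos x)\<^sup>2 * (5 + 4 * cos x)\<^sup>2)) (at x)"
    unfolding theta2_def[abs_def] using nz by (intro DERIV_divide n d) simp
  have gen: "(A * d\<^sup>2 - B * (2 * d * C)) / (d\<^sup>2 * d\<^sup>2) = A / d\<^sup>2 - 2 * B * C / d ^ 3"
    if "d \<noteq> 0" for A B C d :: real
    using that by (simp add: power2_eq_square power3_eq_cube field_simps)
  show ?thesis by (rule DERIV_cong[OF deriv[unfolded gen[OF nz]]]) (simp add: power2_eq_square)
qed

lemma continuous_on_theta [continuous_intros]:
  "continuous_on S f \<Longrightarrow> continuous_on S (\<lambda>x. theta (f x))"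
  using continuous_on_compose2[of UNIV theta S f]
  by (auto simp: continuous_at_imp_continuous_on DERIV_isCont[OF DERIV_theta])

lemma continuous_on_theta2 [continuous_intros]:
  "continuous_on S f \<Longrightarrow> continuous_on S (\<lambda>x. theta2 (f x))"
  using continuous_on_compose2[of UNIV theta2 S f]
  by (auto simp: continuous_at_imp_continuous_on DERIV_isCont[OF DERIV_theta2])

lemma theta2_Lipschitz: "\<bar>theta2 x - theta2 y\<bar> \<le> 108 * \<bar>x - y\<bar>"
proof -
  \<comment> \<open>108 = 12 + 96, one summand for each term of the third derivative; the
    denominators are at least 1.\<close>
  have bound: "\<bar>- 12 * cos x / (5 + 4 * cos x)\<^sup>2 - 96 * (sin x)\<^sup>2 / (5 + 4 * cos x) ^ 3\<bar> \<le> 108" for x :: real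
  proof -
    have "\<bar>- 12 * cos x / (5 + 4 * cos x)\<^sup>2\<bar> \<le> 12 * 1 / 1"
      using five_plus_cos[of x] abs_cos_le_one[of x]
      by (simp only: abs_divide abs_mult) (intro frac_le mult_mono, auto simp: one_le_power)
    moreover have "\<bar>96 * (sin x)\<^sup>2 / (5 + 4 * cos x) ^ 3\<bar> \<le> 96 * 1 / 1"
      using five_plus_cos[of x] abs_sin_le_one[of x] abs_square_le_1[of "sin x"]
      by (simp only: abs_divide abs_mult) (intro frac_le mult_mono, auto simp: one_le_power)
    ultimately show ?thesis by linarith
  qed
  have "norm (theta2 x - theta2 y) \<le> 108 * norm (x - y)"
    by (rule field_differentiable_bound[of UNIV theta2 _ 108 x y])
       (use bound in \<open>auto intro!: DERIV_theta2\<close>)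
  then show ?thesis by simp
qed

text \<open>This fixes the window [1,2]: it lies within pi/3 of pi/2, so the sine is at least 1/2,
  while the denominator is at most 81. Hence the constant 6/81.\<close>

lemma theta2_upper:
  assumes "x \<in> {1..2}"
  shows "theta2 x \<le> - (2 / 27)"
proof -
  have "\<bar>x - pi / 2\<bar> \<le> pi / 3"
    using assms pi_gt3 pi_less_4 by (intro abs_leI) auto
  then have "cos (pi / 3) \<le> cos \<bar>x - pi / 2\<bar>"
    by (intro cos_monotone_0_pi_le) auto
  then have s: "1 / 2 \<le> sin x"
    by (simp add: cos_60 cos_diff abs_if split: if_splits)
  have pos: "0 < 5 + 4 * cos x" using five_plus_cos[of x] by linarith
  have "(5 + 4 * cos x)\<^sup>2 \<le> 9\<^sup>2"
    using five_plus_cos[of x] by (intro power_mono) auto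
  then have "12 * (1 / 2) / 81 \<le> 12 * sin x / (5 + 4 * cos x)\<^sup>2"
    using s pos by (intro frac_le) auto
  then show ?thesis by (simp add: theta2_def)
qed

text \<open>Curvature in the form in which it is used: the derivative of a difference of two shifted
  phases grows linearly with the shift.\<close>

lemma theta1_expanding:
  assumes "x \<in> {1..2}" "y \<in> {1..2}"
  shows "2 / 27 * \<bar>x - y\<bar> \<le> \<bar>theta1 x - theta1 y\<bar>"
proof -
  have *: "2 / 27 * (y - x) \<le> theta1 x - theta1 y" if "x < y" "x \<in> {1..2}" "y \<in> {1..2}" for x y
  proof -
    from MVT2[OF that(1), of theta1 theta2] DERIV_theta1
    obtain z where z: "x < z" "z < y" "theta1 y - theta1 x = (y - x) * theta2 z" by blast
    have "(y - x) * theta2 z \<le> (y - x) * (- (2 / 27))"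
      using z that by (intro mult_left_mono theta2_upper) auto
    then show ?thesis using z(3) by linarith
  qed
  show ?thesis
    using *[of x y] *[of y x] assms by (cases x y rule: linorder_cases) auto
qed


section \<open>Correlations of two shifted waves with nearly equal frequencies\<close>

definition osc_pairing :: "real \<Rightarrow> real \<Rightarrow> real \<Rightarrow> real \<Rightarrow> complex" where
  "osc_pairing a a' u u' = (\<integral>s. (indicator {1..2} (s - u) * indicator {1..2} (s - u')) *\<^sub>R
     cis (a * theta (s - u) - a' * theta (s - u')) \<partial>lborel)"

text \<open>Windows shifted by more than 1 are disjoint, hence the indicator. The constant is
  generous: the two regimes of the bound need 55 and 79515 * 55 / 54.\<close>

definition osc_majorant :: "real \<Rightarrow> real \<Rightarrow> real" where
  "osc_majorant R h = indicator {-1..1} h * (160000 / (1 + R * \<bar>h\<bar>))"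

lemma osc_majorant_nonneg: "0 \<le> R \<Longrightarrow> 0 \<le> osc_majorant R h"
  by (simp add: osc_majorant_def)

lemma norm_integral_indicator_cis_le:
  assumes "a \<le> b"
  shows "cmod (\<integral>x. indicator {a..b} x *\<^sub>R cis (f x) \<partial>lborel) \<le> b - a"
proof (cases "integrable lborel (\<lambda>x. indicator {a..b} x *\<^sub>R cis (f x))")
  case True
  then have "cmod (\<integral>x. indicator {a..b} x *\<^sub>R cis (f x) \<partial>lborel) \<le> (\<integral>x. indicator {a..b} x \<partial>lborel)"
    by (rule norm_integral_le_integral) (auto simp: emeasure_lborel_Icc_eq split: split_indicator)
  then show ?thesis using assms by simp
qed (use assms in \<open>simp add: not_integrable_integral_eq\<close>)

text \<open>The phase difference is a times a difference of two shifted copies of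
  \<open>theta\<close>, up to (a - a') times one copy. The first part has derivative at least 2/27
  |a| |u - u'|; the second stays bounded, because a and a' differ by at most 1, and is absorbed as
  soon as R |u - u'| is large. For small R |u - u'| the trivial bound suffices.\<close>

lemma osc_pairing_bound:
  assumes R: "0 \<le> R" "R \<le> \<bar>a\<bar>" and aa': "\<bar>a - a'\<bar> \<le> 1"
  shows "cmod (osc_pairing a a' u u') \<le> osc_majorant R (u - u')"
proof -
  define \<alpha> \<beta> where "\<alpha> = max u u' + 1" and "\<beta> = min u u' + 2"
  define h where "h = \<bar>u - u'\<bar>"
  define \<psi> where "\<psi> s = a * theta (s - u) - a' * theta (s - u')" for s
  have ind: "indicator {1..2} (s - u) * indicator {1..2} (s - u') = (indicator {\<alpha>..\<beta>} s :: real)" for s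
    by (auto simp: \<alpha>_def \<beta>_def split: split_indicator)
  have J: "osc_pairing a a' u u' = (\<integral>s. indicator {\<alpha>..\<beta>} s *\<^sub>R cis (\<psi> s) \<partial>lborel)"
    by (simp add: osc_pairing_def ind \<psi>_def)
  show ?thesis
  proof (cases "h \<le> 1")
    case False
    then have "{\<alpha>..\<beta>} = {}" by (auto simp: h_def \<alpha>_def \<beta>_def)
    then show ?thesis using R(1) by (simp add: J osc_majorant_nonneg)
  next
    case True
    have ab: "\<alpha> \<le> \<beta>" "\<beta> - \<alpha> \<le> 1" using True by (auto simp: h_def \<alpha>_def \<beta>_def)
    have maj: "osc_majorant R (u - u') = 160000 / (1 + R * h)"
      using True by (auto simp: osc_majorant_def h_def split: split_indicator)
    have h0: "0 \<le> h" by (simp add: h_def)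
    show ?thesis
    proof (cases "R * h < 54")
      case True
      have "cmod (osc_pairing a a' u u') \<le> 1"
        unfolding J using norm_integral_indicator_cis_le[OF ab(1), of \<psi>] ab(2) by linarith
      also have "1 \<le> 160000 / (1 + R * h)"
        using True mult_nonneg_nonneg[OF R(1) h0] by (simp add: le_divide_eq)
      finally show ?thesis by (simp add: maj)
    next
      case False
      then have Rh: "54 \<le> R * h" by simp
      have ah: "R * h \<le> \<bar>a\<bar> * h" using R h0 by (intro mult_right_mono) auto
      \<comment> \<open>Half of the lower bound for the main part. The threshold 54 makes
        \<open>m\<close> at least 2, so that subtracting the perturbation, at most 2, still leaves
        \<open>m\<close>.\<close>
      define m where "m = \<bar>a\<bar> * h / 27"
      have m: "2 \<le> m" using Rh ah by (simp add: m_def)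
      define \<psi>1 where "\<psi>1 s = a * theta1 (s - u) - a' * theta1 (s - u')" for s
      define \<psi>2 where "\<psi>2 s = a * theta2 (s - u) - a' * theta2 (s - u')" for s
      have split: "a * x - a' * y = a * (x - y) + (a - a') * y" for x y :: real
        by (simp add: algebra_simps)
      have low: "m \<le> \<bar>\<psi>1 s\<bar>" if s: "s \<in> {\<alpha>..\<beta>}" for s
      proof -
        have "s - u \<in> {1..2}" "s - u' \<in> {1..2}" using s by (auto simp: \<alpha>_def \<beta>_def)
        from theta1_expanding[OF this] have "2 / 27 * h \<le> \<bar>theta1 (s - u) - theta1 (s - u')\<bar>"
          by (simp add: h_def abs_minus_commute)
        then have "\<bar>a\<bar> * (2 / 27 * h) \<le> \<bar>a * (theta1 (s - u) - theta1 (s - u'))\<bar>"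
          unfolding abs_mult by (intro mult_left_mono) auto
        moreover have "\<bar>(a - a') * theta1 (s - u')\<bar> \<le> 1 * 2"
          unfolding abs_mult by (intro mult_mono aa' abs_theta1_le) auto
        ultimately have "2 * m - 2 \<le> \<bar>\<psi>1 s\<bar>"
          unfolding \<psi>1_def split m_def by linarith
        then show ?thesis using m by linarith
      qed
      \<comment> \<open>108 = 2916 / 27, and the perturbation 12 is at most 27 m because m is at
        least 2.\<close>
      have up: "\<bar>\<psi>2 s\<bar> \<le> 2943 * m" for s
      proof -
        have "\<bar>theta2 (s - u) - theta2 (s - u')\<bar> \<le> 108 * h"
          using theta2_Lipschitz[of "s - u" "s - u'"] by (simp add: h_def abs_minus_commute)
        then have "\<bar>a * (theta2 (s - u) - theta2 (s - u'))\<bar> \<le> \<bar>a\<bar> * (108 * h)"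
          unfolding abs_mult by (intro mult_left_mono) auto
        moreover have "\<bar>(a - a') * theta2 (s - u')\<bar> \<le> 1 * 12"
          unfolding abs_mult by (intro mult_mono aa' abs_theta2_le) auto
        ultimately have "\<bar>\<psi>2 s\<bar> \<le> 2916 * m + 12"
          unfolding \<psi>2_def split m_def by linarith
        then show ?thesis using m by linarith
      qed
      have "cmod (osc_pairing a a' u u') \<le> (2 + 2943 * (\<beta> - \<alpha>)) / m"
        unfolding J
      proof (rule oscillatory_integral_bound[OF ab(1)])
        show "(\<psi> has_real_derivative \<psi>1 s) (at s within {\<alpha>..\<beta>})" for s
          unfolding \<psi>_def[abs_def] \<psi>1_def
          by (auto intro!: derivative_eq_intros DERIV_theta[THEN DERIV_chain2])
        show "(\<psi>1 has_real_derivative \<psi>2 s) (at s within {\<alpha>..\<beta>})" for s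
          unfolding \<psi>1_def[abs_def] \<psi>2_def
          by (auto intro!: derivative_eq_intros DERIV_theta1[THEN DERIV_chain2])
        show "continuous_on {\<alpha>..\<beta>} \<psi>2"
          unfolding \<psi>2_def[abs_def] by (intro continuous_intros)
      qed (use m low up in auto)
      also have "\<dots> \<le> 2945 / m" using ab m by (intro divide_right_mono) auto
      also have "\<dots> = 79515 / (\<bar>a\<bar> * h)" by (simp add: m_def)
      also have "\<dots> \<le> 79515 / (R * h)" using Rh ah by (intro divide_left_mono) auto
      also have "\<dots> \<le> 160000 / (1 + R * h)" using Rh by (simp add: field_simps)
      finally show ?thesis by (simp add: maj)
    qed
  qed
qed

lemma nn_integral_even_le:
  fixes f :: "real \<Rightarrow> ennreal"
  assumes [measurable]: "f \<in> borel_measurable borel"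
  shows "(\<integral>\<^sup>+x. f \<bar>x\<bar> \<partial>lborel) \<le> 2 * (\<integral>\<^sup>+x. f x * indicator {0..} x \<partial>lborel)"
proof -
  have "(\<integral>\<^sup>+x. f \<bar>x\<bar> \<partial>lborel) \<le> (\<integral>\<^sup>+x. f x * indicator {0..} x + f (0 + (-1) * x) * indicator {0..} (0 + (-1) * x) \<partial>lborel)"
    by (intro nn_integral_mono) (auto simp: abs_if split: split_indicator)
  also have "\<dots> = (\<integral>\<^sup>+x. f x * indicator {0..} x \<partial>lborel)
      + (\<integral>\<^sup>+x. f (0 + (-1) * x) * indicator {0..} (0 + (-1) * x) \<partial>lborel)"
    by (rule nn_integral_add) measurable
  also have "(\<integral>\<^sup>+x. f (0 + (-1) * x) * indicator {0..} (0 + (-1) * x) \<partial>lborel)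
      = (\<integral>\<^sup>+x. f x * indicator {0..} x \<partial>lborel)"
    by (subst (2) nn_integral_real_affine[where c = "-1" and t = 0]) auto
  finally show ?thesis by (simp add: mult_2)
qed

text \<open>The logarithm arises here: 1 / (1 + R |h|) is integrated up to the edge |h| = 1 of the
  support.\<close>

lemma nn_integral_osc_majorant:
  assumes R: "R > 0"
  shows "(\<integral>\<^sup>+h. ennreal (osc_majorant R h) \<partial>lborel) \<le> ennreal (320000 * ln (1 + R) / R)"
proof -
  let ?f = "\<lambda>h. ennreal (indicator {..1} h * (160000 / (1 + R * h)))"
  have "(\<integral>\<^sup>+h. ennreal (osc_majorant R h) \<partial>lborel) = (\<integral>\<^sup>+h. ?f \<bar>h\<bar> \<partial>lborel)"
    by (intro nn_integral_cong) (auto simp: osc_majorant_def split: split_indicator)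
  also have "\<dots> \<le> 2 * (\<integral>\<^sup>+h. ?f h * indicator {0..} h \<partial>lborel)"
    by (rule nn_integral_even_le) measurable
  also have "(\<integral>\<^sup>+h. ?f h * indicator {0..} h \<partial>lborel)
      = (\<integral>\<^sup>+h. ennreal (160000 / (1 + R * h)) * indicator {0..1} h \<partial>lborel)"
    by (intro nn_integral_cong) (auto split: split_indicator)
  also have "\<dots> = ennreal (160000 * ln (1 + R * 1) / R - 160000 * ln (1 + R * 0) / R)"
  proof (rule nn_integral_FTC_Icc)
    fix h :: real assume "h \<in> {0..1}"
    then have "1 + R * h > 0" using R by (auto intro: add_pos_nonneg)
    then show "((\<lambda>h. 160000 * ln (1 + R * h) / R) has_real_derivative 160000 / (1 + R * h))
        (at h)" "0 \<le> 160000 / (1 + R * h)"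
      using R by (auto intro!: derivative_eq_intros)
  qed auto
  finally show ?thesis
    using R by (simp add: ennreal_mult'[symmetric] flip: ennreal_numeral)
qed

section \<open>The one-dimensional oscillatory transform\<close>

definition osc_transform :: "real \<Rightarrow> real \<Rightarrow> complex" where
  "osc_transform l q = (\<integral>y. indicator {1..2} y *\<^sub>R cis (l * theta y + q * y) \<partial>lborel)"

lemma measurable_theta [measurable]: "theta \<in> borel_measurable borel"
  by (intro borel_measurable_continuous_onI continuous_intros)

lemma integrable_indicator_cis:
  assumes [measurable]: "f \<in> borel_measurable borel"
  shows "integrable lborel (\<lambda>y. indicator {a..b::real} y *\<^sub>R cis (f y))"
proof (rule Bochner_Integration.integrable_bound)
  show "integrable lborel (\<lambda>y. indicator {a..b} y :: real)" by (simp add: emeasure_lborel_Icc_eq)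
qed (auto split: split_indicator)

text \<open>The identity \<open>cis_theta\<close> multiplied by a wave and integrated: the factor
  exp(i theta) raises \<open>l\<close> by 1 and exp(i y) or exp(-i y) shifts \<open>q\<close> by
  1.\<close>

lemma osc_transform_relation:
  "2 * osc_transform (l + 1) q + osc_transform (l + 1) (q - 1)
    = 2 * osc_transform l q + osc_transform l (q + 1)"
proof -
  let ?g = "\<lambda>l q y. indicator {1..2} y *\<^sub>R cis (l * theta y + q * y)"
  have int: "integrable lborel (?g l q)" for l q :: real
    by (rule integrable_indicator_cis) measurable
  have "2 * osc_transform (l + 1) q + osc_transform (l + 1) (q - 1)
      = (\<integral>y. 2 * ?g (l + 1) q y + ?g (l + 1) (q - 1) y \<partial>lborel)"
    unfolding osc_transform_def
    by (simp only: Bochner_Integration.integral_add[OF integrable_mult_right[OF int] int] integral_mult_right_zero)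
  also have "\<dots> = (\<integral>y. 2 * ?g l q y + ?g l (q + 1) y \<partial>lborel)"
  proof (rule Bochner_Integration.integral_cong[OF refl])
    fix y
    have "cis ((l + 1) * theta y + (q - 1) * y) = cis (l * theta y + q * y) * cis (theta y) * cis (- y)"
      "cis ((l + 1) * theta y + q * y) = cis (l * theta y + q * y) * cis (theta y)"
      "cis (l * theta y + (q + 1) * y) = cis (l * theta y + q * y) * cis y"
      by (simp_all add: cis_mult algebra_simps)
    then have "2 * cis ((l + 1) * theta y + q * y) + cis ((l + 1) * theta y + (q - 1) * y)
        = cis (l * theta y + q * y) * (cis (theta y) * (2 + cis (- y)))"
      "2 * cis (l * theta y + q * y) + cis (l * theta y + (q + 1) * y)
        = cis (l * theta y + q * y) * (2 + cis y)"
      by (simp_all only:) (simp_all add: algebra_simps)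
    then have "2 * cis ((l + 1) * theta y + q * y) + cis ((l + 1) * theta y + (q - 1) * y)
        = 2 * cis (l * theta y + q * y) + cis (l * theta y + (q + 1) * y)"
      by (simp only: cis_theta)
    then show "2 * ?g (l + 1) q y + ?g (l + 1) (q - 1) y = 2 * ?g l q y + ?g l (q + 1) y"
      by (auto split: split_indicator)
  qed
  also have "\<dots> = 2 * osc_transform l q + osc_transform l (q + 1)"
    unfolding osc_transform_def
    by (simp only: Bochner_Integration.integral_add[OF integrable_mult_right[OF int] int] integral_mult_right_zero)
  finally show ?thesis .
qed

lemma norm_osc_transform_le_1: "cmod (osc_transform l q) \<le> 1"
  unfolding osc_transform_def using norm_integral_indicator_cis_le[of 1 2] by simp

lemma osc_transform_0: "osc_transform 0 0 = 1"
  by (simp add: osc_transform_def scaleR_conv_of_real)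

lemma continuous_on_osc_transform:
  "continuous_on UNIV (\<lambda>z. osc_transform (fst z) (snd z))"
  unfolding continuous_on_sequentially
proof (intro allI ballI impI)
  fix x :: "nat \<Rightarrow> real \<times> real" and a
  assume "(\<forall>n. x n \<in> UNIV) \<and> x \<longlonglongrightarrow> a"
  then have x: "x \<longlonglongrightarrow> a" by simp
  have "(\<lambda>n. \<integral>y. indicator {1..2} y *\<^sub>R cis (fst (x n) * theta y + snd (x n) * y) \<partial>lborel)
     \<longlonglongrightarrow> (\<integral>y. indicator {1..2} y *\<^sub>R cis (fst a * theta y + snd a * y) \<partial>lborel)"
  proof (rule integral_dominated_convergence[where w = "\<lambda>y. indicator {1..2} y"])
    show "AE y in lborel. (\<lambda>n. indicator {1..2} y *\<^sub>R cis (fst (x n) * theta y + snd (x n) * y))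
        \<longlonglongrightarrow> indicator {1..2} y *\<^sub>R cis (fst a * theta y + snd a * y)"
      unfolding cis_conv_exp by (intro AE_I2 tendsto_intros x)
  qed (auto split: split_indicator)
  then show "((\<lambda>z. osc_transform (fst z) (snd z)) \<circ> x) \<longlonglongrightarrow> osc_transform (fst a) (snd a)"
    by (simp add: osc_transform_def o_def)
qed

text \<open>The square of the modulus is the Fourier transform of the autocorrelation of the wave,
  evaluated at \<open>q\<close>; in absolute value \<open>q\<close> disappears. The correlation
  bound thus yields decay of order |l|^(-1/2), up to a logarithm, uniformly in
  \<open>q\<close>.\<close>

lemma norm_osc_transform_sq_le:
  "ennreal ((cmod (osc_transform l q))\<^sup>2) \<le> (\<integral>\<^sup>+h. ennreal (cmod (osc_pairing l l 0 (- h))) \<partial>lborel)"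
proof -
  let ?I = "\<integral>h. cis (- (q * h)) * osc_pairing l l 0 (- h) \<partial>lborel"
  let ?g = "\<lambda>y. indicator {1..2} y *\<^sub>R cis (l * theta y + q * y)"
  have [measurable]: "?g \<in> borel_measurable borel" by measurable
  have int: "integrable (lborel \<Otimes>\<^sub>M lborel) (\<lambda>(y, h). ?g y * cnj (?g (y + h)))"
  proof (rule Bochner_Integration.integrable_bound)
    show "integrable (lborel \<Otimes>\<^sub>M lborel) (\<lambda>z. indicator ({1..2::real} \<times> {-1..1::real}) z :: real)"
      by (rule integrable_real_indicator)
         (auto simp: lborel.emeasure_pair_measure_Times ennreal_mult_less_top)
    show "(\<lambda>(y, h). ?g y * cnj (?g (y + h))) \<in> borel_measurable (lborel \<Otimes>\<^sub>M lborel)"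
      unfolding case_prod_beta' by measurable
    show "AE z in lborel \<Otimes>\<^sub>M lborel. norm (case z of (y, h) \<Rightarrow> ?g y * cnj (?g (y + h)))
        \<le> norm (indicator ({1..2::real} \<times> {-1..1::real}) z :: real)"
      by (intro AE_I2) (auto simp: norm_mult indicator_def split: if_splits)
  qed
  have "complex_of_real ((cmod (osc_transform l q))\<^sup>2) = osc_transform l q * cnj (osc_transform l q)"
    by (rule complex_norm_square)
  also have "\<dots> = (\<integral>y. ?g y * cnj (osc_transform l q) \<partial>lborel)"
    unfolding osc_transform_def[of l q] by (rule integral_mult_left_zero[symmetric])
  also have "\<dots> = (\<integral>y. (\<integral>h. ?g y * cnj (?g (y + h)) \<partial>lborel) \<partial>lborel)"
  proof (rule Bochner_Integration.integral_cong[OF refl])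
    fix y
    have "cnj (osc_transform l q) = (\<integral>z. cnj (?g z) \<partial>lborel)"
      unfolding osc_transform_def by (rule Bochner_Integration.integral_cnj[symmetric])
    \<comment> \<open>Replacing the second variable by y + h makes the linear phases in
      \<open>y\<close> cancel, leaving the factor exp(-i q h).\<close>
    also have "\<dots> = (\<integral>h. cnj (?g (y + h)) \<partial>lborel)"
      by (subst lborel_integral_real_affine[where c = 1 and t = y]) auto
    finally show "?g y * cnj (osc_transform l q) = (\<integral>h. ?g y * cnj (?g (y + h)) \<partial>lborel)"
      by (simp only: integral_mult_right_zero)
  qed
  also have "\<dots> = (\<integral>h. (\<integral>y. ?g y * cnj (?g (y + h)) \<partial>lborel) \<partial>lborel)"
    by (rule lborel_pair.Fubini_integral[symmetric]) (rule int)
  also have "\<dots> = ?I"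
  proof (rule Bochner_Integration.integral_cong[OF refl])
    fix h
    have "?g y * cnj (?g (y + h)) = cis (- (q * h)) * ((indicator {1..2} (y - 0) * indicator {1..2} (y - (- h))) *\<^sub>R
        cis (l * theta (y - 0) - l * theta (y - (- h))))" for y
      by (auto simp: cis_cnj cis_mult algebra_simps split: split_indicator)
    then show "(\<integral>y. ?g y * cnj (?g (y + h)) \<partial>lborel) = cis (- (q * h)) * osc_pairing l l 0 (- h)"
      by (simp only: osc_pairing_def integral_mult_right_zero)
  qed
  finally have eq: "complex_of_real ((cmod (osc_transform l q))\<^sup>2)
      = ?I" .
  have "(cmod (osc_transform l q))\<^sup>2 = cmod ?I"
    unfolding eq[symmetric] by (simp add: norm_power)
  moreover have "ennreal (cmod ?I)
      \<le> (\<integral>\<^sup>+h. ennreal (cmod (osc_pairing l l 0 (- h))) \<partial>lborel)"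
  proof (cases "integrable lborel (\<lambda>h. cis (- (q * h)) * osc_pairing l l 0 (- h))")
    case True
    then show ?thesis using integral_norm_bound_ennreal[OF True] by (simp add: norm_mult)
  qed (simp add: not_integrable_integral_eq)
  ultimately show ?thesis by simp
qed

lemma osc_transform_bound1:
  assumes "l \<noteq> 0"
  shows "(cmod (osc_transform l q))\<^sup>2 \<le> 320000 * ln (1 + \<bar>l\<bar>) / \<bar>l\<bar>"
proof -
  have "ennreal ((cmod (osc_transform l q))\<^sup>2) \<le> (\<integral>\<^sup>+h. ennreal (cmod (osc_pairing l l 0 (- h))) \<partial>lborel)"
    by (rule norm_osc_transform_sq_le)
  also have "\<dots> \<le> (\<integral>\<^sup>+h. ennreal (osc_majorant \<bar>l\<bar> h) \<partial>lborel)"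
    using osc_pairing_bound[of "\<bar>l\<bar>" l l 0] by (intro nn_integral_mono ennreal_leI) (metis abs_ge_zero
      abs_zero diff_0 diff_self minus_minus order_refl zero_le_one)
  also have "\<dots> \<le> ennreal (320000 * ln (1 + \<bar>l\<bar>) / \<bar>l\<bar>)"
    using assms by (intro nn_integral_osc_majorant) simp
  finally show ?thesis by (subst (asm) ennreal_le_iff) auto
qed

text \<open>In this range there is no stationary point: l theta' is at most 2 |l| \<le> |q| / 2 in
  modulus, so the derivative of the phase is at least |q| / 2. The 6 comes from 12 |l| \<le> 3
  |q|.\<close>

lemma osc_transform_bound2:
  assumes q: "4 * \<bar>l\<bar> \<le> \<bar>q\<bar>" "q \<noteq> 0"
  shows "cmod (osc_transform l q) \<le> 16 / \<bar>q\<bar>"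
proof -
  have "cmod (osc_transform l q) \<le> (2 + 6 * (2 - 1)) / (\<bar>q\<bar> / 2)"
    unfolding osc_transform_def
  proof (rule oscillatory_integral_bound)
    show "((\<lambda>y. l * theta y + q * y) has_real_derivative l * theta1 y + q) (at y within {1..2})" for y
      by (auto intro!: derivative_eq_intros DERIV_theta[THEN DERIV_chain2])
    show "((\<lambda>y. l * theta1 y + q) has_real_derivative l * theta2 y) (at y within {1..2})" for y
      by (auto intro!: derivative_eq_intros DERIV_theta1[THEN DERIV_chain2])
    show "continuous_on {1..2} (\<lambda>y. l * theta2 y)"
      by (intro continuous_intros)
    show "\<bar>q\<bar> / 2 \<le> \<bar>l * theta1 y + q\<bar>" for y
    proof -
      have "\<bar>l * theta1 y\<bar> \<le> \<bar>l\<bar> * 2" unfolding abs_mult by (intro mult_left_mono abs_theta1_le) auto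
      then show ?thesis using q(1) by linarith
    qed
    show "\<bar>l * theta2 y\<bar> \<le> 6 * (\<bar>q\<bar> / 2)" for y
    proof -
      have "\<bar>l * theta2 y\<bar> \<le> \<bar>l\<bar> * 12" unfolding abs_mult by (intro mult_left_mono abs_theta2_le) auto
      then show ?thesis using q(1) by linarith
    qed
  qed (use q in auto)
  then show ?thesis by simp
qed

text \<open>Combines the regimes |q| \<lesssim> |l| and |q| \<gtrsim> |l| into a Poisson kernel in
  \<open>q\<close> of width 1 + |l|, which has a pointwise maximum of order 1/|l| and an integral
  independent of \<open>l\<close>. The numerical constant is a common majorant for both
  regimes.\<close>

lemma osc_transform_bound:
  "(cmod (osc_transform l q))\<^sup>2 \<le> 20000000 * ln (2 + \<bar>l\<bar>) * ((1 + \<bar>l\<bar>) / ((1 + \<bar>l\<bar>)\<^sup>2 + q\<^sup>2))"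
proof -
  define c where "c = 1 + \<bar>l\<bar>"
  define L where "L = ln (2 + \<bar>l\<bar>)"
  have c: "1 \<le> c" by (simp add: c_def)
  have "ln 2 \<le> L" unfolding L_def by simp
  then have L: "2 / 3 \<le> L" using ln2_ge_two_thirds by linarith
  show ?thesis
  proof (cases "\<bar>q\<bar> \<le> 4 * c")
    case True
    then have "q\<^sup>2 \<le> (4 * c)\<^sup>2" using abs_le_square_iff[of q "4 * c"] c by simp
    \<comment> \<open>17 = 1 + 4^2, with 4 the slope separating the two regimes.\<close>
    then have "c\<^sup>2 + q\<^sup>2 \<le> 17 * c\<^sup>2" by (simp add: power_mult_distrib)
    moreover have "0 < c\<^sup>2 + q\<^sup>2" using c by (intro add_pos_nonneg) auto
    ultimately have "c / (17 * c\<^sup>2) \<le> c / (c\<^sup>2 + q\<^sup>2)" using c by (intro divide_left_mono) auto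
    then have "20000000 * L * (c / (17 * c\<^sup>2)) \<le> 20000000 * L * (c / (c\<^sup>2 + q\<^sup>2))"
      using L by (intro mult_left_mono) auto
    moreover have "(cmod (osc_transform l q))\<^sup>2 \<le> 20000000 * L * (c / (17 * c\<^sup>2))"
    proof (cases "\<bar>l\<bar> < 1")
      case True
      have "(cmod (osc_transform l q))\<^sup>2 \<le> 1"
        using norm_osc_transform_le_1[of l q] by (simp add: power_le_one)
      also have "1 \<le> 20000000 * L / (17 * c)" using True L c by (simp add: c_def field_simps)
      finally show ?thesis using c by (simp add: power2_eq_square)
    next
      case False
      then have "(cmod (osc_transform l q))\<^sup>2 \<le> 320000 * ln (1 + \<bar>l\<bar>) / \<bar>l\<bar>"
        by (intro osc_transform_bound1) auto
      also have "\<dots> \<le> 320000 * L / (c / 2)"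
        using False L by (intro frac_le mult_left_mono) (auto simp: L_def c_def)
      also have "\<dots> \<le> 20000000 * L / (17 * c)" using L c by (simp add: field_simps)
      finally show ?thesis using c by (simp add: power2_eq_square)
    qed
    ultimately show ?thesis by (simp add: c_def L_def)
  next
    case False
    then have q: "4 * c < \<bar>q\<bar>" by simp
    have "cmod (osc_transform l q) \<le> 16 / \<bar>q\<bar>"
      using q by (intro osc_transform_bound2) (auto simp: c_def)
    then have "(cmod (osc_transform l q))\<^sup>2 \<le> (16 / \<bar>q\<bar>)\<^sup>2" by (intro power_mono) auto
    also have "\<dots> = 256 / q\<^sup>2" by (simp add: power_divide)
    also have "\<dots> \<le> 20000000 * L * (c / (2 * q\<^sup>2))"
    proof -
      have "512 \<le> 20000000 * (2 / 3) * (1::real)" by simp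
      also have "\<dots> \<le> 20000000 * L * c" using L c by (intro mult_mono) auto
      finally show ?thesis using q c by (simp add: field_simps)
    qed
    also have "\<dots> \<le> 20000000 * L * (c / (c\<^sup>2 + q\<^sup>2))"
    proof -
      have "c\<^sup>2 \<le> q\<^sup>2" using q c abs_le_square_iff[of c q] by simp
      moreover have "0 < c\<^sup>2 + q\<^sup>2" using c by (intro add_pos_nonneg) auto
      ultimately show ?thesis using c L q by (intro mult_left_mono divide_left_mono mult_pos_pos) auto
    qed
    finally show ?thesis by (simp add: c_def L_def)
  qed
qed

text \<open>The Poisson kernel integrates to pi. Compared with the Plancherel value 2 pi a logarithm
  is lost, which \<epsilon> absorbs later.\<close>

lemma nn_integral_osc_transform:
  "(\<integral>\<^sup>+q. ennreal ((cmod (osc_transform l q))\<^sup>2) \<partial>lborel) \<le> ennreal (20000000 * pi * ln (2 + \<bar>l\<bar>))"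
proof -
  define c where "c = 1 + \<bar>l\<bar>"
  define L where "L = 20000000 * ln (2 + \<bar>l\<bar>)"
  have c: "1 \<le> c" by (simp add: c_def)
  have L: "0 \<le> L" by (simp add: L_def)
  have cq: "0 < c\<^sup>2 + q\<^sup>2" for q :: real using c by (intro add_pos_nonneg) auto
  let ?f = "\<lambda>q. ennreal (L * (c / (c\<^sup>2 + q\<^sup>2)))"
  have "(\<integral>\<^sup>+q. ennreal ((cmod (osc_transform l q))\<^sup>2) \<partial>lborel) \<le> (\<integral>\<^sup>+q. ?f \<bar>q\<bar> \<partial>lborel)"
    using osc_transform_bound[of l] by (intro nn_integral_mono ennreal_leI) (simp add: c_def L_def)
  also have "\<dots> \<le> 2 * (\<integral>\<^sup>+q. ?f q * indicator {0..} q \<partial>lborel)"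
    by (rule nn_integral_even_le) measurable
  also have "(\<integral>\<^sup>+q. ?f q * indicator {0..} q \<partial>lborel) = ennreal (L * (pi / 2) - L * arctan (0 / c))"
  proof (rule nn_integral_FTC_atLeast)
    show "((\<lambda>q. L * arctan (q / c)) has_real_derivative L * (c / (c\<^sup>2 + q\<^sup>2))) (at q)" for q
    proof -
      have "((\<lambda>q. L * arctan (q / c)) has_real_derivative L * (1 / c * inverse (1 + (q / c)\<^sup>2))) (at q)"
        using c by (auto intro!: derivative_eq_intros)
      moreover have "1 / c * inverse (1 + (q / c)\<^sup>2) = c / (c\<^sup>2 + q\<^sup>2)"
      proof -
        have "1 + (q / c)\<^sup>2 = (c\<^sup>2 + q\<^sup>2) / c\<^sup>2" using c by (simp add: power_divide field_simps)
        then show ?thesis using c cq[of q] by (simp add: power2_eq_square field_simps)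
      qed
      ultimately show ?thesis by (simp only:)
    qed
    show "0 \<le> L * (c / (c\<^sup>2 + q\<^sup>2))" for q using L c cq[of q] by simp
    have "filterlim (\<lambda>q. 1 / c * q) at_top at_top"
      using c by (intro filterlim_tendsto_pos_mult_at_top[OF tendsto_const _ filterlim_ident]) auto
    then have "filterlim (\<lambda>q. q / c) at_top at_top" by simp
    then show "((\<lambda>q. L * arctan (q / c)) \<longlongrightarrow> L * (pi / 2)) at_top"
      by (intro tendsto_intros filterlim_compose[OF tendsto_arctan_at_top])
  qed measurable
  finally show ?thesis
    using L by (simp add: ennreal_mult'[symmetric] L_def ac_simps flip: ennreal_numeral)
qed

section \<open>Integrals of products of one-dimensional functions\<close>

lemma nn_integral_real_shift:
  fixes f :: "real \<Rightarrow> ennreal"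
  assumes [measurable]: "f \<in> borel_measurable borel"
  shows "(\<integral>\<^sup>+x. f (x - c) \<partial>lborel) = (\<integral>\<^sup>+x. f x \<partial>lborel)"
    and "(\<integral>\<^sup>+x. f (c - x) \<partial>lborel) = (\<integral>\<^sup>+x. f x \<partial>lborel)"
  by (subst (2) nn_integral_real_affine[where c = 1 and t = "-c"], simp_all)
     (subst (2) nn_integral_real_affine[where c = "-1" and t = c], simp_all)

lemma nn_integral_prod_shift:
  fixes f :: "'a::euclidean_space \<Rightarrow> real \<Rightarrow> ennreal" and c :: 'a
  assumes [measurable]: "\<And>b. b \<in> Basis \<Longrightarrow> f b \<in> borel_measurable borel"
  shows "(\<integral>\<^sup>+x. (\<Prod>b\<in>Basis. f b (x \<bullet> b - c \<bullet> b)) \<partial>lborel) = (\<Prod>b\<in>Basis. \<integral>\<^sup>+y. f b y \<partial>lborel)"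
    and "(\<integral>\<^sup>+x. (\<Prod>b\<in>Basis. f b (c \<bullet> b - x \<bullet> b)) \<partial>lborel) = (\<Prod>b\<in>Basis. \<integral>\<^sup>+y. f b y \<partial>lborel)"
proof -
  have "(\<integral>\<^sup>+x. (\<Prod>b\<in>Basis. f b (x \<bullet> b - c \<bullet> b)) \<partial>lborel) = (\<Prod>b\<in>Basis. \<integral>\<^sup>+y. f b (y - c \<bullet> b) \<partial>lborel)"
    by (rule nn_integral_lborel_prod[of "\<lambda>b y. f b (y - c \<bullet> b)"]) auto
  also have "\<dots> = (\<Prod>b\<in>Basis. \<integral>\<^sup>+y. f b y \<partial>lborel)"
    by (intro prod.cong refl nn_integral_real_shift) auto
  finally show "(\<integral>\<^sup>+x. (\<Prod>b\<in>Basis. f b (x \<bullet> b - c \<bullet> b)) \<partial>lborel) = (\<Prod>b\<in>Basis. \<integral>\<^sup>+y. f b y \<partial>lborel)" .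
  have "(\<integral>\<^sup>+x. (\<Prod>b\<in>Basis. f b (c \<bullet> b - x \<bullet> b)) \<partial>lborel) = (\<Prod>b\<in>Basis. \<integral>\<^sup>+y. f b (c \<bullet> b - y) \<partial>lborel)"
    by (rule nn_integral_lborel_prod[of "\<lambda>b y. f b (c \<bullet> b - y)"]) auto
  also have "\<dots> = (\<Prod>b\<in>Basis. \<integral>\<^sup>+y. f b y \<partial>lborel)"
    by (intro prod.cong refl nn_integral_real_shift) auto
  finally show "(\<integral>\<^sup>+x. (\<Prod>b\<in>Basis. f b (c \<bullet> b - x \<bullet> b)) \<partial>lborel) = (\<Prod>b\<in>Basis. \<integral>\<^sup>+y. f b y \<partial>lborel)" .
qed

lemma integral_lborel_prod:
  fixes f :: "'a::euclidean_space \<Rightarrow> real \<Rightarrow> complex"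
  assumes int: "\<And>b. b \<in> Basis \<Longrightarrow> integrable lborel (f b)"
  shows "(\<integral>x. (\<Prod>b\<in>Basis. f b (x \<bullet> b)) \<partial>lborel) = (\<Prod>b\<in>Basis. \<integral>y. f b y \<partial>lborel)"
proof -
  interpret product_sigma_finite "\<lambda>_::'a. lborel :: real measure" by standard
  have [measurable]: "f b \<in> borel_measurable borel" if "b \<in> Basis" for b
    using borel_measurable_integrable[OF int[OF that]] by simp
  have "(\<integral>x. (\<Prod>b\<in>Basis. f b (x \<bullet> b)) \<partial>lborel)
      = (\<integral>x. (\<Prod>b\<in>Basis. f b ((\<Sum>i\<in>Basis. x i *\<^sub>R i) \<bullet> b)) \<partial>(\<Pi>\<^sub>M b\<in>Basis. lborel))"
    by (subst lborel_eq, subst integral_distr) (auto intro!: borel_measurable_prod)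
  also have "\<dots> = (\<integral>x. (\<Prod>b\<in>Basis. f b (x b)) \<partial>(\<Pi>\<^sub>M b\<in>Basis. lborel))"
    by (intro Bochner_Integration.integral_cong prod.cong refl) simp
  also have "\<dots> = (\<Prod>b\<in>Basis. \<integral>y. f b y \<partial>lborel)"
    using int by (intro product_integral_prod) auto
  finally show ?thesis .
qed

text \<open>The factors are coupled through the coordinate along \<open>b0\<close> alone; once that
  coordinate is fixed, the others separate into equal integrals.\<close>

lemma nn_integral_lborel_prod_fibre:
  fixes f :: "real \<Rightarrow> real \<Rightarrow> ennreal" and g :: "real \<Rightarrow> ennreal" and b0 :: "'a::euclidean_space"
  assumes b0: "b0 \<in> Basis" and [measurable]: "case_prod f \<in> borel_measurable (borel \<Otimes>\<^sub>M borel)"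
    "g \<in> borel_measurable borel"
  shows "(\<integral>\<^sup>+x. g (x \<bullet> b0) * (\<Prod>b\<in>Basis - {b0}. f (x \<bullet> b0) (x \<bullet> b)) \<partial>lborel)
    = (\<integral>\<^sup>+l. g l * (\<integral>\<^sup>+q. f l q \<partial>lborel) ^ (DIM('a) - 1) \<partial>lborel)"
proof -
  interpret product_sigma_finite "\<lambda>_::'a. lborel :: real measure" by standard
  let ?B = "Basis - {b0} :: 'a set"
  have ins: "insert b0 ?B = Basis" using b0 by auto
  let ?F = "\<lambda>x :: 'a \<Rightarrow> real. g (x b0) * (\<Prod>b\<in>?B. f (x b0) (x b))"
  have comp [measurable]: "(\<lambda>x. x b) \<in> borel_measurable (\<Pi>\<^sub>M b\<in>I. (lborel :: real measure))" if "b \<in> I" for b :: 'a and I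
    using measurable_component_singleton[OF that, of "\<lambda>_. lborel :: real measure"] by simp
  have meas: "(\<lambda>x. g (X x) * (\<Prod>b\<in>?B. f (X x) (Y b x))) \<in> borel_measurable M"
    if [measurable]: "X \<in> borel_measurable M" and Y: "\<And>b. b \<in> ?B \<Longrightarrow> Y b \<in> borel_measurable M"
    for X :: "'c \<Rightarrow> real" and Y :: "'a \<Rightarrow> 'c \<Rightarrow> real" and M :: "'c measure"
  proof -
    have "(\<lambda>x. f (X x) (Y b x)) \<in> borel_measurable M" if "b \<in> ?B" for b
      using Y[OF that] by measurable
    then show ?thesis
      by (intro borel_measurable_times_ennreal borel_measurable_prod_ennreal) auto
  qed
  have m: "?F \<in> borel_measurable (\<Pi>\<^sub>M b\<in>Basis. lborel)"
    using b0 by (intro meas comp) auto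
  have "(\<integral>\<^sup>+x. g (x \<bullet> b0) * (\<Prod>b\<in>?B. f (x \<bullet> b0) (x \<bullet> b)) \<partial>lborel)
      = (\<integral>\<^sup>+x. g ((\<Sum>i\<in>Basis. x i *\<^sub>R i) \<bullet> b0)
          * (\<Prod>b\<in>?B. f ((\<Sum>i\<in>Basis. x i *\<^sub>R i) \<bullet> b0) ((\<Sum>i\<in>Basis. x i *\<^sub>R i) \<bullet> b)) \<partial>(\<Pi>\<^sub>M b\<in>Basis. lborel))"
    by (subst lborel_eq, subst nn_integral_distr) (auto intro!: meas)
  also have "\<dots> = (\<integral>\<^sup>+x. ?F x \<partial>(\<Pi>\<^sub>M b\<in>Basis. lborel))"
    using b0 by (intro nn_integral_cong) simp
  also have "\<dots> = (\<integral>\<^sup>+l. (\<integral>\<^sup>+x. ?F (x(b0 := l)) \<partial>(\<Pi>\<^sub>M b\<in>?B. lborel)) \<partial>lborel)"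
    using product_nn_integral_insert_rev[of ?B b0 ?F] m unfolding ins by simp
  also have "\<dots> = (\<integral>\<^sup>+l. g l * (\<integral>\<^sup>+q. f l q \<partial>lborel) ^ (DIM('a) - 1) \<partial>lborel)"
  proof (rule nn_integral_cong)
    fix l
    have "(\<integral>\<^sup>+x. ?F (x(b0 := l)) \<partial>(\<Pi>\<^sub>M b\<in>?B. lborel))
        = (\<integral>\<^sup>+x. g l * (\<Prod>b\<in>?B. f l (x b)) \<partial>(\<Pi>\<^sub>M b\<in>?B. lborel))"
      by (intro nn_integral_cong arg_cong2[of _ _ _ _ "(*)"] prod.cong) auto
    also have "\<dots> = g l * (\<integral>\<^sup>+x. (\<Prod>b\<in>?B. f l (x b)) \<partial>(\<Pi>\<^sub>M b\<in>?B. lborel))"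
      by (intro nn_integral_cmult borel_measurable_prod_ennreal) measurable
    also have "(\<integral>\<^sup>+x. (\<Prod>b\<in>?B. f l (x b)) \<partial>(\<Pi>\<^sub>M b\<in>?B. lborel)) = (\<Prod>b\<in>?B. \<integral>\<^sup>+q. f l q \<partial>lborel)"
      by (rule product_nn_integral_prod) auto
    also have "\<dots> = (\<integral>\<^sup>+q. f l q \<partial>lborel) ^ (DIM('a) - 1)"
      using b0 by (simp add: card_Diff_singleton)
    finally show "(\<integral>\<^sup>+x. ?F (x(b0 := l)) \<partial>(\<Pi>\<^sub>M b\<in>?B. lborel))
        = g l * (\<integral>\<^sup>+q. f l q \<partial>lborel) ^ (DIM('a) - 1)" .
  qed
  finally show ?thesis .
qed

lemma AE_inner_neq:
  fixes b :: "'a::euclidean_space"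
  assumes "b \<in> Basis"
  shows "AE x in lborel. x \<bullet> b \<noteq> c"
proof (rule AE_I')
  have "negligible {x. x \<bullet> b = c}" using assms by (rule negligible_standard_hyperplane)
  moreover have "{x. x \<bullet> b = c} \<in> sets lborel" by measurable
  ultimately show "{x. x \<bullet> b = c} \<in> null_sets lborel"
    by (simp add: negligible_iff_null_sets null_sets_completion_iff)
qed auto

text \<open>All logarithmic losses are traded for R^\<epsilon> by this inequality.\<close>

lemma ln_le_powr:
  fixes x \<epsilon> :: real
  assumes "0 < \<epsilon>" "1 \<le> x"
  shows "ln (2 + x) \<le> (2 + 1 / \<epsilon>) * x powr \<epsilon>"
proof -
  have "ln (2 + x) \<le> ln (3 * x)" using assms by simp
  also have "\<dots> = ln 3 + ln x" using assms by (simp add: ln_mult)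
  also have "\<dots> \<le> 2 * x powr \<epsilon> + x powr \<epsilon> / \<epsilon>"
  proof (rule add_mono)
    have "ln 3 \<le> (2::real)" using ln_le_minus_one[of "3::real"] by simp
    also have "2 \<le> 2 * x powr \<epsilon>" using assms by (simp add: ge_one_powr_ge_zero)
    finally show "ln 3 \<le> 2 * x powr \<epsilon>" .
    show "ln x \<le> x powr \<epsilon> / \<epsilon>" using assms ln_powr_bound by blast
  qed
  finally show ?thesis by (simp add: algebra_simps)
qed

section \<open>The oscillatory kernel\<close>

text \<open>The part of the kernel depending on \<open>t\<close> alone. It is the amplitude of the
  row at \<open>t\<close>, and is the empty product 1 in dimension one.\<close>

definition osc_symbol :: "'a::euclidean_space \<Rightarrow> 'a \<Rightarrow> complex" where
  "osc_symbol b0 t = (\<Prod>b\<in>Basis - {b0}. osc_transform (t \<bullet> b0) (t \<bullet> b))"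

definition osc_wave :: "real \<Rightarrow> real \<Rightarrow> complex" where
  "osc_wave l y = indicator {1..2} y *\<^sub>R cis (l * theta y)"

definition osc_kernel :: "'a::euclidean_space \<Rightarrow> 'a \<Rightarrow> 'a \<Rightarrow> complex" where
  "osc_kernel b0 t s = osc_symbol b0 t * (\<Prod>b\<in>Basis. osc_wave (t \<bullet> b0) ((s - t) \<bullet> b))"

lemma measurable_osc_transform [measurable (raw)]:
  assumes [measurable]: "f \<in> borel_measurable M" "g \<in> borel_measurable M"
  shows "(\<lambda>x. osc_transform (f x) (g x)) \<in> borel_measurable M"
proof -
  have "(\<lambda>z. osc_transform (fst z) (snd z)) \<in> borel_measurable borel"
    by (rule borel_measurable_continuous_onI[OF continuous_on_osc_transform])
  then have "(\<lambda>x. (\<lambda>z. osc_transform (fst z) (snd z)) (f x, g x)) \<in> borel_measurable M"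
    by (rule measurable_compose[rotated]) measurable
  then show ?thesis by simp
qed

lemma measurable_osc_wave [measurable (raw)]:
  assumes [measurable]: "f \<in> borel_measurable M" "g \<in> borel_measurable M"
  shows "(\<lambda>x. osc_wave (f x) (g x)) \<in> borel_measurable M"
  unfolding osc_wave_def by measurable

lemma measurable_osc_symbol [measurable]: "osc_symbol b0 \<in> borel_measurable borel"
  unfolding osc_symbol_def by (intro borel_measurable_prod) measurable

lemma measurable_osc_kernel [measurable]:
  "case_prod (osc_kernel b0) \<in> borel_measurable (borel \<Otimes>\<^sub>M borel)"
  unfolding osc_kernel_def case_prod_beta'
  by (intro borel_measurable_times borel_measurable_prod) measurable

lemma cmod_osc_wave: "cmod (osc_wave l y) = indicator {1..2} y"
  by (simp add: osc_wave_def)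

lemma cmod_osc_symbol_le_1: "cmod (osc_symbol b0 t) \<le> 1"
  unfolding osc_symbol_def prod_norm[symmetric]
  by (intro prod_le_1) (auto simp: norm_osc_transform_le_1)

lemma cmod_osc_kernel:
  "cmod (osc_kernel b0 t s) = cmod (osc_symbol b0 t) * (\<Prod>b\<in>Basis. indicator {1..2} (s \<bullet> b - t \<bullet> b))"
  by (simp add: osc_kernel_def norm_mult prod_norm[symmetric] cmod_osc_wave inner_diff_left)

lemma nn_integral_window:
  fixes c :: "'a::euclidean_space"
  shows "(\<integral>\<^sup>+s. ennreal (\<Prod>b\<in>Basis. indicator {1..2} (s \<bullet> b - c \<bullet> b)) \<partial>lborel) = 1"
    and "(\<integral>\<^sup>+s. ennreal (\<Prod>b\<in>Basis. indicator {1..2} (c \<bullet> b - s \<bullet> b)) \<partial>lborel) = 1"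
proof -
  have "(\<integral>\<^sup>+y. ennreal (indicator {1..2::real} y) \<partial>lborel) = 1"
    by (simp add: ennreal_indicator)
  then show "(\<integral>\<^sup>+s. ennreal (\<Prod>b\<in>Basis. indicator {1..2} (s \<bullet> b - c \<bullet> b)) \<partial>lborel) = 1"
    "(\<integral>\<^sup>+s. ennreal (\<Prod>b\<in>Basis. indicator {1..2} (c \<bullet> b - s \<bullet> b)) \<partial>lborel) = 1"
    using nn_integral_prod_shift[of "\<lambda>_ y. ennreal (indicator {1..2} y)" c]
    by (simp_all add: prod_ennreal)
qed

lemma cmod_osc_kernel_le:
  "cmod (osc_kernel b0 t s) \<le> (\<Prod>b\<in>Basis. indicator {1..2} (s \<bullet> b - t \<bullet> b))"
  unfolding cmod_osc_kernel
  by (intro mult_left_le_one_le cmod_osc_symbol_le_1 prod_nonneg) auto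

lemma schur_osc_kernel: "schur_kernel 1 (osc_kernel (b0 :: 'a::euclidean_space))"
  unfolding schur_kernel_def
proof (intro conjI allI)
  fix t s :: 'a
  have "(\<integral>\<^sup>+s. ennreal (cmod (osc_kernel b0 t s)) \<partial>lborel)
      \<le> (\<integral>\<^sup>+s. ennreal (\<Prod>b\<in>Basis. indicator {1..2} (s \<bullet> b - t \<bullet> b)) \<partial>lborel)"
    by (intro nn_integral_mono ennreal_leI cmod_osc_kernel_le)
  then show "(\<integral>\<^sup>+s. ennreal (cmod (osc_kernel b0 t s)) \<partial>lborel) \<le> ennreal 1"
    by (simp add: nn_integral_window)
  have "(\<integral>\<^sup>+t. ennreal (cmod (osc_kernel b0 t s)) \<partial>lborel)
      \<le> (\<integral>\<^sup>+t. ennreal (\<Prod>b\<in>Basis. indicator {1..2} (s \<bullet> b - t \<bullet> b)) \<partial>lborel)"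
    by (intro nn_integral_mono ennreal_leI cmod_osc_kernel_le)
  then show "(\<integral>\<^sup>+t. ennreal (cmod (osc_kernel b0 t s)) \<partial>lborel) \<le> ennreal 1"
    by (simp add: nn_integral_window)
qed (auto intro: measurable_osc_kernel)

text \<open>The waves have modulus 1 on a cube of volume 1, so only the amplitude survives.\<close>

lemma nn_integral_osc_kernel_sq:
  "(\<integral>\<^sup>+s. ennreal ((cmod (osc_kernel b0 t s))\<^sup>2) \<partial>lborel) = ennreal ((cmod (osc_symbol b0 t))\<^sup>2)"
proof -
  have "(\<integral>\<^sup>+s. ennreal ((cmod (osc_kernel b0 t s))\<^sup>2) \<partial>lborel)
      = (\<integral>\<^sup>+s. ennreal ((cmod (osc_symbol b0 t))\<^sup>2)
          * ennreal (\<Prod>b\<in>Basis. indicator {1..2} (s \<bullet> b - t \<bullet> b)) \<partial>lborel)"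
  proof (rule nn_integral_cong)
    fix s
    have "(\<Prod>b\<in>Basis. indicator {1..2} (s \<bullet> b - t \<bullet> b))\<^sup>2
        = (\<Prod>b\<in>Basis. indicator {1..2} (s \<bullet> b - t \<bullet> b) :: real)"
      unfolding prod_power_distrib
      by (intro prod.cong refl) (auto split: split_indicator)
    then show "ennreal ((cmod (osc_kernel b0 t s))\<^sup>2) = ennreal ((cmod (osc_symbol b0 t))\<^sup>2)
          * ennreal (\<Prod>b\<in>Basis. indicator {1..2} (s \<bullet> b - t \<bullet> b))"
      by (simp add: cmod_osc_kernel power_mult_distrib ennreal_mult prod_nonneg)
  qed
  also have "\<dots> = ennreal ((cmod (osc_symbol b0 t))\<^sup>2)
      * (\<integral>\<^sup>+s. ennreal (\<Prod>b\<in>Basis. indicator {1..2} (s \<bullet> b - t \<bullet> b)) \<partial>lborel)"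
    by (rule nn_integral_cmult) (auto intro!: measurable_compose[OF _ measurable_ennreal] borel_measurable_prod)
  finally show ?thesis by (simp add: nn_integral_window)
qed

lemma square_integrable_osc_kernel: "square_integrable (osc_kernel b0 t)"
  by (rule square_integrableI) (auto simp: nn_integral_osc_kernel_sq)

lemma norm_kernel_row_osc: "norm (kernel_row (osc_kernel b0) t) = cmod (osc_symbol b0 t)"
proof -
  have "ennreal ((norm (kernel_row (osc_kernel b0) t))\<^sup>2) = ennreal ((cmod (osc_symbol b0 t))\<^sup>2)"
    by (simp add: norm_kernel_row[OF square_integrable_osc_kernel] nn_integral_osc_kernel_sq)
  then show ?thesis by simp
qed

lemma continuous_on_osc_symbol: "continuous_on UNIV (osc_symbol b0)"
proof -
  have "continuous_on UNIV (\<lambda>t. osc_transform (t \<bullet> b0) (t \<bullet> b))" for b :: 'a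
  proof -
    have "continuous_on UNIV (\<lambda>t. (t \<bullet> b0, t \<bullet> b))" by (intro continuous_intros)
    from continuous_on_compose2[OF continuous_on_osc_transform this] show ?thesis by simp
  qed
  then show ?thesis unfolding osc_symbol_def[abs_def] by (intro continuous_on_prod) auto
qed

text \<open>The kernel itself jumps at the faces of the cube t + [1,2]^n, but for fixed
  \<open>t\<close> these faces form a null set. Off them the kernel converges pointwise, and bounded
  rows inside a common box allow dominated convergence.\<close>

lemma continuous_on_kernel_row_osc:
  "continuous_on UNIV (kernel_row (osc_kernel (b0 :: 'a::euclidean_space)))"
  unfolding continuous_on_sequentially
proof (intro allI ballI impI)
  fix u :: "nat \<Rightarrow> 'a" and t :: 'a
  assume "(\<forall>n. u n \<in> UNIV) \<and> u \<longlonglongrightarrow> t"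
  then have u: "u \<longlonglongrightarrow> t" by simp
  let ?k = "osc_kernel b0"
  obtain M where M: "\<And>n. norm (u n) \<le> M"
    using Bseq_def convergent_imp_Bseq[of u] u by (auto simp: convergent_def Bseq_def)
  have tM: "norm t \<le> M" by (rule LIMSEQ_le_const2[OF tendsto_norm[OF u]]) (use M in auto)
  \<comment> \<open>A box containing the windows of all centres of norm at most \<open>M\<close>,
    hence those of the whole sequence and of its limit.\<close>
  define W :: "'a set" where "W = cbox (\<Sum>b\<in>Basis. (1 - M) *\<^sub>R b) (\<Sum>b\<in>Basis. (2 + M) *\<^sub>R b)"
  have W: "cmod (?k v s) \<le> indicator W s" if "norm v \<le> M" for v s
  proof (cases "s \<in> W")
    case True
    have "(\<Prod>b\<in>Basis. indicator {1..2} (s \<bullet> b - v \<bullet> b) :: real) \<le> 1"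
      by (intro prod_le_1) auto
    then show ?thesis using cmod_osc_kernel_le[of b0 v s] True by simp
  next
    case False
    then obtain b where b: "b \<in> Basis" "\<not> (1 - M \<le> s \<bullet> b \<and> s \<bullet> b \<le> 2 + M)"
      by (auto simp: W_def mem_box)
    have "\<bar>v \<bullet> b\<bar> \<le> M" using Basis_le_norm[OF b(1), of v] that by simp
    then have "s \<bullet> b - v \<bullet> b \<notin> {1..2}" using b(2) by auto
    then have "indicator {1..2} (s \<bullet> b - v \<bullet> b) = (0 :: real)" by (rule indicator_simps(2))
    with b(1) have "(\<Prod>b\<in>Basis. indicator {1..2} (s \<bullet> b - v \<bullet> b) :: real) = 0"
      by (intro prod_zero bexI[of _ b]) auto
    with cmod_osc_kernel_le[of b0 v s] have "cmod (?k v s) \<le> 0" by (simp only:)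
    then show ?thesis by simp
  qed
  have sq: "norm (kernel_row ?k (u n) - kernel_row ?k t) ^ 2 = (\<integral>s. (cmod (?k (u n) s - ?k t s))\<^sup>2 \<partial>lborel)" for n
  proof -
    have d: "square_integrable (\<lambda>s. cnj (?k (u n) s) - cnj (?k t s))"
      by (intro square_integrable_diff square_integrable_cnj square_integrable_osc_kernel)
    have "ennreal ((norm (kernel_row ?k (u n) - kernel_row ?k t))\<^sup>2)
        = (\<integral>\<^sup>+s. ennreal ((cmod (cnj (?k (u n) s) - cnj (?k t s)))\<^sup>2) \<partial>lborel)"
      unfolding kernel_row_def using norm_abs_L2[OF d]
      by (simp add: abs_L2_diff square_integrable_cnj square_integrable_osc_kernel)
    also have "\<dots> = ennreal (\<integral>s. (cmod (cnj (?k (u n) s) - cnj (?k t s)))\<^sup>2 \<partial>lborel)"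
      using d by (intro nn_integral_eq_integral) (auto simp: square_integrable_def)
    finally have "(norm (kernel_row ?k (u n) - kernel_row ?k t))\<^sup>2
        = (\<integral>s. (cmod (cnj (?k (u n) s) - cnj (?k t s)))\<^sup>2 \<partial>lborel)" by simp
    then show ?thesis by (simp flip: complex_cnj_diff)
  qed
  have "(\<lambda>n. \<integral>s. (cmod (?k (u n) s - ?k t s))\<^sup>2 \<partial>lborel) \<longlonglongrightarrow> (\<integral>s. 0 \<partial>(lborel :: 'a measure))"
  proof (rule integral_dominated_convergence[where w = "\<lambda>s. 4 * indicator W s"])
    show "integrable lborel (\<lambda>s. 4 * indicator W s :: real)"
      by (intro integrable_mult_right integrable_real_indicator) (auto simp: W_def emeasure_lborel_cbox_eq)
    show "AE s in lborel. norm ((cmod (?k (u n) s - ?k t s))\<^sup>2) \<le> 4 * indicator W s" for n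
    proof (rule AE_I2)
      fix s
      have "(cmod (?k (u n) s - ?k t s))\<^sup>2 \<le> 2 * (cmod (?k (u n) s))\<^sup>2 + 2 * (cmod (?k t s))\<^sup>2"
        by (rule power2_cmod_diff_le)
      also have "\<dots> \<le> 2 * (indicator W s)\<^sup>2 + 2 * (indicator W s)\<^sup>2"
        by (intro add_mono mult_left_mono power_mono W M tM) auto
      finally show "norm ((cmod (?k (u n) s - ?k t s))\<^sup>2) \<le> 4 * indicator W s"
        by (auto split: split_indicator_asm)
    qed
    have ae: "AE s in lborel. \<forall>b\<in>Basis. s \<bullet> b \<noteq> 1 + t \<bullet> b \<and> s \<bullet> b \<noteq> 2 + t \<bullet> b"
      by (intro AE_finite_allI AE_conjI AE_inner_neq) auto
    show "AE s in lborel. (\<lambda>n. (cmod (?k (u n) s - ?k t s))\<^sup>2) \<longlonglongrightarrow> 0"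
      using ae
    proof eventually_elim
      case (elim s)
      have "(\<lambda>n. osc_wave (u n \<bullet> b0) ((s - u n) \<bullet> b)) \<longlonglongrightarrow> osc_wave (t \<bullet> b0) ((s - t) \<bullet> b)"
        if b: "b \<in> Basis" for b
      proof -
        have lim: "(\<lambda>n. (s - u n) \<bullet> b) \<longlonglongrightarrow> (s - t) \<bullet> b" by (intro tendsto_intros u)
        have th: "(\<lambda>n. theta ((s - u n) \<bullet> b)) \<longlonglongrightarrow> theta ((s - t) \<bullet> b)"
          by (rule isCont_tendsto_compose[OF DERIV_isCont[OF DERIV_theta] lim])
        have c: "(\<lambda>n. cis ((u n \<bullet> b0) * theta ((s - u n) \<bullet> b))) \<longlonglongrightarrow> cis ((t \<bullet> b0) * theta ((s - t) \<bullet> b))"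
          unfolding cis_conv_exp by (intro tendsto_intros u th)
        have ne: "(s - t) \<bullet> b \<noteq> 1" "(s - t) \<bullet> b \<noteq> 2" using elim b by (auto simp: inner_diff_left)
        have "\<forall>\<^sub>F n in sequentially. indicator {1..2} ((s - u n) \<bullet> b) = (indicator {1..2} ((s - t) \<bullet> b) :: real)"
        proof -
          consider "(s - t) \<bullet> b < 1" | "1 < (s - t) \<bullet> b" "(s - t) \<bullet> b < 2" | "2 < (s - t) \<bullet> b"
            using ne by linarith
          then show ?thesis
          proof cases
            case 1
            then have "\<forall>\<^sub>F n in sequentially. (s - u n) \<bullet> b < 1" by (rule order_tendstoD(2)[OF lim])
            then show ?thesis by eventually_elim (use 1 in auto)
          next
            case 2
            have "\<forall>\<^sub>F n in sequentially. (s - u n) \<bullet> b > 1" "\<forall>\<^sub>F n in sequentially. (s - u n) \<bullet> b < 2"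
              using 2 lim by (auto intro: order_tendstoD)
            then show ?thesis by eventually_elim (use 2 in auto)
          next
            case 3
            then have "\<forall>\<^sub>F n in sequentially. (s - u n) \<bullet> b > 2" by (rule order_tendstoD(1)[OF lim])
            then show ?thesis by eventually_elim (use 3 in auto)
          qed
        qed
        then have "(\<lambda>n. indicator {1..2} ((s - u n) \<bullet> b) :: real) \<longlonglongrightarrow> indicator {1..2} ((s - t) \<bullet> b)"
          by (rule tendsto_eventually)
        then show ?thesis unfolding osc_wave_def using c by (rule tendsto_scaleR)
      qed
      then have p: "(\<lambda>n. \<Prod>b\<in>Basis. osc_wave (u n \<bullet> b0) ((s - u n) \<bullet> b))
          \<longlonglongrightarrow> (\<Prod>b\<in>Basis. osc_wave (t \<bullet> b0) ((s - t) \<bullet> b))"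
        by (rule tendsto_prod)
      have m: "(\<lambda>n. osc_symbol b0 (u n)) \<longlonglongrightarrow> osc_symbol b0 t"
        using continuous_on_osc_symbol[of b0] u unfolding continuous_on_sequentially by (auto simp: o_def)
      have "(\<lambda>n. ?k (u n) s) \<longlonglongrightarrow> ?k t s"
        unfolding osc_kernel_def by (intro tendsto_mult m p)
      then have "(\<lambda>n. (cmod (?k (u n) s - ?k t s))\<^sup>2) \<longlonglongrightarrow> (cmod (?k t s - ?k t s))\<^sup>2"
        by (intro tendsto_intros)
      then show ?case by simp
    qed
  qed measurable
  then have "(\<lambda>n. (norm (kernel_row ?k (u n) - kernel_row ?k t))\<^sup>2) \<longlonglongrightarrow> 0"
    by (simp add: sq)
  then have "(\<lambda>n. norm (kernel_row ?k (u n) - kernel_row ?k t)) \<longlonglongrightarrow> 0"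
    using tendsto_real_sqrt[of _ 0] by fastforce
  then show "(kernel_row ?k \<circ> u) \<longlonglongrightarrow> kernel_row ?k t"
    by (auto simp: o_def intro: LIM_zero_cancel tendsto_norm_zero_cancel)
qed

text \<open>Apply the operator to one of its own rows. The image at \<open>u\<close> is the inner
  product of the rows at \<open>t\<close> and \<open>u\<close>; it is continuous in
  \<open>u\<close>, so if it vanished almost everywhere it would vanish at \<open>u = t\<close>,
  where it is the squared norm of a non-zero row.\<close>

lemma kernel_op_ne_zero:
  assumes k: "schur_kernel S k" and rows: "\<And>t. square_integrable (k t)"
    and cont: "continuous_on UNIV (kernel_row k)" and t: "kernel_row k t \<noteq> 0"
  shows "kernel_op k \<noteq> (\<lambda>_. 0)"
proof
  assume zero: "kernel_op k = (\<lambda>_. 0)"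
  define F where "F u = cinner (kernel_row k t) (kernel_row k u)" for u
  have "continuous_on UNIV (cinner (kernel_row k t))"
  proof (rule lipschitz_on_continuous_on, rule lipschitz_onI)
    fix x y
    have "cinner (kernel_row k t) x - cinner (kernel_row k t) y = cinner (kernel_row k t) (x - y)"
      by (subst (1 2 3) cinner_commute) (simp add: cinner_diff_left)
    then show "dist (cinner (kernel_row k t) x) (cinner (kernel_row k t) y)
        \<le> norm (kernel_row k t) * dist x y"
      using cinner_Cauchy_Schwarz[of "kernel_row k t" "x - y"] by (simp add: dist_norm)
  qed simp
  then have F: "continuous_on UNIV F"
    unfolding F_def[abs_def] by (rule continuous_on_compose2[OF _ cont]) auto
  then have [measurable]: "F \<in> borel_measurable borel" by (rule borel_measurable_continuous_onI)
  have "(\<integral>\<^sup>+u. ennreal ((cmod (F u))\<^sup>2) \<partial>lborel) = 0"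
    using norm_kernel_op_nn[OF k, of "kernel_row k t"]
    by (simp add: zero F_def int_op_rep_eq_cinner[of k, OF rows])
  then have "AE u in lborel. ennreal ((cmod (F u))\<^sup>2) = 0"
    by (subst (asm) nn_integral_0_iff_AE) auto
  then have "AE u in lborel. u \<notin> {u. F u \<noteq> 0}" by eventually_elim simp
  moreover have op: "open {u. F u \<noteq> 0}"
    using open_Collect_neq[OF F continuous_on_const[of UNIV 0]] .
  ultimately have "{u. F u \<noteq> 0} \<in> null_sets lborel"
    by (subst (asm) AE_iff_null_sets[symmetric]) (auto intro: borel_open)
  then have "negligible {u. F u \<noteq> 0}"
    using op by (simp add: negligible_iff_null_sets null_sets_completion_iff borel_open)
  then have "{u. F u \<noteq> 0} = {}" using op open_not_negligible by blast
  then have "F t = 0" by auto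
  then show False using t by (simp add: F_def cinner_self)
qed

lemma kernel_op_osc_ne_zero: "kernel_op (osc_kernel b0) \<noteq> (\<lambda>_. 0)"
proof (rule kernel_op_ne_zero[OF schur_osc_kernel square_integrable_osc_kernel continuous_on_kernel_row_osc])
  \<comment> \<open>At the origin there is no oscillation, and each transform equals the length 1 of
    the window.\<close>
  have "norm (kernel_row (osc_kernel b0) 0) = 1"
    by (simp add: norm_kernel_row_osc osc_symbol_def osc_transform_0)
  then show "kernel_row (osc_kernel b0) 0 \<noteq> 0" by force
qed

text \<open>Each row norm is the modulus of the symbol. The coordinate along \<open>b0\<close>
  contributes the length 2R of the slab, and every other coordinate only the logarithmic integral of
  one transform; the slab need not be bounded in those directions.\<close>

lemma osc_head:
  fixes b0 :: "'a::euclidean_space"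
  assumes b0: "b0 \<in> Basis" and \<epsilon>: "0 < \<epsilon>" and R: "1 \<le> R"
  shows "(\<integral>\<^sup>+t\<in>{t. \<bar>t \<bullet> b0\<bar> \<le> R}. ennreal ((norm (kernel_row (osc_kernel b0) t))\<^sup>2) \<partial>lborel)
    \<le> ennreal (2 * (20000000 * pi * (2 + 1 / \<epsilon>)) ^ (DIM('a) - 1)
        * R powr (1 + real (DIM('a) - 1) * \<epsilon>))"
proof -
  let ?n = "DIM('a) - 1"
  define K where "K = 20000000 * pi * (2 + 1 / \<epsilon>)"
  have K: "0 \<le> K" using \<epsilon> by (simp add: K_def)
  let ?g = "\<lambda>l. indicator {-R..R} l :: ennreal"
  let ?f = "\<lambda>l q. ennreal ((cmod (osc_transform l q))\<^sup>2)"
  let ?I = "\<lambda>l. \<integral>\<^sup>+q. ?f l q \<partial>lborel"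
  have "(\<integral>\<^sup>+t\<in>{t. \<bar>t \<bullet> b0\<bar> \<le> R}. ennreal ((norm (kernel_row (osc_kernel b0) t))\<^sup>2) \<partial>lborel)
      = (\<integral>\<^sup>+t. ?g (t \<bullet> b0) * (\<Prod>b\<in>Basis - {b0}. ?f (t \<bullet> b0) (t \<bullet> b)) \<partial>lborel)"
    by (intro nn_integral_cong)
       (auto simp: norm_kernel_row_osc osc_symbol_def prod_norm[symmetric] prod_power_distrib
          prod_ennreal abs_le_iff split: split_indicator)
  also have "\<dots> = (\<integral>\<^sup>+l. ?g l * ?I l ^ ?n \<partial>lborel)"
    by (rule nn_integral_lborel_prod_fibre[OF b0]) (auto simp: case_prod_beta')
  also have "\<dots> \<le> (\<integral>\<^sup>+l. ?g l * ennreal ((K * R powr \<epsilon>) ^ ?n) \<partial>lborel)"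
  proof (rule nn_integral_mono)
    fix l
    have "?I l ^ ?n \<le> ennreal ((K * R powr \<epsilon>) ^ ?n)" if "l \<in> {-R..R}"
    proof -
      have "ln (2 + \<bar>l\<bar>) \<le> ln (2 + R)" using that by auto
      also have "\<dots> \<le> (2 + 1 / \<epsilon>) * R powr \<epsilon>" by (rule ln_le_powr[OF \<epsilon> R])
      finally have "20000000 * pi * ln (2 + \<bar>l\<bar>) \<le> 20000000 * pi * ((2 + 1 / \<epsilon>) * R powr \<epsilon>)"
        by (intro mult_left_mono) auto
      also have "\<dots> = K * R powr \<epsilon>" by (simp add: K_def)
      finally have "?I l \<le> ennreal (K * R powr \<epsilon>)"
        using nn_integral_osc_transform[of l] by (auto intro: order_trans ennreal_leI)
      then have "?I l ^ ?n \<le> ennreal (K * R powr \<epsilon>) ^ ?n"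
        by (rule power_mono) simp
      then show ?thesis using K by (simp add: ennreal_power)
    qed
    then show "?g l * ?I l ^ ?n \<le> ?g l * ennreal ((K * R powr \<epsilon>) ^ ?n)"
      by (auto split: split_indicator)
  qed
  also have "\<dots> = (\<integral>\<^sup>+l. ?g l \<partial>lborel) * ennreal ((K * R powr \<epsilon>) ^ ?n)"
    by (rule nn_integral_multc) measurable
  also have "(\<integral>\<^sup>+l. ?g l \<partial>lborel) = ennreal (2 * R)"
    using R by simp
  also have "ennreal (2 * R) * ennreal ((K * R powr \<epsilon>) ^ ?n)
      = ennreal (2 * K ^ ?n * R powr (1 + real ?n * \<epsilon>))"
  proof -
    have "(R powr \<epsilon>) ^ ?n = R powr (real ?n * \<epsilon>)"
      using R by (simp add: powr_powr mult.commute flip: powr_realpow)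
    then have "2 * R * (K * R powr \<epsilon>) ^ ?n = 2 * K ^ ?n * R powr (1 + real ?n * \<epsilon>)"
      using R by (simp add: power_mult_distrib powr_add)
    then show ?thesis using R K by (simp flip: ennreal_mult)
  qed
  finally show ?thesis by (simp add: K_def)
qed

section \<open>Decay outside the slab\<close>

lemma schur_kernel_mult_left:
  assumes k: "schur_kernel S k" and [measurable]: "c \<in> borel_measurable borel" and c: "\<And>t. cmod (c t) \<le> 1"
  shows "schur_kernel S (\<lambda>t s. c t * k t s)"
proof -
  note [measurable] = schur_kernel_measurable[OF k]
  have le: "ennreal (cmod (c t * k t s)) \<le> ennreal (cmod (k t s))" for t s
    using c[of t] by (intro ennreal_leI) (simp add: norm_mult mult_left_le_one_le)
  have "(\<integral>\<^sup>+s. ennreal (cmod (c t * k t s)) \<partial>lborel) \<le> ennreal S" for t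
    using k by (intro order_trans[OF nn_integral_mono[OF le]]) (simp add: schur_kernel_def)
  moreover have "(\<integral>\<^sup>+t. ennreal (cmod (c t * k t s)) \<partial>lborel) \<le> ennreal S" for s
    using k by (intro order_trans[OF nn_integral_mono[OF le]]) (simp add: schur_kernel_def)
  moreover have "(\<lambda>(t, s). c t * k t s) \<in> borel_measurable (borel \<Otimes>\<^sub>M borel)"
    unfolding case_prod_beta' by measurable
  ultimately show ?thesis using k by (simp add: schur_kernel_def)
qed

lemma osc_log_factor:
  fixes \<epsilon> R x :: real
  assumes "0 < \<epsilon>" "\<epsilon> < 1" "1 \<le> R" "R \<le> x"
  shows "20000000 * ln (2 + x) / x \<le> 20000000 * (2 + 1 / \<epsilon>) * R powr (\<epsilon> - 1)"
proof -
  have x: "1 \<le> x" using assms by simp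
  have "ln (2 + x) / x \<le> (2 + 1 / \<epsilon>) * x powr \<epsilon> / x"
    using ln_le_powr[OF assms(1) x] x by (intro divide_right_mono) auto
  also have "\<dots> = (2 + 1 / \<epsilon>) * x powr (\<epsilon> - 1)" using x by (simp add: powr_diff)
  also have "\<dots> \<le> (2 + 1 / \<epsilon>) * R powr (\<epsilon> - 1)"
    using assms by (intro mult_left_mono powr_mono2') auto
  finally have "20000000 * (ln (2 + x) / x) \<le> 20000000 * ((2 + 1 / \<epsilon>) * R powr (\<epsilon> - 1))"
    by (intro mult_left_mono) auto
  then show ?thesis by (simp only: mult.assoc times_divide_eq_right)
qed

text \<open>Dropping \<open>q\<close> from the Poisson-type bound leaves ln(2 + |l|) / |l| for each
  factor; since \<epsilon> < 1 this is controlled by its size at |l| = R.\<close>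

lemma osc_symbol_decay:
  fixes b0 t :: "'a::euclidean_space"
  assumes "b0 \<in> Basis" "0 < \<epsilon>" "\<epsilon> < 1" "1 \<le> R" "R \<le> \<bar>t \<bullet> b0\<bar>"
  shows "(cmod (osc_symbol b0 t))\<^sup>2 \<le> (20000000 * (2 + 1 / \<epsilon>) * R powr (\<epsilon> - 1)) ^ (DIM('a) - 1)"
proof -
  define l where "l = t \<bullet> b0"
  have l: "R \<le> \<bar>l\<bar>" "1 \<le> \<bar>l\<bar>" using assms by (auto simp: l_def)
  have F: "(cmod (osc_transform l q))\<^sup>2 \<le> 20000000 * (2 + 1 / \<epsilon>) * R powr (\<epsilon> - 1)" for q
  proof -
    have "(1 + \<bar>l\<bar>) / ((1 + \<bar>l\<bar>)\<^sup>2 + q\<^sup>2) \<le> (1 + \<bar>l\<bar>) / (1 + \<bar>l\<bar>)\<^sup>2"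
      using l by (intro divide_left_mono mult_pos_pos add_pos_nonneg) auto
    also have "\<dots> = 1 / (1 + \<bar>l\<bar>)" by (simp add: power2_eq_square)
    also have "\<dots> \<le> 1 / \<bar>l\<bar>" using l by (intro divide_left_mono) auto
    finally have "20000000 * ln (2 + \<bar>l\<bar>) * ((1 + \<bar>l\<bar>) / ((1 + \<bar>l\<bar>)\<^sup>2 + q\<^sup>2))
        \<le> 20000000 * ln (2 + \<bar>l\<bar>) * (1 / \<bar>l\<bar>)"
      using l by (intro mult_left_mono) auto
    then show ?thesis
      using osc_transform_bound[of l q] osc_log_factor[OF assms(2-4) l(1)] by simp
  qed
  have "(cmod (osc_symbol b0 t))\<^sup>2 = (\<Prod>b\<in>Basis - {b0}. (cmod (osc_transform l (t \<bullet> b)))\<^sup>2)"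
    by (simp add: osc_symbol_def l_def prod_norm[symmetric] prod_power_distrib)
  also have "\<dots> \<le> (\<Prod>b\<in>Basis - {b0}. 20000000 * (2 + 1 / \<epsilon>) * R powr (\<epsilon> - 1))"
    by (intro prod_mono conjI F) auto
  also have "\<dots> = (20000000 * (2 + 1 / \<epsilon>) * R powr (\<epsilon> - 1)) ^ (DIM('a) - 1)"
    using assms(1) by (simp add: card_Diff_singleton)
  finally show ?thesis .
qed

lemma osc_wave_correlation:
  "(\<integral>s. (\<Prod>b\<in>Basis. osc_wave l ((s - t) \<bullet> b)) * cnj (\<Prod>b\<in>Basis. osc_wave l' ((s - r) \<bullet> b)) \<partial>lborel)
    = (\<Prod>b\<in>Basis. osc_pairing l l' (t \<bullet> b) (r \<bullet> b))"
proof -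
  let ?f = "\<lambda>b y. (indicator {1..2} (y - t \<bullet> b) * indicator {1..2} (y - r \<bullet> b)) *\<^sub>R
     cis (l * theta (y - t \<bullet> b) - l' * theta (y - r \<bullet> b))"
  have "osc_wave l ((s - t) \<bullet> b) * cnj (osc_wave l' ((s - r) \<bullet> b)) = ?f b (s \<bullet> b)" for s b
    by (auto simp: osc_wave_def inner_diff_left cis_cnj cis_mult split: split_indicator)
  then have "(\<Prod>b\<in>Basis. osc_wave l ((s - t) \<bullet> b)) * cnj (\<Prod>b\<in>Basis. osc_wave l' ((s - r) \<bullet> b))
      = (\<Prod>b\<in>Basis. ?f b (s \<bullet> b))" for s
    by (simp add: prod.distrib[symmetric])
  moreover have "(\<integral>s. (\<Prod>b\<in>Basis. ?f b (s \<bullet> b)) \<partial>lborel) = (\<Prod>b\<in>Basis. \<integral>y. ?f b y \<partial>lborel)"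
  proof (rule integral_lborel_prod)
    fix b
    show "integrable lborel (?f b)"
    proof (rule Bochner_Integration.integrable_bound)
      show "integrable lborel (indicator {t \<bullet> b + 1..t \<bullet> b + 2} :: real \<Rightarrow> real)"
        by (rule integrable_real_indicator) auto
    qed (auto simp: indicator_def split: if_splits)
  qed
  ultimately show ?thesis by (simp add: osc_pairing_def)
qed

lemma osc_pairing_eq_0: "\<bar>u - u'\<bar> > 1 \<Longrightarrow> osc_pairing a a' u u' = 0"
proof -
  assume "\<bar>u - u'\<bar> > 1"
  then have zero: "indicator {1..2} (s - u) * indicator {1..2} (s - u') = (0 :: real)" for s
    by (auto split: split_indicator)
  show ?thesis unfolding osc_pairing_def zero by simp
qed

text \<open>For the kernel cut off to the complement of the slab, the kernel of T T* is a product of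
  two symbols and one correlation per coordinate. The symbols supply n - 1 factors R^(\<epsilon>-1)
  and the integrated correlations n more, whence the exponent 2n - 1.\<close>

lemma osc_tail:
  fixes b0 :: "'a::euclidean_space"
  assumes b0: "b0 \<in> Basis" and \<epsilon>: "0 < \<epsilon>" "\<epsilon> < 1" and R: "1 \<le> R"
  shows "(\<integral>\<^sup>+t\<in>-{t. \<bar>t \<bullet> b0\<bar> \<le> R}. ennreal ((cmod (int_op (osc_kernel b0) (rep_L2 \<phi>) t))\<^sup>2) \<partial>lborel)
    \<le> ennreal ((20000000 * (2 + 1 / \<epsilon>)) ^ (2 * DIM('a) - 1)
        * R powr (- ((1 - \<epsilon>) * real (2 * DIM('a) - 1))) * (norm \<phi>)\<^sup>2)"
proof -
  define c :: "'a \<Rightarrow> complex" where "c = indicator (-{t. \<bar>t \<bullet> b0\<bar> \<le> R})"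
  define k where "k t s = c t * osc_kernel b0 t s" for t s
  define Q where "Q = 20000000 * (2 + 1 / \<epsilon>) * R powr (\<epsilon> - 1)"
  have Q: "0 \<le> Q" using \<epsilon> by (simp add: Q_def)
  have [measurable]: "c \<in> borel_measurable borel" unfolding c_def by measurable
  have c1: "cmod (c t) \<le> 1" for t by (auto simp: c_def split: split_indicator)
  have c_nz: "R < \<bar>t \<bullet> b0\<bar>" if "c t \<noteq> 0" for t
    using that by (auto simp: c_def indicator_def split: if_splits)
  have k: "schur_kernel 1 k"
    unfolding k_def[abs_def] by (rule schur_kernel_mult_left[OF schur_osc_kernel _ c1]) measurable
  let ?c = "comp_kernel k (adj_kernel k)" and ?n = "DIM('a)"
  have comp: "?c t r
      = c t * cnj (c r) * (osc_symbol b0 t * cnj (osc_symbol b0 r))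
        * (\<Prod>b\<in>Basis. osc_pairing (t \<bullet> b0) (r \<bullet> b0) (t \<bullet> b) (r \<bullet> b))" for t r
  proof -
    have "?c t r = (\<integral>s. (c t * cnj (c r) * (osc_symbol b0 t * cnj (osc_symbol b0 r)))
        * ((\<Prod>b\<in>Basis. osc_wave (t \<bullet> b0) ((s - t) \<bullet> b))
           * cnj (\<Prod>b\<in>Basis. osc_wave (r \<bullet> b0) ((s - r) \<bullet> b))) \<partial>lborel)"
      unfolding comp_kernel_def adj_kernel_def k_def osc_kernel_def
      by (intro Bochner_Integration.integral_cong refl) (simp add: ac_simps)
    then show ?thesis by (simp only: integral_mult_right_zero osc_wave_correlation)
  qed
  have bound: "cmod (?c t r)
      \<le> Q ^ (?n - 1) * (\<Prod>b\<in>Basis. osc_majorant R (t \<bullet> b - r \<bullet> b))" for t r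
  proof -
    have nonneg: "0 \<le> Q ^ (?n - 1) * (\<Prod>b\<in>Basis. osc_majorant R (t \<bullet> b - r \<bullet> b))"
      using Q R by (intro mult_nonneg_nonneg prod_nonneg osc_majorant_nonneg) auto
    \<comment> \<open>The coordinates along \<open>b0\<close> are also the frequencies of the two
      waves. If they differ by more than 1, the windows in that same coordinate are disjoint and the
      kernel vanishes; otherwise the correlation bound for nearby frequencies applies.\<close>
    consider "c t = 0 \<or> c r = 0" | "1 < \<bar>t \<bullet> b0 - r \<bullet> b0\<bar>"
      | "R < \<bar>t \<bullet> b0\<bar>" "R < \<bar>r \<bullet> b0\<bar>" "\<bar>t \<bullet> b0 - r \<bullet> b0\<bar> \<le> 1"
      using c_nz by (metis not_le)
    then show ?thesis
    proof cases
      case 1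
      then show ?thesis using nonneg by (auto simp: comp)
    next
      case 2
      then have "(\<Prod>b\<in>Basis. osc_pairing (t \<bullet> b0) (r \<bullet> b0) (t \<bullet> b) (r \<bullet> b)) = 0"
        using b0 osc_pairing_eq_0 by (intro prod_zero bexI[of _ b0]) auto
      then have "?c t r = 0" unfolding comp by simp
      then show ?thesis using nonneg by simp
    next
      case 3
      let ?x = "cmod (osc_symbol b0 t)" and ?y = "cmod (osc_symbol b0 r)"
      have "?x\<^sup>2 \<le> Q ^ (?n - 1)" "?y\<^sup>2 \<le> Q ^ (?n - 1)"
        unfolding Q_def using 3 by (intro osc_symbol_decay[OF b0 \<epsilon> R]; simp)+
      \<comment> \<open>By 2xy \<le> x^2 + y^2, two symbols together cost one bound for a squared
        symbol.\<close>
      then have xy: "?x * ?y \<le> Q ^ (?n - 1)"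
        using sum_squares_bound[of ?x ?y] by linarith
      have "cmod (\<Prod>b\<in>Basis. osc_pairing (t \<bullet> b0) (r \<bullet> b0) (t \<bullet> b) (r \<bullet> b))
          \<le> (\<Prod>b\<in>Basis. osc_majorant R (t \<bullet> b - r \<bullet> b))"
        unfolding prod_norm[symmetric] using 3 R
        by (intro prod_mono conjI osc_pairing_bound) auto
      moreover have "cmod (c t * cnj (c r) * (osc_symbol b0 t * cnj (osc_symbol b0 r))) \<le> 1 * 1 * (Q ^ (?n - 1))"
        unfolding norm_mult complex_mod_cnj
        by (intro mult_mono c1 xy mult_nonneg_nonneg) auto
      ultimately show ?thesis
        unfolding comp norm_mult[of _ "prod _ _"] using Q by (intro mult_mono) auto
    qed
  qed
  have maj: "(\<Prod>b\<in>(Basis :: 'a set). \<integral>\<^sup>+y. ennreal (osc_majorant R y) \<partial>lborel) \<le> ennreal (Q ^ ?n)"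
  proof -
    have "320000 * ln (1 + R) / R \<le> 20000000 * ln (2 + R) / R"
      using R by (intro divide_right_mono mult_mono) auto
    also have "\<dots> \<le> Q" unfolding Q_def using osc_log_factor[OF \<epsilon> R order_refl] .
    finally have "(\<integral>\<^sup>+y. ennreal (osc_majorant R y) \<partial>lborel) \<le> ennreal Q"
      using nn_integral_osc_majorant[of R] R by (auto intro: order_trans ennreal_leI)
    then have "(\<Prod>b\<in>(Basis :: 'a set). \<integral>\<^sup>+y. ennreal (osc_majorant R y) \<partial>lborel) \<le> ennreal Q ^ ?n"
      by (simp add: power_mono)
    then show ?thesis using Q by (simp add: ennreal_power)
  qed
  have prod_eq: "ennreal (Q ^ (?n - 1)) * ennreal (Q ^ ?n) = ennreal (Q ^ (2 * ?n - 1))"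
  proof -
    have "?n - 1 + ?n = 2 * ?n - 1" by (simp add: mult_2)
    then show ?thesis using Q by (simp flip: ennreal_mult power_add)
  qed
  have meas [measurable]: "osc_majorant R \<in> borel_measurable borel"
    unfolding osc_majorant_def[abs_def] by measurable
  have schur: "schur_kernel (Q ^ (2 * ?n - 1)) (?c)"
    unfolding schur_kernel_def
  proof (intro conjI allI)
    show "case_prod (?c) \<in> borel_measurable (borel \<Otimes>\<^sub>M borel)"
      by (intro measurable_comp_kernel schur_kernel_measurable[OF k]
          schur_kernel_measurable[OF schur_adj_kernel[OF k]])
    have le: "ennreal (cmod (?c t r))
        \<le> ennreal (Q ^ (?n - 1)) * (\<Prod>b\<in>Basis. ennreal (osc_majorant R (t \<bullet> b - r \<bullet> b)))" for t r
      using ennreal_leI[OF bound[of t r]] Q R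
      by (simp add: ennreal_mult prod_ennreal osc_majorant_nonneg prod_nonneg)
    have int: "(\<integral>\<^sup>+x. ennreal (Q ^ (?n - 1)) * (\<Prod>b\<in>Basis. ennreal (osc_majorant R (g b x))) \<partial>lborel)
        \<le> ennreal (Q ^ (2 * ?n - 1))"
      if [measurable]: "\<And>b. g b \<in> borel_measurable borel"
        and g: "(\<integral>\<^sup>+x. (\<Prod>b\<in>Basis. ennreal (osc_majorant R (g b x))) \<partial>lborel)
          = (\<Prod>b\<in>(Basis :: 'a set). \<integral>\<^sup>+y. ennreal (osc_majorant R y) \<partial>lborel)"
      for g :: "'a \<Rightarrow> 'a \<Rightarrow> real"
    proof -
      have "(\<integral>\<^sup>+x. ennreal (Q ^ (?n - 1)) * (\<Prod>b\<in>Basis. ennreal (osc_majorant R (g b x))) \<partial>lborel)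
          = ennreal (Q ^ (?n - 1)) * (\<Prod>b\<in>(Basis :: 'a set). \<integral>\<^sup>+y. ennreal (osc_majorant R y) \<partial>lborel)"
        unfolding g[symmetric] by (intro nn_integral_cmult borel_measurable_prod_ennreal) measurable
      also have "\<dots> \<le> ennreal (Q ^ (2 * ?n - 1))"
        unfolding prod_eq[symmetric] by (intro mult_left_mono maj) auto
      finally show ?thesis .
    qed
    show "(\<integral>\<^sup>+r. ennreal (cmod (?c t r)) \<partial>lborel) \<le> ennreal (Q ^ (2 * ?n - 1))" for t
      by (rule order_trans[OF nn_integral_mono[OF le] int])
         (measurable, rule nn_integral_prod_shift(2)[of "\<lambda>_ y. ennreal (osc_majorant R y)" t], measurable)
    show "(\<integral>\<^sup>+t. ennreal (cmod (?c t r)) \<partial>lborel) \<le> ennreal (Q ^ (2 * ?n - 1))" for r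
      by (rule order_trans[OF nn_integral_mono[OF le] int])
         (measurable, rule nn_integral_prod_shift(1)[of "\<lambda>_ y. ennreal (osc_majorant R y)" r], measurable)
  qed (use Q in auto)
  have op: "int_op k f t = c t * int_op (osc_kernel b0) f t" for f t
    unfolding int_op_def k_def by (simp add: mult.assoc)
  have "(\<integral>\<^sup>+t\<in>-{t. \<bar>t \<bullet> b0\<bar> \<le> R}. ennreal ((cmod (int_op (osc_kernel b0) (rep_L2 \<phi>) t))\<^sup>2) \<partial>lborel)
      = (\<integral>\<^sup>+t. ennreal ((cmod (int_op k (rep_L2 \<phi>) t))\<^sup>2) \<partial>lborel)"
    by (intro nn_integral_cong) (auto simp: op c_def split: split_indicator)
  also have "\<dots> = ennreal ((norm (kernel_op k \<phi>))\<^sup>2)" by (rule norm_kernel_op_nn[OF k, symmetric])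
  also have "\<dots> \<le> ennreal (Q ^ (2 * ?n - 1) * (norm \<phi>)\<^sup>2)"
    by (intro ennreal_leI norm_kernel_op_TTstar[OF k schur])
  also have "Q ^ (2 * ?n - 1) = (20000000 * (2 + 1 / \<epsilon>)) ^ (2 * ?n - 1)
      * R powr (- ((1 - \<epsilon>) * real (2 * ?n - 1)))"
  proof -
    have "(R powr (\<epsilon> - 1)) ^ (2 * ?n - 1) = R powr ((\<epsilon> - 1) * real (2 * ?n - 1))"
      using R by (simp add: powr_powr del: of_nat_diff flip: powr_realpow)
    also have "(\<epsilon> - 1) * real (2 * ?n - 1) = - ((1 - \<epsilon>) * real (2 * ?n - 1))"
      by (simp add: algebra_simps)
    finally show ?thesis by (simp add: Q_def power_mult_distrib)
  qed
  finally show ?thesis .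
qed

theorem kernel_op_osc_schatten:
  fixes b0 :: "'a::euclidean_space"
  assumes b0: "b0 \<in> Basis" and p: "p > 4 * real DIM('a) / (2 * real DIM('a) - 1)"
  shows "kernel_op (osc_kernel b0) \<in> schatten_class p"
proof -
  define n where "n = DIM('a)"
  have n: "1 \<le> n" using DIM_positive[where 'a = 'a] by (simp add: n_def)
  have m: "real (2 * n - 1) = 2 * real n - 1" "0 < 2 * real n - 1" using n by auto
  \<comment> \<open>At \<epsilon> = 0 the exponent is 2 + 2/(2n - 1) = 4n/(2n - 1), which is below
    \<open>p\<close>; by continuity this persists for some positive \<epsilon>.\<close>
  have "((\<lambda>\<epsilon>. 2 + 2 * (1 + real (n - 1) * \<epsilon>) / ((1 - \<epsilon>) * (2 * real n - 1)))
      \<longlongrightarrow> 2 + 2 * (1 + real (n - 1) * 0) / ((1 - 0) * (2 * real n - 1))) (at_right 0)"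
    using m by (intro tendsto_intros) auto
  moreover have "2 + 2 * (1 + real (n - 1) * 0) / ((1 - 0) * (2 * real n - 1)) < p"
    using p m by (simp add: n_def[symmetric] field_simps)
  ultimately have "\<forall>\<^sub>F \<epsilon> in at_right 0.
      2 + 2 * (1 + real (n - 1) * \<epsilon>) / ((1 - \<epsilon>) * (2 * real n - 1)) < p"
    by (rule order_tendstoD)
  moreover have "\<forall>\<^sub>F \<epsilon> in at_right (0::real). 0 < \<epsilon> \<and> \<epsilon> < 1"
    using eventually_at_right_real[of 0 1] by (rule eventually_mono) auto
  ultimately have "\<forall>\<^sub>F \<epsilon> in at_right 0. 0 < \<epsilon> \<and> \<epsilon> < 1 \<and>
      2 + 2 * (1 + real (n - 1) * \<epsilon>) / ((1 - \<epsilon>) * (2 * real n - 1)) < p"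
    by eventually_elim auto
  then obtain \<epsilon> where \<epsilon>: "0 < \<epsilon>" "\<epsilon> < 1"
      and \<epsilon>p: "2 + 2 * (1 + real (n - 1) * \<epsilon>) / ((1 - \<epsilon>) * (2 * real n - 1)) < p"
    using eventually_happens by force
  define C1 C2 where "C1 = 2 * (20000000 * pi * (2 + 1 / \<epsilon>)) ^ (DIM('a) - 1)"
    and "C2 = (20000000 * (2 + 1 / \<epsilon>)) ^ (2 * DIM('a) - 1)"
  have C: "0 \<le> C1" "0 \<le> C2" using \<epsilon> by (simp_all add: C1_def C2_def)
  show ?thesis
  proof (rule kernel_op_in_schatten_class[OF schur_osc_kernel square_integrable_osc_kernel _
        continuous_on_kernel_row_osc, where B = 1 and T = "\<lambda>R. {t. \<bar>t \<bullet> b0\<bar> \<le> R}" and C = "C1 + C2 + 1"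
          and a = "1 + real (n - 1) * \<epsilon>" and b = "(1 - \<epsilon>) * (2 * real n - 1)"])
    show "norm (kernel_row (osc_kernel b0) t) \<le> 1" for t
      by (simp add: norm_kernel_row_osc cmod_osc_symbol_le_1)
    show "{t. \<bar>t \<bullet> b0\<bar> \<le> R} \<in> sets borel" for R by measurable
    show "(\<integral>\<^sup>+t\<in>{t. \<bar>t \<bullet> b0\<bar> \<le> R}. ennreal ((norm (kernel_row (osc_kernel b0) t))\<^sup>2) \<partial>lborel)
        \<le> ennreal ((C1 + C2 + 1) * R powr (1 + real (n - 1) * \<epsilon>))" if "1 \<le> R" for R
    proof (rule order_trans[OF osc_head[OF b0 \<epsilon>(1) that] ennreal_leI])
      show "2 * (20000000 * pi * (2 + 1 / \<epsilon>)) ^ (DIM('a) - 1) * R powr (1 + real (DIM('a) - 1) * \<epsilon>)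
        \<le> (C1 + C2 + 1) * R powr (1 + real (n - 1) * \<epsilon>)"
        unfolding C1_def[symmetric] unfolding n_def[symmetric] using C by (intro mult_right_mono) auto
    qed
    show "(\<integral>\<^sup>+t\<in>-{t. \<bar>t \<bullet> b0\<bar> \<le> R}. ennreal ((cmod (int_op (osc_kernel b0) (rep_L2 \<phi>) t))\<^sup>2) \<partial>lborel)
        \<le> ennreal ((C1 + C2 + 1) * R powr (- ((1 - \<epsilon>) * (2 * real n - 1))) * (norm \<phi>)\<^sup>2)"
      if "1 \<le> R" for R \<phi>
    proof (rule order_trans[OF osc_tail[OF b0 \<epsilon> that] ennreal_leI])
      show "(20000000 * (2 + 1 / \<epsilon>)) ^ (2 * DIM('a) - 1)
        * R powr (- ((1 - \<epsilon>) * real (2 * DIM('a) - 1))) * (norm \<phi>)\<^sup>2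
        \<le> (C1 + C2 + 1) * R powr (- ((1 - \<epsilon>) * (2 * real n - 1))) * (norm \<phi>)\<^sup>2"
        unfolding C2_def[symmetric] unfolding n_def[symmetric] m(1) using C by (intro mult_right_mono) auto
    qed
    show "0 < C1 + C2 + 1" using C by simp
    show "0 < 1 + real (n - 1) * \<epsilon>" using \<epsilon> by (intro add_pos_nonneg) auto
    show "0 < (1 - \<epsilon>) * (2 * real n - 1)" using \<epsilon> m by simp
    show "2 + 2 * (1 + real (n - 1) * \<epsilon>) / ((1 - \<epsilon>) * (2 * real n - 1)) < p" by (rule \<epsilon>p)
  qed
qed

section \<open>Quantum translates of integral operators\<close>

lemma inv_schroedinger: "inv (schroedinger x y 1) \<phi> = schroedinger (- x) (- y) 1 \<phi>"
proof (rule inv_f_eq)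
  show "inj (schroedinger x y 1)" by (rule bij_is_inj[OF bij_schroedinger]) simp
  show "schroedinger x y 1 (schroedinger (- x) (- y) 1 \<phi>) = \<phi>"
    by (simp add: schroedinger_mult schroedinger_one inner_commute)
qed

lemma integral_lborel_shift:
  fixes f :: "'a::euclidean_space \<Rightarrow> complex"
  assumes [measurable]: "f \<in> borel_measurable borel"
  shows "(\<integral>s. f (s + c) \<partial>lborel) = (\<integral>s. f s \<partial>lborel)"
proof -
  have "(\<integral>s. f s \<partial>lborel) = (\<integral>s. f s \<partial>distr lborel borel ((+) c))"
    by (simp only: lborel_distr_plus)
  also have "\<dots> = (\<integral>s. f (c + s) \<partial>lborel)"
    by (rule integral_distr) auto
  finally show ?thesis by (simp add: add.commute)
qed

text \<open>The kernel after conjugation: the shift moves both arguments, and the modulation leaves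
  a character of s - t, because the constant phases x \<bullet> y of the operator and of its inverse
  cancel.\<close>

definition translate_kernel ::
  "'a::euclidean_space \<times> 'a \<Rightarrow> ('a \<Rightarrow> 'a \<Rightarrow> complex) \<Rightarrow> 'a \<Rightarrow> 'a \<Rightarrow> complex" where
  "translate_kernel w k t s = k (t + fst w) (s + fst w) * cis (- 2 * pi * (snd w \<bullet> (s - t)))"

lemma schroedinger_phase_cis: "schroedinger_phase x y t = cis (pi * (x \<bullet> y + 2 * (y \<bullet> t)))"
  by (simp add: schroedinger_phase_def cis_conv_exp ac_simps)

lemma quantum_translate_kernel_op:
  assumes k: "schur_kernel S k" and f: "square_integrable f"
  shows "square_integrable (int_op (translate_kernel w k) f)"
    and "quantum_translate w (kernel_op k) (abs_L2 f) = abs_L2 (int_op (translate_kernel w k) f)"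
proof -
  obtain x y where w: "w = (x, y)" by (cases w)
  note [measurable] = schur_kernel_measurable[OF k] square_integrable_measurable[OF f]
  define g where "g s = 1 * schroedinger_phase (- x) (- y) s * f (s + - x)" for s
  have sg: "square_integrable g"
    using l2_rel_schroedinger[OF l2_rel_refl[OF f], of 1 "- x" "- y"] by (simp add: g_def[abs_def] l2_rel_def)
  note [measurable] = square_integrable_measurable[OF sg]
  note sh = square_integrable_int_op[OF k sg]
  have eq: "(\<lambda>t. 1 * schroedinger_phase x y t * int_op k g (t + x)) = int_op (translate_kernel w k) f"
  proof
    fix t
    have "int_op k g (t + x) = (\<integral>s. k (t + x) (s + x) * g (s + x) \<partial>lborel)"
      unfolding int_op_def
      by (rule integral_lborel_shift[of "\<lambda>s. k (t + x) s * g s", symmetric]) measurable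
    then have "1 * schroedinger_phase x y t * int_op k g (t + x)
        = (\<integral>s. schroedinger_phase x y t * (k (t + x) (s + x) * g (s + x)) \<partial>lborel)"
      by simp
    also have "\<dots> = int_op (translate_kernel w k) f t"
      unfolding int_op_def
    proof (rule Bochner_Integration.integral_cong[OF refl])
      fix s
      have "schroedinger_phase x y t * schroedinger_phase (- x) (- y) (s + x)
          = cis (- 2 * pi * (y \<bullet> (s - t)))"
        unfolding schroedinger_phase_cis cis_mult
        by (rule arg_cong[of _ _ cis]) (simp add: inner_diff_right inner_add_right inner_commute algebra_simps)
      moreover have "schroedinger_phase x y t * (k (t + x) (s + x) * g (s + x))
          = k (t + x) (s + x) * (schroedinger_phase x y t * schroedinger_phase (- x) (- y) (s + x)) * f s"
        by (simp add: g_def)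
      ultimately show "schroedinger_phase x y t * (k (t + x) (s + x) * g (s + x)) = translate_kernel w k t s * f s"
        by (simp only: translate_kernel_def w fst_conv snd_conv)
    qed
    finally show "1 * schroedinger_phase x y t * int_op k g (t + x) = int_op (translate_kernel w k) f t" .
  qed
  show "square_integrable (int_op (translate_kernel w k) f)"
    using l2_rel_schroedinger[OF l2_rel_refl[OF sh], of 1 x y] unfolding eq by (simp add: l2_rel_def)
  have "inv (schroedinger x y 1) (abs_L2 f) = abs_L2 g"
    unfolding inv_schroedinger g_def[abs_def] by (rule schroedinger.abs_eq[OF l2_rel_refl[OF f]])
  then have "quantum_translate w (kernel_op k) (abs_L2 f) = schroedinger x y 1 (abs_L2 (int_op k g))"
    by (simp add: quantum_translate_def w kernel_op_abs[OF k sg])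
  also have "\<dots> = abs_L2 (int_op (translate_kernel w k) f)"
    unfolding schroedinger.abs_eq[OF l2_rel_refl[OF sh]] eq ..
  finally show "quantum_translate w (kernel_op k) (abs_L2 f) = abs_L2 (int_op (translate_kernel w k) f)" .
qed

lemma sum_scaleC_abs_L2:
  assumes "\<And>j. j \<in> J \<Longrightarrow> square_integrable (f j)"
  shows "square_integrable (\<lambda>t. \<Sum>j\<in>J. c j * f j t) \<and>
    (\<Sum>j\<in>J. c j *\<^sub>C abs_L2 (f j)) = abs_L2 (\<lambda>t. \<Sum>j\<in>J. c j * f j t)"
  using assms
proof (induction J rule: infinite_finite_induct)
  case (insert j J)
  then have "square_integrable (f j)" "square_integrable (\<lambda>t. \<Sum>j\<in>J. c j * f j t)"
    "(\<Sum>j\<in>J. c j *\<^sub>C abs_L2 (f j)) = abs_L2 (\<lambda>t. \<Sum>j\<in>J. c j * f j t)" by auto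
  then show ?case
    using insert.hyps by (simp add: abs_L2_scaleC abs_L2_add square_integrable_cmult square_integrable_add)
qed (simp_all add: square_integrable_zero zero_L2.abs_eq)

lemma translate_kernel_square_integrable:
  assumes "square_integrable (k (t + fst w))"
  shows "square_integrable (translate_kernel w k t)"
proof (rule square_integrableI)
  have sh: "square_integrable (\<lambda>s. k (t + fst w) (s + fst w))"
    using assms by (rule square_integrable_shift)
  note [measurable] = square_integrable_measurable[OF sh]
  show "translate_kernel w k t \<in> borel_measurable borel"
    unfolding translate_kernel_def[abs_def] by measurable
  show "(\<integral>\<^sup>+s. ennreal ((cmod (translate_kernel w k t s))\<^sup>2) \<partial>lborel) < \<infinity>"
    using square_integrable_nn[OF sh] by (simp add: translate_kernel_def norm_mult)
qed

text \<open>A pointwise relation among the translated kernels suffices. Since the rows are in L2,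
  every translated integral converges at every \<open>t\<close>, and the finite sum may be taken
  under the integral.\<close>

lemma quantum_translates_dependent_kernel_op:
  assumes k: "schur_kernel S k" and rows: "\<And>t. square_integrable (k t)"
    and rel: "\<And>t s. (\<Sum>j\<in>J. c j * translate_kernel (w j) k t s) = 0"
  shows "(\<Sum>j\<in>J. c j *\<^sub>C quantum_translate (w j) (kernel_op k) \<phi>) = 0"
proof -
  obtain f where f: "square_integrable f" "\<phi> = abs_L2 f" by (rule L2_cases)
  have int: "integrable lborel (\<lambda>s. translate_kernel (w j) k t s * f s)" for j t
    using square_integrable_mult_cnj[OF translate_kernel_square_integrable[OF rows] square_integrable_cnj[OF f(1)]]
    by simp
  have zero: "(\<Sum>j\<in>J. c j * int_op (translate_kernel (w j) k) f t) = 0" for t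
  proof -
    have "(\<Sum>j\<in>J. c j * int_op (translate_kernel (w j) k) f t)
        = (\<Sum>j\<in>J. \<integral>s. c j * (translate_kernel (w j) k t s * f s) \<partial>lborel)"
      by (simp only: int_op_def integral_mult_right_zero)
    also have "\<dots> = (\<integral>s. (\<Sum>j\<in>J. c j * (translate_kernel (w j) k t s * f s)) \<partial>lborel)"
      by (rule Bochner_Integration.integral_sum[symmetric]) (intro integrable_mult_right int)
    also have "\<dots> = (\<integral>s. (\<Sum>j\<in>J. c j * translate_kernel (w j) k t s) * f s \<partial>lborel)"
      by (simp only: sum_distrib_right mult.assoc)
    finally show ?thesis by (simp add: rel)
  qed
  have "(\<Sum>j\<in>J. c j *\<^sub>C quantum_translate (w j) (kernel_op k) \<phi>)
      = (\<Sum>j\<in>J. c j *\<^sub>C abs_L2 (int_op (translate_kernel (w j) k) f))"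
    unfolding f(2) quantum_translate_kernel_op(2)[OF k f(1)] ..
  also have "\<dots> = abs_L2 (\<lambda>t. \<Sum>j\<in>J. c j * int_op (translate_kernel (w j) k) f t)"
    using sum_scaleC_abs_L2[of J "\<lambda>j. int_op (translate_kernel (w j) k) f" c]
      quantum_translate_kernel_op(1)[OF k f(1)] by blast
  finally show ?thesis by (simp add: zero zero_L2.abs_eq)
qed

section \<open>The linear relation\<close>

lemma cis_sum: "cis (\<Sum>i\<in>I. f i) = (\<Prod>i\<in>I. cis (f i))"
  by (induction I rule: infinite_finite_induct) (auto simp: cis_mult[symmetric])

text \<open>Expands a product of binomials into monomials, \<open>B\<close> being the set of factors
  in which the non-constant term is chosen. Keeping one product over \<open>A\<close> matches the
  shape of a translated kernel.\<close>

lemma prod_add_two_times: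
  fixes f g :: "'i \<Rightarrow> complex"
  assumes "finite A"
  shows "(\<Prod>i\<in>A. f i + 2 * g i) = (\<Sum>B\<in>Pow A. 2 ^ card (A - B) * (\<Prod>i\<in>A. if i \<in> B then f i else g i))"
proof -
  have "(\<Prod>i\<in>A. f i + 2 * g i) = (\<Sum>B\<in>Pow A. (\<Prod>i\<in>B. f i) * (\<Prod>i\<in>A - B. 2 * g i))"
    by (rule prod_add[OF assms])
  also have "\<dots> = (\<Sum>B\<in>Pow A. 2 ^ card (A - B) * (\<Prod>i\<in>A. if i \<in> B then f i else g i))"
  proof (rule sum.cong[OF refl])
    fix B assume "B \<in> Pow A"
    then have B: "B \<subseteq> A" by simp
    have "(\<Prod>i\<in>A. if i \<in> B then f i else g i)
        = (\<Prod>i\<in>A - B. if i \<in> B then f i else g i) * (\<Prod>i\<in>B. if i \<in> B then f i else g i)"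
      by (rule prod.subset_diff[OF B assms])
    also have "\<dots> = (\<Prod>i\<in>A - B. g i) * (\<Prod>i\<in>B. f i)" by simp
    finally show "(\<Prod>i\<in>B. f i) * (\<Prod>i\<in>A - B. 2 * g i)
        = 2 ^ card (A - B) * (\<Prod>i\<in>A. if i \<in> B then f i else g i)"
      by (simp add: prod.distrib)
  qed
  finally show ?thesis .
qed

lemma inner_sum_Basis:
  fixes S :: "'a::euclidean_space set"
  assumes "S \<subseteq> Basis" "b \<in> Basis"
  shows "(\<Sum>S) \<bullet> b = (if b \<in> S then 1 else 0)"
proof -
  have "finite S" using assms(1) finite_Basis by (rule finite_subset)
  have "(\<Sum>S) \<bullet> b = (\<Sum>c\<in>S. if b = c then 1 else 0)"
    unfolding inner_sum_left using assms by (intro sum.cong refl) (auto simp: inner_Basis)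
  then show ?thesis using \<open>finite S\<close> by simp
qed

text \<open>The vector \<open>(b0 - \<Sum>S, \<Sum>U / 2\<pi>)\<close> belongs to the monomials of
  \<open>exp (i y\<^sub>0) \<Prod>(2 + exp (-i x\<^sub>b)) \<Prod>(2 + exp (-i y\<^sub>b))\<close>, and \<open>(\<Sum>S, - \<Sum>U / 2\<pi>)\<close> to those of
  \<open>\<Prod>(2 + exp (i x\<^sub>b)) \<Prod>(2 + exp (i y\<^sub>b))\<close>.\<close>

definition osc_shift :: "'a::euclidean_space \<Rightarrow> bool \<times> 'a set \<times> 'a set \<Rightarrow> 'a \<times> 'a" where
  "osc_shift b0 = (\<lambda>(d, S, U). (if d then b0 - \<Sum>S else \<Sum>S,
     (if d then 1 / (2 * pi) else - 1 / (2 * pi)) *\<^sub>R \<Sum>U))"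

text \<open>The powers of 2 count the factors in which the constant term 2 is chosen; the sign moves
  both products to one side of the equation.\<close>

definition osc_coeff :: "'a::euclidean_space \<Rightarrow> bool \<times> 'a set \<times> 'a set \<Rightarrow> complex" where
  "osc_coeff b0 = (\<lambda>(d, S, U). (if d then 1 else - 1)
     * 2 ^ card (Basis - {b0} - S) * 2 ^ card (Basis - U))"

text \<open>Each monomial acts coordinatewise: a step along \<open>b0\<close> raises the frequency
  by 1, steps along \<open>S\<close> shift the second argument of the transforms, and the modulation
  by \<open>U\<close> multiplies waves by exponentials. \<open>S\<close> avoids \<open>b0\<close>,
  so that the frequency depends on \<open>d\<close> only.\<close>

lemma translate_osc_kernel:
  fixes b0 :: "'a::euclidean_space" and d :: bool
  assumes b0: "b0 \<in> Basis" and S: "S \<subseteq> Basis - {b0}" and U: "U \<subseteq> Basis"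
  defines "\<delta> \<equiv> (if d then 1 else 0)" and "\<eta> \<equiv> (if d then - 1 else 1)"
  shows "translate_kernel (osc_shift b0 (d, S, U)) (osc_kernel b0) t s
    = (\<Prod>b\<in>Basis - {b0}. if b \<in> S then osc_transform (t \<bullet> b0 + \<delta>) (t \<bullet> b + \<eta>)
          else osc_transform (t \<bullet> b0 + \<delta>) (t \<bullet> b))
      * (\<Prod>b\<in>Basis. if b \<in> U then osc_wave (t \<bullet> b0 + \<delta>) ((s - t) \<bullet> b) * cis (\<eta> * ((s - t) \<bullet> b))
          else osc_wave (t \<bullet> b0 + \<delta>) ((s - t) \<bullet> b))"
proof -
  define w where "w = osc_shift b0 (d, S, U)"
  have S': "S \<subseteq> Basis" using S by auto
  have w0: "fst w \<bullet> b0 = \<delta>"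
    using b0 S inner_sum_Basis[OF S' b0] by (auto simp: w_def osc_shift_def \<delta>_def inner_diff_left inner_Basis)
  have wb: "fst w \<bullet> b = (if b \<in> S then \<eta> else 0)" if "b \<in> Basis - {b0}" for b
    using b0 that inner_sum_Basis[OF S', of b]
    by (auto simp: w_def osc_shift_def \<eta>_def inner_diff_left inner_Basis)
  have symbol: "osc_symbol b0 (t + fst w)
      = (\<Prod>b\<in>Basis - {b0}. if b \<in> S then osc_transform (t \<bullet> b0 + \<delta>) (t \<bullet> b + \<eta>)
          else osc_transform (t \<bullet> b0 + \<delta>) (t \<bullet> b))"
    unfolding osc_symbol_def by (intro prod.cong refl) (auto simp: inner_add_left w0 wb)
  have "- 2 * pi * (snd w \<bullet> (s - t)) = \<eta> * ((\<Sum>U) \<bullet> (s - t))"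
    by (simp add: w_def osc_shift_def \<eta>_def)
  also have "\<dots> = (\<Sum>b\<in>U. \<eta> * ((s - t) \<bullet> b))"
    by (simp only: inner_sum_left sum_distrib_left) (simp add: inner_commute)
  finally have "cis (- 2 * pi * (snd w \<bullet> (s - t))) = (\<Prod>b\<in>U. cis (\<eta> * ((s - t) \<bullet> b)))"
    by (simp only: cis_sum)
  also have "\<dots> = (\<Prod>b\<in>Basis. if b \<in> U then cis (\<eta> * ((s - t) \<bullet> b)) else 1)"
    using U by (intro prod.mono_neutral_cong_left) auto
  finally have cis: "cis (- 2 * pi * (snd w \<bullet> (s - t)))
      = (\<Prod>b\<in>Basis. if b \<in> U then cis (\<eta> * ((s - t) \<bullet> b)) else 1)" .
  have "translate_kernel w (osc_kernel b0) t s = osc_symbol b0 (t + fst w)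
      * ((\<Prod>b\<in>Basis. osc_wave (t \<bullet> b0 + \<delta>) ((s - t) \<bullet> b))
        * (\<Prod>b\<in>Basis. if b \<in> U then cis (\<eta> * ((s - t) \<bullet> b)) else 1))"
    unfolding translate_kernel_def cis osc_kernel_def by (simp add: inner_add_left w0 mult.assoc)
  also have "(\<Prod>b\<in>Basis. osc_wave (t \<bullet> b0 + \<delta>) ((s - t) \<bullet> b))
        * (\<Prod>b\<in>Basis. if b \<in> U then cis (\<eta> * ((s - t) \<bullet> b)) else 1)
      = (\<Prod>b\<in>Basis. if b \<in> U then osc_wave (t \<bullet> b0 + \<delta>) ((s - t) \<bullet> b) * cis (\<eta> * ((s - t) \<bullet> b))
          else osc_wave (t \<bullet> b0 + \<delta>) ((s - t) \<bullet> b))"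
    unfolding prod.distrib[symmetric] by (intro prod.cong refl) auto
  finally show ?thesis unfolding w_def symbol[unfolded w_def] .
qed

lemma osc_wave_relation:
  "osc_wave (l + 1) y * cis (- y) + 2 * osc_wave (l + 1) y = osc_wave l y * cis y + 2 * osc_wave l y"
proof -
  have "cis ((l + 1) * theta y) = cis (l * theta y) * cis (theta y)"
    by (simp add: cis_mult distrib_right)
  then have "osc_wave (l + 1) y * cis (- y) + 2 * osc_wave (l + 1) y
      = indicator {1..2} y *\<^sub>R (cis (l * theta y) * (cis (theta y) * (2 + cis (- y))))"
    by (simp add: osc_wave_def scaleR_conv_of_real algebra_simps)
  also have "\<dots> = indicator {1..2} y *\<^sub>R (cis (l * theta y) * (2 + cis y))"
    by (simp only: cis_theta)
  also have "\<dots> = osc_wave l y * cis y + 2 * osc_wave l y"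
    by (simp add: osc_wave_def scaleR_conv_of_real algebra_simps)
  finally show ?thesis .
qed

text \<open>Summing over all subsets folds the monomials back into two products, one for each value
  of \<open>d\<close>. They agree factor by factor: the relation for the transforms handles the
  symbol and the one for the waves handles the rest.\<close>

lemma osc_kernel_relation:
  fixes b0 :: "'a::euclidean_space"
  assumes b0: "b0 \<in> Basis"
  shows "(\<Sum>j\<in>UNIV \<times> Pow (Basis - {b0}) \<times> Pow Basis.
    osc_coeff b0 j * translate_kernel (osc_shift b0 j) (osc_kernel b0) t s) = 0"
proof -
  define \<delta> \<eta> where "\<delta> d = (if d then 1 else 0 :: real)" and "\<eta> d = (if d then - 1 else 1 :: real)" for d
  define \<sigma> where "\<sigma> d = (if d then 1 else - 1 :: complex)" for d
  define l where "l = t \<bullet> b0"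
  let ?F = "\<lambda>d b. osc_transform (l + \<delta> d) (t \<bullet> b + \<eta> d) + 2 * osc_transform (l + \<delta> d) (t \<bullet> b)"
  let ?G = "\<lambda>d b. osc_wave (l + \<delta> d) ((s - t) \<bullet> b) * cis (\<eta> d * ((s - t) \<bullet> b))
      + 2 * osc_wave (l + \<delta> d) ((s - t) \<bullet> b)"
  define P where "P d = (\<Prod>b\<in>Basis - {b0}. ?F d b) * (\<Prod>b\<in>Basis. ?G d b)" for d
  let ?T = "\<lambda>j. osc_coeff b0 j * translate_kernel (osc_shift b0 j) (osc_kernel b0) t s"
  have "(\<Sum>(S, U)\<in>Pow (Basis - {b0}) \<times> Pow Basis.
      ?T (d, S, U)) = \<sigma> d * P d" for d
  proof -
    let ?f = "\<lambda>S. 2 ^ card (Basis - {b0} - S) * (\<Prod>b\<in>Basis - {b0}.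
        if b \<in> S then osc_transform (l + \<delta> d) (t \<bullet> b + \<eta> d) else osc_transform (l + \<delta> d) (t \<bullet> b))"
    let ?g = "\<lambda>U. 2 ^ card (Basis - U) * (\<Prod>b\<in>Basis.
        if b \<in> U then osc_wave (l + \<delta> d) ((s - t) \<bullet> b) * cis (\<eta> d * ((s - t) \<bullet> b))
        else osc_wave (l + \<delta> d) ((s - t) \<bullet> b))"
    have "(\<Sum>(S, U)\<in>Pow (Basis - {b0}) \<times> Pow Basis.
        ?T (d, S, U))
        = (\<Sum>(S, U)\<in>Pow (Basis - {b0}) \<times> Pow Basis. \<sigma> d * (?f S * ?g U))"
    proof (rule sum.cong[OF refl], clarify)
      fix S U :: "'a set" assume "S \<subseteq> Basis - {b0}" "U \<subseteq> Basis"
      from translate_osc_kernel[OF b0 this, of d t s]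
      show "?T (d, S, U)
          = \<sigma> d * (?f S * ?g U)"
        unfolding osc_coeff_def \<sigma>_def \<delta>_def \<eta>_def l_def by (simp only: case_prod_conv ac_simps)
    qed
    also have "\<dots> = \<sigma> d * ((\<Sum>S\<in>Pow (Basis - {b0}). ?f S) * (\<Sum>U\<in>Pow Basis. ?g U))"
      unfolding sum.cartesian_product[symmetric] sum_product by (simp only: sum_distrib_left)
    also have "\<dots> = \<sigma> d * P d"
      unfolding P_def by (subst (1 2) prod_add_two_times) auto
    finally show ?thesis .
  qed
  then have "(\<Sum>j\<in>UNIV \<times> Pow (Basis - {b0}) \<times> Pow Basis.
      ?T j) = (\<Sum>d\<in>UNIV. \<sigma> d * P d)"
    by (subst sum.cartesian_product') (simp add: case_prod_beta')
  also have "\<dots> = P True - P False" by (simp add: UNIV_bool \<sigma>_def)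
  also have "P True = P False"
  proof -
    have "?F True b = ?F False b" for b
      using osc_transform_relation[of l "t \<bullet> b"] by (simp add: \<delta>_def \<eta>_def add.commute)
    moreover have "?G True b = ?G False b" for b
      using osc_wave_relation[of l "(s - t) \<bullet> b"] by (simp add: \<delta>_def \<eta>_def)
    ultimately show ?thesis unfolding P_def by simp
  qed
  finally show ?thesis by simp
qed

text \<open>The parameters can be read off the vector: its position component has coordinate 1 or 0
  along \<open>b0\<close>, according to \<open>d\<close>, and the remaining coordinates reveal
  \<open>S\<close> and \<open>U\<close>.\<close>

lemma inj_on_osc_shift:
  fixes b0 :: "'a::euclidean_space"
  assumes b0: "b0 \<in> Basis"
  shows "inj_on (osc_shift b0) (UNIV \<times> Pow (Basis - {b0}) \<times> Pow Basis)"
proof (rule inj_onI)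
  fix j j' :: "bool \<times> 'a set \<times> 'a set"
  assume "j \<in> UNIV \<times> Pow (Basis - {b0}) \<times> Pow Basis" "j' \<in> UNIV \<times> Pow (Basis - {b0}) \<times> Pow Basis"
    and eq: "osc_shift b0 j = osc_shift b0 j'"
  then obtain d S U d' S' U' where j: "j = (d, S, U)" "j' = (d', S', U')"
    and sub: "S \<subseteq> Basis - {b0}" "U \<subseteq> Basis" "S' \<subseteq> Basis - {b0}" "U' \<subseteq> Basis" by auto
  have SB: "S \<subseteq> Basis" "S' \<subseteq> Basis" using sub by auto
  have b0b0: "b0 \<bullet> b0 = 1" using b0 by (simp add: inner_Basis)
  have "fst (osc_shift b0 j) \<bullet> b0 = (if d then 1 else 0)" "fst (osc_shift b0 j') \<bullet> b0 = (if d' then 1 else 0)"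
    using sub inner_sum_Basis[OF SB(1) b0] inner_sum_Basis[OF SB(2) b0]
    by (auto simp: j osc_shift_def inner_diff_left b0b0)
  then have d: "d = d'" unfolding eq by (auto split: if_splits)
  from eq have "\<Sum>S = \<Sum>S'" "\<Sum>U = \<Sum>U'" by (auto simp: j d osc_shift_def split: if_splits)
  moreover have "V = V'" if "V \<subseteq> Basis" "V' \<subseteq> Basis" "\<Sum>V = \<Sum>V'" for V V' :: "'a set"
  proof -
    have "b \<in> V \<longleftrightarrow> b \<in> V'" if b: "b \<in> Basis" for b
    proof -
      have "(\<Sum>V) \<bullet> b = (\<Sum>V') \<bullet> b" using \<open>\<Sum>V = \<Sum>V'\<close> by simp
      then show ?thesis
        using inner_sum_Basis[OF \<open>V \<subseteq> Basis\<close> b] inner_sum_Basis[OF \<open>V' \<subseteq> Basis\<close> b] by (auto split: if_splits)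
    qed
    then show ?thesis using that by blast
  qed
  ultimately have "S = S'" "U = U'" using SB sub by blast+
  then show "j = j'" by (simp add: j d)
qed

theorem mainTheorem2:
  fixes p :: real
  assumes "p > 4 * real CARD('n::finite) / (2 * real CARD('n) - 1)"
  shows "\<exists>A :: (real ^ 'n) L2 \<Rightarrow> (real ^ 'n) L2.
    A \<in> schatten_class p \<and> A \<noteq> (\<lambda>_. 0) \<and>
    (\<exists>(k::nat) (w :: nat \<Rightarrow> (real ^ 'n) \<times> (real ^ 'n)) (c :: nat \<Rightarrow> complex).
       k \<ge> 1 \<and> inj_on w {..<k} \<and> (\<exists>j<k. c j \<noteq> 0) \<and>
       (\<forall>\<phi>. (\<Sum>j<k. c j *\<^sub>C quantum_translate (w j) A \<phi>) = 0))"
proof -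
  obtain b0 :: "real ^ 'n" where b0: "b0 \<in> Basis" using nonempty_Basis by blast
  define A where "A = kernel_op (osc_kernel b0)"
  \<comment> \<open>One index for each monomial of the two expanded products, 2 * 2^(n-1) * 2^n =
    4^n translates in dimension n.\<close>
  define J where "J = (UNIV :: bool set) \<times> Pow (Basis - {b0}) \<times> Pow (Basis :: (real ^ 'n) set)"
  have fin: "finite J" by (simp add: J_def)
  have "J \<noteq> {}" by (auto simp: J_def)
  obtain h where h: "bij_betw h {..<card J} J"
    using ex_bij_betw_nat_finite[OF fin] by (auto simp: atLeast0LessThan)
  have card: "card J \<ge> 1" using fin \<open>J \<noteq> {}\<close> by (simp add: Suc_le_eq card_gt_0_iff)
  have "A \<in> schatten_class p"
    unfolding A_def by (rule kernel_op_osc_schatten[OF b0]) (use assms in simp)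
  moreover have "A \<noteq> (\<lambda>_. 0)" unfolding A_def by (rule kernel_op_osc_ne_zero)
  moreover have "inj_on (osc_shift b0 \<circ> h) {..<card J}"
    using h inj_on_osc_shift[OF b0] by (auto simp: bij_betw_def J_def intro!: comp_inj_on)
  moreover have "\<exists>j<card J. (osc_coeff b0 \<circ> h) j \<noteq> 0"
    using card by (intro exI[of _ 0]) (auto simp: osc_coeff_def case_prod_beta')
  moreover have "(\<Sum>j<card J. (osc_coeff b0 \<circ> h) j *\<^sub>C quantum_translate ((osc_shift b0 \<circ> h) j) A \<phi>) = 0" for \<phi>
  proof -
    have "(\<Sum>j<card J. (osc_coeff b0 \<circ> h) j *\<^sub>C quantum_translate ((osc_shift b0 \<circ> h) j) A \<phi>)
        = (\<Sum>i\<in>J. osc_coeff b0 i *\<^sub>C quantum_translate (osc_shift b0 i) A \<phi>)"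
      using sum.reindex_bij_betw[OF h, of "\<lambda>i. osc_coeff b0 i *\<^sub>C quantum_translate (osc_shift b0 i) A \<phi>"]
      by simp
    also have "\<dots> = 0"
      unfolding A_def
      by (rule quantum_translates_dependent_kernel_op[OF schur_osc_kernel square_integrable_osc_kernel])
         (unfold J_def, rule osc_kernel_relation[OF b0])
    finally show ?thesis .
  qed
  ultimately show ?thesis
    using card by blast
qed

end
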